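(* Let the data $h,f_\ell,u_\pm,t_\ell,w_\pm,w_0^\pm$ satisfy the standing assumptions listed in the context (including (A1)-(A3)). Then $u_N^+(t,y)$ and its derivatives with respect to $y$ are bounded, uniformly with respect to $y\in\mathbb R^m$, on $t\ge t_N(y)$. Similarly, $u_{-M}^-(t,y)$ and its derivatives with respect to $y$ are bounded, uniformly with respect to $y\in\mathbb R^m$, on $t\le t_{-M}(y)$.
   Context: Setup. Let $n,m,M,N\ge 1$ and $r\ge 2$ be integers, let $c_{-M}<\dots<c_0<\dots<c_{N-1}$ be real numbers, and put $c_{-M-1}=-\infty$, $c_N=+\infty$. Let $h:\mathbb R^n\times\mathbb R^m\to\mathbb R$ be $C^r$ with bounded derivatives and, for $\ell=-M,\dots,N$, let $f_\ell:\mathbb R^n\times\mathbb R^m\to\mathbb R^n$ be $C^r$, bounded together with its derivatives. Put $\Omega_\ell=\{(x,y): c_{\ell-1}\le h(x,y)<c_\ell\}$ and $f(x,y)=f_\ell(x,y)$ for $(x,y)\in\Omega_\ell$. The index $i$ refers to $1,\dots,N$, the index $j$ to $-1,\dots,-M$; $t_0(y)=0$. Subscripts $x,y$ denote partial derivatives, and $h_x$ is a row vector. For every $y\in\mathbb R^m$ there are given continuous, piecewise smooth functions $u_+(t,y)$, $t\ge0$, and $u_-(t,y)$, $t\le0$, numbers $t_{-M}(y)<\dots<t_{-1}(y)<0<t_1(y)<\dots<t_N(y)$ and $\eta>0$ (independent of $y$) such that: - for $t\ge0$: $\dot u_+=f_{i-1}(u_+,y)$ for $t_{i-1}(y)<t<t_i(y)$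 ($i=1,\dots,N$) and $\dot u_+=f_N(u_+,y)$ for $t>t_N(y)$; $h(u_+(t_i(y),y),y)=c_{i-1}$ and $h_x(u_+(t_i(y),y),y)\dot u_+(t_i(y)^\pm,y)>2\eta$; $c_{i-1}<h(u_+(t,y),y)<c_i$ for $t_i(y)<t<t_{i+1}(y)$ ($i=0,\dots,N-1$) and $h(u_+(t,y),y)>c_{N-1}$ for $t>t_N(y)$; - for $t\le0$: $\dot u_-=f_{j+1}(u_-,y)$ for $t_j(y)<t<t_{j+1}(y)$ ($j=-1,\dots,-M$) and $\dot u_-=f_{-M}(u_-,y)$ for $t<t_{-M}(y)$; $h(u_-(t_j(y),y),y)=c_j$ and $h_x(u_-(t_j(y),y),y)\dot u_-(t_j(y)^\pm,y)>2\eta$; $c_j<h(u_-(t,y),y)<c_{j+1}$ for $t_j(y)<t<t_{j+1}(y)$ and $h(u_-(t,y),y)<c_{-M}$ for $t<t_{-M}(y)$. Moreover: (A1) $w_0^\pm(y):=u_\pm(0,y)$ are $C^r$, bounded together with their derivatives, with values in an open bounded set $B\subset\mathbb R^n$ with $\overline B\times\mathbb R^m\subset\Omega_0$. (A2) There are smooth bounded functions $w_\pm(y)$ and $\mu_0>0$ with $f_N(w_+(y),y)=0=f_{-M}(w_-(y),y)$, $h(w_+(y),y)-c_{N-1}>\mu_0$, $h(w_-(y),y)-c_{-M}<-\mu_0$ for all $y$, and $\lim_{t\to\pm\infty}(u_\pm(t,y)-w_\pm(y))=0$ uniformly in $y\in\mathbb R^m$. (A3) There are $k$ and $\delta_0>0$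 such that for every $y$ each of $f_{N,x}(w_+(y),y)$ and $f_{-M,x}(w_-(y),y)$ has $k$ eigenvalues with negative real part and $n-k$ with positive real part (with multiplicity), and all of them satisfy $|\mathrm{Re}\,\lambda(y)|>\delta_0$. $u_N^+(t,y)$ is the solution of $\dot x=f_N(x,y)$ with $u_N^+(t_N(y),y)=u_+(t_N(y),y)$ (so $u_N^+=u_+$ for $t\ge t_N(y)$), and $u_{-M}^-(t,y)$ is the solution of $\dot x=f_{-M}(x,y)$ with $u_{-M}^-(t_{-M}(y),y)=u_-(t_{-M}(y),y)$ (so $u^-_{-M}=u_-$ for $t\le t_{-M}(y)$). "Derivatives" are those of order up to $r$. *)

theory Defs
  imports "HOL-Analysis.Analysis" "HOL-Computational_Algebra.Computational_Algebra"
begin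

(* nderiv f [v1, ..., vk] x is the k-th derivative D^k f(x) applied to (v1, ..., vk).
   It is meaningful only where the lower order derivatives are differentiable. *)
primrec nderiv ::
  "('a::real_normed_vector \<Rightarrow> 'b::real_normed_vector) \<Rightarrow> 'a list \<Rightarrow> 'a \<Rightarrow> 'b" where
  "nderiv f [] = f"
| "nderiv f (v # vs) = (\<lambda>x. frechet_derivative (nderiv f vs) (at x) v)"

(* Functions of class C^r on a whole (finite-dimensional) space. *)
definition C_class ::
  "nat \<Rightarrow> ('a::euclidean_space \<Rightarrow> 'b::euclidean_space) \<Rightarrow> bool" where
  "C_class r f \<longleftrightarrow>
     (\<forall>vs. length vs < r \<longrightarrow> (\<forall>x. nderiv f vs differentiable (at x))) \<and>
     (\<forall>vs. length vs \<le> r \<longrightarrow> continuous_on UNIV (nderiv f vs))"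

(* The norm of the k-linear map D^k f(x) is at most K. For k = 0 this bounds f(x) itself. *)
definition nderiv_norm_le ::
  "nat \<Rightarrow> ('a::real_normed_vector \<Rightarrow> 'b::real_normed_vector) \<Rightarrow> 'a \<Rightarrow> real \<Rightarrow> bool" where
  "nderiv_norm_le k f x K \<longleftrightarrow>
     (\<forall>vs. length vs = k \<and> (\<forall>v\<in>set vs. norm v \<le> 1) \<longrightarrow> norm (nderiv f vs x) \<le> K)"

(* The convention c_{-M-1} = -oo, c_N = +oo. *)
definition threshold :: "int \<Rightarrow> int \<Rightarrow> (int \<Rightarrow> real) \<Rightarrow> int \<Rightarrow> ereal" where
  "threshold M N c l =
     (if l < - M then - \<infinity> else if l \<ge> N then \<infinity> else ereal (c l))"

definition Omega ::
  "int \<Rightarrow> int \<Rightarrow> (int \<Rightarrow> real) \<Rightarrow> ('p \<Rightarrow> real) \<Rightarrow> int \<Rightarrow> 'p set" where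
  "Omega M N c h l =
     {p. threshold M N c (l - 1) \<le> ereal (h p) \<and> ereal (h p) < threshold M N c l}"

(* The partial derivative g_x(x, y) at p = (x, y), as a linear map; for scalar g it is the
   row vector g_x acting on column vectors. *)
definition partial_x ::
  "('a::real_normed_vector \<times> 'b \<Rightarrow> 'c::real_normed_vector) \<Rightarrow> 'a \<times> 'b \<Rightarrow> 'a \<Rightarrow> 'c" where
  "partial_x g p = frechet_derivative (\<lambda>x. g (x, snd p)) (at (fst p))"

definition charpoly :: "real^'n^'n \<Rightarrow> complex poly" where
  "charpoly A = det (mat [:0, 1:] - (\<chi> i j. [:complex_of_real (A $ i $ j):]))"

(* Complex eigenvalues, repeated according to algebraic multiplicity. *)
definition eigenvalues :: "real^'n^'n \<Rightarrow> complex multiset" where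
  "eigenvalues A = proots (charpoly A)"

definition hyperbolic_splitting :: "nat \<Rightarrow> real \<Rightarrow> real^'n^'n \<Rightarrow> bool" where
  "hyperbolic_splitting k \<delta> A \<longleftrightarrow>
     size {#z \<in># eigenvalues A. Re z < 0#} = k \<and>
     size {#z \<in># eigenvalues A. Re z > 0#} = CARD('n) - k \<and>
     (\<forall>z\<in>#eigenvalues A. \<bar>Re z\<bar> > \<delta>)"

end

theory Submission
  imports Defs "HOL-Real_Asymp.Real_Asymp"
begin

unbundle no fps_syntax

text \<open>The outer solution solves u' = f(u, y) with an equation that depends smoothly on y, starting from a point that
is reached after finitely many crossings. Two things have to be shown: that this starting point, and the time
at which it is reached, are smooth with bounds uniform in y, and that the uniform bounds survive for all later
times. The second is the heart of the matter, because the equilibrium w(y) has unstable directions, in which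
derivatives of solutions usually grow exponentially.

What saves the bounds is that the whole family is known to stay near w(y). Consider v' = A(s) v + g with A(s)
close to a hyperbolic matrix. A solution that is known a priori to be bounded on the half-line is controlled by
its initial value and by g: the stable directions decay, and in the unstable ones a bounded solution is
determined by integrating backwards from infinity. The estimate |v| \<le> C (|v(0)| + sup |g|) for bounded v is
the predicate stable_on. It holds on bounded time intervals by Gronwall's inequality (stable_on_interval)
and on the half-line for small perturbations of matrices without spectrum near the imaginary axis, with a constant that
depends only on the norm, the dimension and the width of the spectral gap (stable_on_spectral_gap).

Differences of two solutions of u' = f(u, y) at nearby parameters are bounded and solve such a linear equation
up to small errors. Hence the solution is Lipschitz in y, uniformly in time; its difference quotients are
Cauchy, uniformly in time; their limit solves the variational equation and is bounded, so that the same
argument applies to it and yields the higher derivatives one after the other (nonlinear_ode_uniform_C). This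
gives existence, continuity and uniform bounds of all derivatives together, for finite and for infinite time
intervals.

The starting point is handled by induction over the crossings: each crossing time is an implicit function of y,
nondegenerate because the orbit crosses with speed at least 2 \<eta> (crossing_time_bounded_C), and uniformly bounded
because the orbits converge to w uniformly while h(w) is bounded away from the last threshold. The backward
orbits are the forward orbits of the time-reversed system.\<close>

section \<open>Families of class C^j with uniform bounds\<close>

definition uniformly_bounded :: "'i set \<Rightarrow> ('i \<Rightarrow> 'a \<Rightarrow> 'b::real_normed_vector) \<Rightarrow> bool" where
  "uniformly_bounded I g \<longleftrightarrow> (\<exists>K. \<forall>i\<in>I. \<forall>y. norm (g i y) \<le> K)"

definition equicontinuous ::
  "'i set \<Rightarrow> ('i \<Rightarrow> 'a::topological_space \<Rightarrow> 'b::metric_space) \<Rightarrow> bool" where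
  "equicontinuous I g \<longleftrightarrow> (\<forall>y. uniform_limit I (\<lambda>z i. g i z) (\<lambda>i. g i y) (at y))"

text \<open>Functions of y that carry an index i, later the time, and that are of class C^j in y with bounds on all
derivatives of order at most j that are uniform in i and y. The derivatives of highest order are required to be
equicontinuous, because limits of difference quotients have to be taken uniformly in time. Using one
direction w at a time keeps all derivatives in the same type, so that induction on j is possible.\<close>

primrec uniform_C ::
  "nat \<Rightarrow> 'i set \<Rightarrow> ('i \<Rightarrow> 'a::euclidean_space \<Rightarrow> 'b::euclidean_space) \<Rightarrow> bool" where
  "uniform_C 0 I g \<longleftrightarrow> uniformly_bounded I g \<and> equicontinuous I g"
| "uniform_C (Suc j) I g \<longleftrightarrow> uniformly_bounded I g \<and>
     (\<exists>g'. (\<forall>i\<in>I. \<forall>y. (g i has_derivative g' i y) (at y)) \<and>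
           (\<forall>w. uniform_C j I (\<lambda>i y. g' i y w)))"

text \<open>A single function is a family over a one-point index set.\<close>

abbreviation bounded_C :: "nat \<Rightarrow> ('a::euclidean_space \<Rightarrow> 'b::euclidean_space) \<Rightarrow> bool" where
  "bounded_C j f \<equiv> uniform_C j (UNIV :: unit set) (\<lambda>_. f)"

lemma uniform_C_bounded: "uniform_C j I g \<Longrightarrow> uniformly_bounded I g"
  by (cases j) auto

lemma linear_norm_le_sum_Basis:
  fixes L :: "'a::euclidean_space \<Rightarrow> 'b::real_normed_vector"
  assumes "linear L"
  shows "norm (L w) \<le> (\<Sum>b\<in>Basis. norm (L b)) * norm w"
proof -
  have "L w = L (\<Sum>b\<in>Basis. (w \<bullet> b) *\<^sub>R b)"
    by (simp add: euclidean_representation)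
  also have "\<dots> = (\<Sum>b\<in>Basis. (w \<bullet> b) *\<^sub>R L b)"
    using assms by (simp add: linear_sum linear_cmul)
  also have "norm \<dots> \<le> (\<Sum>b\<in>Basis. \<bar>w \<bullet> b\<bar> * norm (L b))"
    by (rule order_trans[OF norm_sum]) simp
  also have "\<dots> \<le> (\<Sum>b\<in>Basis. norm w * norm (L b))"
    by (intro sum_mono mult_right_mono Basis_le_norm) auto
  finally show ?thesis
    by (simp add: sum_distrib_left mult.commute)
qed

lemma linear_eq_sum_Basis:
  fixes L :: "'a::euclidean_space \<Rightarrow> 'b::real_normed_vector"
  assumes "linear L"
  shows "L w = (\<Sum>b\<in>Basis. (w \<bullet> b) *\<^sub>R L b)"
proof -
  have "L w = L (\<Sum>b\<in>Basis. (w \<bullet> b) *\<^sub>R b)"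
    by (simp add: euclidean_representation)
  then show ?thesis
    using assms by (simp add: linear_sum linear_cmul)
qed

text \<open>A bound for each direction is a bound for the operator norm, because a basis is finite.\<close>

lemma uniformly_bounded_Basis:
  fixes g' :: "'i \<Rightarrow> 'a::euclidean_space \<Rightarrow> 'c::euclidean_space \<Rightarrow> 'b::euclidean_space"
  assumes lin: "\<And>i y. i \<in> I \<Longrightarrow> linear (g' i y)"
    and b: "\<And>w. uniformly_bounded I (\<lambda>i y. g' i y w)"
  shows "\<exists>K\<ge>0. \<forall>i\<in>I. \<forall>y w. norm (g' i y w) \<le> K * norm w"
proof -
  from b have "\<forall>w. \<exists>K. \<forall>i\<in>I. \<forall>y. norm (g' i y w) \<le> K"
    by (auto simp: uniformly_bounded_def)
  then obtain K where K: "\<And>w i y. i \<in> I \<Longrightarrow> norm (g' i y w) \<le> K w"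
    by metis
  show ?thesis
  proof (intro exI[of _ "\<Sum>b\<in>Basis. \<bar>K b\<bar>"] conjI ballI allI)
    fix i y w assume i: "i \<in> I"
    have "norm (g' i y w) \<le> (\<Sum>b\<in>Basis. norm (g' i y b)) * norm w"
      by (rule linear_norm_le_sum_Basis[OF lin[OF i]])
    also have "\<dots> \<le> (\<Sum>b\<in>Basis. \<bar>K b\<bar>) * norm w"
      using order_trans[OF K[OF i] abs_ge_self] by (intro mult_right_mono sum_mono) auto
    finally show "norm (g' i y w) \<le> (\<Sum>b\<in>Basis. \<bar>K b\<bar>) * norm w" .
  qed (auto intro: sum_nonneg)
qed

lemma uniform_C_Suc_D:
  assumes "uniform_C (Suc j) I g"
  obtains g' K where "\<And>i y. i \<in> I \<Longrightarrow> (g i has_derivative g' i y) (at y)"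
    "\<And>w. uniform_C j I (\<lambda>i y. g' i y w)"
    "K \<ge> 0" "\<And>i y w. i \<in> I \<Longrightarrow> norm (g' i y w) \<le> K * norm w"
proof -
  from assms obtain g' where g': "\<And>i y. i \<in> I \<Longrightarrow> (g i has_derivative g' i y) (at y)"
    and C: "\<And>w. uniform_C j I (\<lambda>i y. g' i y w)" by auto
  obtain K where "K \<ge> 0" "\<forall>i\<in>I. \<forall>y w. norm (g' i y w) \<le> K * norm w"
    using uniformly_bounded_Basis[of I g'] g' C uniform_C_bounded has_derivative_linear
    by (metis (no_types, lifting))
  with g' C that show thesis by blast
qed

lemma uniform_C_Suc_I:
  assumes "uniformly_bounded I g" "\<And>i y. i \<in> I \<Longrightarrow> (g i has_derivative g' i y) (at y)"
    "\<And>w. uniform_C j I (\<lambda>i y. g' i y w)"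
  shows "uniform_C (Suc j) I g"
  using assms by auto

lemma Lipschitz_from_derivative_bound:
  fixes g :: "'a::euclidean_space \<Rightarrow> 'b::euclidean_space"
  assumes "\<And>y. (g has_derivative g' y) (at y)" "\<And>y w. norm (g' y w) \<le> K * norm w"
  shows "norm (g z - g y) \<le> K * norm (z - y)"
proof (rule differentiable_bound[of UNIV g g'])
  show "onorm (g' x) \<le> K" for x by (rule onorm_le) (rule assms)
qed (use assms in auto)

lemma uniform_C_Suc_Lipschitz:
  assumes "uniform_C (Suc j) I g"
  obtains K where "K \<ge> 0" "\<And>i y z. i \<in> I \<Longrightarrow> norm (g i z - g i y) \<le> K * norm (z - y)"
  using uniform_C_Suc_D[OF assms] Lipschitz_from_derivative_bound by metis

lemma equicontinuous_Lipschitz: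
  fixes g :: "'i \<Rightarrow> 'a::real_normed_vector \<Rightarrow> 'b::real_normed_vector"
  assumes "\<And>i y z. i \<in> I \<Longrightarrow> norm (g i z - g i y) \<le> K * norm (z - y)"
  shows "equicontinuous I g"
  unfolding equicontinuous_def
proof
  fix y :: 'a
  have "((\<lambda>z. K * norm (z - y)) \<longlongrightarrow> K * norm (y - y)) (at y)"
    by (intro tendsto_intros)
  then have lim: "((\<lambda>z. K * norm (z - y)) \<longlongrightarrow> 0) (at y)" by simp
  show "uniform_limit I (\<lambda>z i. g i z) (\<lambda>i. g i y) (at y)"
  proof (rule uniform_limitI)
    fix e :: real assume "e > 0"
    from order_tendstoD(2)[OF lim this]
    show "\<forall>\<^sub>F z in at y. \<forall>i\<in>I. dist (g i z) (g i y) < e"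
      by eventually_elim (auto simp: dist_norm intro: le_less_trans[OF assms])
  qed
qed

lemma uniform_C_equicontinuous: "uniform_C j I g \<Longrightarrow> equicontinuous I g"
proof (cases j)
  case (Suc k)
  assume "uniform_C j I g"
  then obtain K where "K \<ge> 0" "\<And>i y z. i \<in> I \<Longrightarrow> norm (g i z - g i y) \<le> K * norm (z - y)"
    using Suc uniform_C_Suc_Lipschitz by metis
  then show ?thesis by (blast intro: equicontinuous_Lipschitz)
qed auto

lemma uniform_C_Suc_imp: "uniform_C (Suc j) I g \<Longrightarrow> uniform_C j I g"
proof (induction j arbitrary: g)
  case 0
  then show ?case using uniform_C_equicontinuous[OF 0] by auto
next
  case (Suc j)
  from Suc.prems obtain g' where b: "uniformly_bounded I g"
    and d: "\<And>i y. i \<in> I \<Longrightarrow> (g i has_derivative g' i y) (at y)"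
    and C: "\<And>w. uniform_C (Suc j) I (\<lambda>i y. g' i y w)" by auto
  show ?case
    by (rule uniform_C_Suc_I[OF b d]) (use Suc.IH C in auto)
qed

lemma uniform_C_mono: "uniform_C j I g \<Longrightarrow> k \<le> j \<Longrightarrow> uniform_C k I g"
  by (induction j) (auto simp: le_Suc_eq intro: uniform_C_Suc_imp simp del: uniform_C.simps)

lemma uniform_C_cong:
  assumes "\<And>i y. i \<in> I \<Longrightarrow> g i y = g2 i y" "uniform_C j I g"
  shows "uniform_C j I g2"
  using assms
proof (induction j arbitrary: g g2)
  case 0
  have "uniform_limit I (\<lambda>z i. g i z) (\<lambda>i. g i y) (at y) =
        uniform_limit I (\<lambda>z i. g2 i z) (\<lambda>i. g2 i y) (at y)" for y
    by (rule uniform_limit_cong) (use 0 in auto)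
  with 0 show ?case by (auto simp: uniformly_bounded_def equicontinuous_def)
next
  case (Suc j)
  from Suc.prems(2) obtain g' where b: "uniformly_bounded I g"
    and d: "\<And>i y. i \<in> I \<Longrightarrow> (g i has_derivative g' i y) (at y)"
    and C: "\<And>w. uniform_C j I (\<lambda>i y. g' i y w)" by auto
  have "g i = g2 i" if "i \<in> I" for i using Suc.prems that by auto
  with d have d2: "\<And>i y. i \<in> I \<Longrightarrow> (g2 i has_derivative g' i y) (at y)" by metis
  have "uniformly_bounded I g2" using b Suc.prems(1) by (simp add: uniformly_bounded_def)
  then show ?case using d2 C by (rule uniform_C_Suc_I)
qed

text \<open>Passing to a family whose members all occur in the original one keeps every uniform bound; this selects one time
and turns a function without index into a constant family.\<close>

lemma uniform_C_reindex:
  assumes "uniform_C j I g" "\<And>k. k \<in> J \<Longrightarrow> \<sigma> k \<in> I"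
  shows "uniform_C j J (\<lambda>k. g (\<sigma> k))"
  using assms(1)
proof (induction j arbitrary: g)
  case 0
  have "uniform_limit J (\<lambda>z k. g (\<sigma> k) z) (\<lambda>k. g (\<sigma> k) y) (at y)" for y
  proof (rule uniform_limitI)
    fix e :: real assume "e > 0"
    with 0 have "\<forall>\<^sub>F z in at y. \<forall>i\<in>I. dist (g i z) (g i y) < e"
      by (auto simp: equicontinuous_def uniform_limit_iff)
    then show "\<forall>\<^sub>F z in at y. \<forall>k\<in>J. dist (g (\<sigma> k) z) (g (\<sigma> k) y) < e"
      by eventually_elim (use assms(2) in auto)
  qed
  moreover have "uniformly_bounded J (\<lambda>k. g (\<sigma> k))"
    using 0 assms(2) unfolding uniform_C.simps uniformly_bounded_def by blast
  ultimately show ?case by (auto simp: equicontinuous_def)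
next
  case (Suc j)
  from Suc.prems obtain g' where b: "uniformly_bounded I g"
    and d: "\<And>i y. i \<in> I \<Longrightarrow> (g i has_derivative g' i y) (at y)"
    and C: "\<And>w. uniform_C j I (\<lambda>i y. g' i y w)" by auto
  have "uniformly_bounded J (\<lambda>k. g (\<sigma> k))"
    using b assms(2) unfolding uniformly_bounded_def by blast
  then show ?case
    by (rule uniform_C_Suc_I[where g' = "\<lambda>k. g' (\<sigma> k)"])
       (use d assms(2) Suc.IH[OF C] in auto)
qed

lemma uniform_C_const_family: "bounded_C j f \<Longrightarrow> uniform_C j I (\<lambda>_. f)"
  using uniform_C_reindex[of j UNIV "\<lambda>_. f" I "\<lambda>_. ()"] by simp

lemma uniform_C_const: "uniform_C j I (\<lambda>i y. c)"
proof (induction j arbitrary: c)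
  case 0
  then show ?case by (auto simp: uniformly_bounded_def equicontinuous_def intro: uniform_limit_const)
next
  case (Suc j)
  show ?case
    by (rule uniform_C_Suc_I[where g' = "\<lambda>_ _ _. 0"]) (use Suc in \<open>auto simp: uniformly_bounded_def\<close>)
qed

lemma uniform_C_linear:
  assumes "bounded_linear T"
  shows "uniform_C j I g \<Longrightarrow> uniform_C j I (\<lambda>i y. T (g i y))"
proof (induction j arbitrary: g)
  case 0
  interpret bounded_linear T by fact
  have "uniformly_bounded I (\<lambda>i y. T (g i y))"
    using 0 assms unfolding uniform_C.simps uniformly_bounded_def
    by (metis bounded mult.commute mult_left_mono norm_ge_zero order_trans nonneg_bounded)
  then show ?case using 0 by (simp add: equicontinuous_def uniform_limit)
next
  case (Suc j)
  interpret bounded_linear T by fact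
  from Suc.prems obtain g' where b: "uniformly_bounded I g"
    and d: "\<And>i y. i \<in> I \<Longrightarrow> (g i has_derivative g' i y) (at y)"
    and C: "\<And>w. uniform_C j I (\<lambda>i y. g' i y w)" by auto
  have "uniformly_bounded I (\<lambda>i y. T (g i y))"
    using b unfolding uniform_C.simps uniformly_bounded_def
    by (metis bounded mult.commute mult_left_mono norm_ge_zero order_trans nonneg_bounded)
  then show ?case
  proof (rule uniform_C_Suc_I)
    show "((\<lambda>y. T (g i y)) has_derivative (\<lambda>w. T (g' i y w))) (at y)" if "i \<in> I" for i y
      by (rule has_derivative[OF d[OF that]])
    show "uniform_C j I (\<lambda>i y. T (g' i y w))" for w
      by (rule Suc.IH[OF C])
  qed
qed

lemma uniformly_bounded_add:
  "uniformly_bounded I g \<Longrightarrow> uniformly_bounded I h \<Longrightarrow> uniformly_bounded I (\<lambda>i y. g i y + h i y)"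
  unfolding uniformly_bounded_def by (meson norm_triangle_mono)

lemma uniformly_bounded_scaleR:
  assumes "uniformly_bounded I a" "uniformly_bounded I h"
  shows "uniformly_bounded I (\<lambda>i y. a i y *\<^sub>R h i y)"
proof -
  from assms obtain K L where "\<forall>i\<in>I. \<forall>y. norm (a i y) \<le> K" "\<forall>i\<in>I. \<forall>y. norm (h i y) \<le> L"
    unfolding uniformly_bounded_def by blast
  then have "\<forall>i\<in>I. \<forall>y. norm (a i y *\<^sub>R h i y) \<le> K * L"
    by (auto intro!: mult_mono intro: order_trans[OF abs_ge_zero] order_trans[OF norm_ge_zero])
  then show ?thesis unfolding uniformly_bounded_def by blast
qed

lemma uniform_C_add:
  "uniform_C j I g \<Longrightarrow> uniform_C j I h \<Longrightarrow> uniform_C j I (\<lambda>i y. g i y + h i y)"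
proof (induction j arbitrary: g h)
  case 0
  then show ?case
    by (auto simp: equicontinuous_def intro: uniformly_bounded_add uniform_limit_add)
next
  case (Suc j)
  from Suc.prems(1) obtain g' where b: "uniformly_bounded I g"
    and d: "\<And>i y. i \<in> I \<Longrightarrow> (g i has_derivative g' i y) (at y)"
    and C: "\<And>w. uniform_C j I (\<lambda>i y. g' i y w)" by auto
  from Suc.prems(2) obtain h' where b2: "uniformly_bounded I h"
    and d2: "\<And>i y. i \<in> I \<Longrightarrow> (h i has_derivative h' i y) (at y)"
    and C2: "\<And>w. uniform_C j I (\<lambda>i y. h' i y w)" by auto
  show ?case
    by (rule uniform_C_Suc_I[where g' = "\<lambda>i y w. g' i y w + h' i y w"])
       (use b b2 d d2 C C2 Suc.IH in \<open>auto intro: uniformly_bounded_add has_derivative_add\<close>)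
qed

lemma uniform_C_sum:
  assumes "finite A" "\<And>a. a \<in> A \<Longrightarrow> uniform_C j I (g a)"
  shows "uniform_C j I (\<lambda>i y. \<Sum>a\<in>A. g a i y)"
  using assms by (induction A) (auto simp: uniform_C_const uniform_C_add simp del: uniform_C.simps)

lemma uniform_C_scaleR:
  "uniform_C j I a \<Longrightarrow> uniform_C j I h \<Longrightarrow> uniform_C j I (\<lambda>i y. a i y *\<^sub>R h i y)"
proof (induction j arbitrary: a h)
  case 0
  have "uniform_limit I (\<lambda>z i. a i z *\<^sub>R h i z) (\<lambda>i. a i y *\<^sub>R h i y) (at y)" for y
  proof (rule bounded_bilinear.bounded_uniform_limit[OF bounded_bilinear_scaleR])
    show "uniform_limit I (\<lambda>z i. a i z) (\<lambda>i. a i y) (at y)"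
      "uniform_limit I (\<lambda>z i. h i z) (\<lambda>i. h i y) (at y)"
      using 0 by (simp_all add: equicontinuous_def)
    show "bounded ((\<lambda>i. a i y) ` I)" "bounded ((\<lambda>i. h i y) ` I)"
      using 0 unfolding uniform_C.simps uniformly_bounded_def bounded_iff by blast+
  qed
  with 0 show ?case
    by (auto simp: equicontinuous_def intro: uniformly_bounded_scaleR)
next
  case (Suc j)
  from Suc.prems(1) obtain a' where b: "uniformly_bounded I a"
    and d: "\<And>i y. i \<in> I \<Longrightarrow> (a i has_derivative a' i y) (at y)"
    and C: "\<And>w. uniform_C j I (\<lambda>i y. a' i y w)" by auto
  from Suc.prems(2) obtain h' where b2: "uniformly_bounded I h"
    and d2: "\<And>i y. i \<in> I \<Longrightarrow> (h i has_derivative h' i y) (at y)"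
    and C2: "\<And>w. uniform_C j I (\<lambda>i y. h' i y w)" by auto
  show ?case
  proof (rule uniform_C_Suc_I)
    show "uniformly_bounded I (\<lambda>i y. a i y *\<^sub>R h i y)"
      using b b2 by (rule uniformly_bounded_scaleR)
    show "((\<lambda>y. a i y *\<^sub>R h i y) has_derivative (\<lambda>w. a i y *\<^sub>R h' i y w + a' i y w *\<^sub>R h i y)) (at y)"
      if "i \<in> I" for i y
      using has_derivative_scaleR[OF d[OF that] d2[OF that]] by simp
    show "uniform_C j I (\<lambda>i y. a i y *\<^sub>R h' i y w + a' i y w *\<^sub>R h i y)" for w
      by (intro uniform_C_add Suc.IH C C2 Suc.prems[THEN uniform_C_Suc_imp])
  qed
qed

text \<open>The bound from below keeps the reciprocal away from its pole; its derivative is a product of the reciprocal and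
of q', so that the induction hypothesis applies to it.\<close>

lemma uniform_C_inverse:
  fixes q :: "'i \<Rightarrow> 'a::euclidean_space \<Rightarrow> real"
  assumes pos: "\<And>i y. i \<in> I \<Longrightarrow> q i y \<ge> \<eta>" "\<eta> > 0"
  shows "uniform_C j I q \<Longrightarrow> uniform_C j I (\<lambda>i y. inverse (q i y))"
proof (induction j)
  case (0)
  have "uniformly_bounded I (\<lambda>i y. inverse (q i y))"
    unfolding uniformly_bounded_def
    by (rule exI[of _ "inverse \<eta>"])
       (use pos in \<open>auto intro!: le_imp_inverse_le simp: abs_inverse intro: order_trans[OF _ abs_ge_self]\<close>)
  moreover have "uniform_limit I (\<lambda>z i. inverse (q i z)) (\<lambda>i. inverse (q i y)) (at y)" for y
  proof -
    have "uniform_limit I (\<lambda>z i. q i z) (\<lambda>i. q i y) (at y)"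
      using 0 by (simp add: equicontinuous_def)
    moreover have "\<eta> \<le> norm (q i y)" if "i \<in> I" for i
      using pos(1)[OF that, of y] by simp
    ultimately show ?thesis
      using uniform_lim_inverse[where f = "\<lambda>z i. q i z" and l = "\<lambda>i. q i y" and S = I and F = "at y" and b = \<eta>] pos(2)
      by (simp add: comp_def)
  qed
  ultimately show ?case by (auto simp: equicontinuous_def)
next
  case (Suc j)
  from Suc.prems obtain q' where d: "\<And>i y. i \<in> I \<Longrightarrow> (q i has_derivative q' i y) (at y)"
    and C: "\<And>w. uniform_C j I (\<lambda>i y. q' i y w)" by auto
  note IH = Suc.IH[OF uniform_C_Suc_imp[OF Suc.prems]]
  show ?case
  proof (rule uniform_C_Suc_I)
    show "uniformly_bounded I (\<lambda>i y. inverse (q i y))"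
      by (rule uniform_C_bounded[OF IH])
    show "((\<lambda>y. inverse (q i y)) has_derivative
        (\<lambda>w. - (inverse (q i y) *\<^sub>R q' i y w *\<^sub>R inverse (q i y)))) (at y)" if "i \<in> I" for i y
      using Deriv.has_derivative_inverse[OF _ d[OF that]] pos(1)[OF that, of y] pos(2) by (simp add: mult.assoc)
    show "uniform_C j I (\<lambda>i y. - (inverse (q i y) *\<^sub>R q' i y w *\<^sub>R inverse (q i y)))" for w
      by (intro uniform_C_linear[OF bounded_linear_minus[OF bounded_linear_ident]] uniform_C_scaleR IH C)
  qed
qed

lemma bounded_C_Suc_D:
  assumes "bounded_C (Suc j) f"
  obtains f' where "\<And>x. (f has_derivative f' x) (at x)" "\<And>w. bounded_C j (\<lambda>x. f' x w)"
proof -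
  from assms obtain F where F: "\<And>i x. (f has_derivative F (i::unit) x) (at x)"
    and C: "\<And>w. uniform_C j (UNIV::unit set) (\<lambda>i x. F i x w)" by auto
  have "bounded_C j (\<lambda>x. F () x w)" for w
    by (rule uniform_C_cong[OF _ C]) simp
  with F show thesis by (rule that)
qed

lemma uniform_C_derivative:
  assumes "uniform_C (Suc j) I g" "\<And>i y. i \<in> I \<Longrightarrow> (g i has_derivative g' i y) (at y)"
  shows "uniform_C j I (\<lambda>i y. g' i y w)"
proof -
  from assms(1) obtain G where G: "\<And>i y. i \<in> I \<Longrightarrow> (g i has_derivative G i y) (at y)"
    and C: "\<And>w. uniform_C j I (\<lambda>i y. G i y w)" by auto
  show ?thesis
    by (rule uniform_C_cong[OF _ C[of w]]) (use has_derivative_unique[OF G assms(2)] in auto)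
qed

text \<open>The inner function has an unbounded linear part because vector fields are evaluated at (u(s, y), y), where the
second component is the unbounded parameter itself.\<close>

lemma uniform_C_compose:
  fixes f :: "'c::euclidean_space \<Rightarrow> 'b::euclidean_space"
    and g :: "'i \<Rightarrow> 'a::euclidean_space \<Rightarrow> 'c"
  assumes L: "bounded_linear L"
  shows "bounded_C j f \<Longrightarrow> uniform_C j I g \<Longrightarrow> uniform_C j I (\<lambda>i y. f (L y + g i y))"
proof (induction j arbitrary: f g)
  case 0
  have cont: "isCont f x" for x
    using 0(1) uniform_limitD
    by (auto simp: equicontinuous_def isCont_def tendsto_iff uniform_limit_iff)
  have "uniform_limit I (\<lambda>z i. f (L z + g i z)) (\<lambda>i. f (L y + g i y)) (at y)" for y
  proof -
    obtain K where K: "\<forall>i\<in>I. \<forall>y. norm (g i y) \<le> K"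
      using 0(2) by (auto simp: uniformly_bounded_def)
    let ?S = "cball (L y) (K + 1)"
    have lim: "uniform_limit I (\<lambda>z i. L z + g i z) (\<lambda>i. L y + g i y) (at y)"
    proof (rule uniform_limit_add)
      show "uniform_limit I (\<lambda>z i. L z) (\<lambda>i. L y) (at y)"
        using linear_continuous_at[OF L, of y]
        by (auto simp: uniform_limit_iff isCont_def tendsto_iff elim!: eventually_mono)
      show "uniform_limit I (\<lambda>z i. g i z) (\<lambda>i. g i y) (at y)"
        using 0(2) by (auto simp: equicontinuous_def)
    qed
    have in_S: "\<forall>i\<in>I. L y + g i y \<in> ?S"
      using K by (auto simp: dist_norm intro: order_trans[of _ K])
    have "\<forall>\<^sub>F z in at y. \<forall>i\<in>I. dist (L z + g i z) (L y + g i y) < 1"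
      using uniform_limitD[OF lim, of 1] by simp
    then have ev: "\<forall>\<^sub>F z in at y. \<forall>i\<in>I. L z + g i z \<in> ?S"
    proof eventually_elim
      case (elim z)
      have "dist (L y) (L z + g i z) \<le> K + 1" if i: "i \<in> I" for i
      proof -
        have "dist (L y) (L z + g i z) \<le> dist (L y) (L y + g i y) + dist (L y + g i y) (L z + g i z)"
          by (rule dist_triangle)
        also have "\<dots> \<le> K + 1"
          using K i elim by (intro add_mono) (auto simp: dist_norm norm_minus_commute less_imp_le)
        finally show ?thesis .
      qed
      then show ?case by simp
    qed
    \<comment> \<open>Boundedness of g in the index puts all values near y into one compact ball, where f is uniformly continuous.\<close>
    have uc: "uniformly_continuous_on ?S f"
      by (intro compact_uniformly_continuous continuous_at_imp_continuous_on ballI cont compact_cball)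
    show ?thesis
    proof (rule uniform_limitI)
      fix e :: real assume "e > 0"
      with uc obtain d where d: "d > 0" "\<And>x x'. x \<in> ?S \<Longrightarrow> x' \<in> ?S \<Longrightarrow> dist x' x < d \<Longrightarrow> dist (f x') (f x) < e"
        unfolding uniformly_continuous_on_def by metis
      have "\<forall>\<^sub>F z in at y. \<forall>i\<in>I. dist (L z + g i z) (L y + g i y) < d"
        using uniform_limitD[OF lim d(1)] .
      with ev show "\<forall>\<^sub>F z in at y. \<forall>i\<in>I. dist (f (L z + g i z)) (f (L y + g i y)) < e"
        by eventually_elim (use d in_S in auto)
    qed
  qed
  moreover have "uniformly_bounded I (\<lambda>i y. f (L y + g i y))"
    using 0(1) by (auto simp: uniformly_bounded_def)
  ultimately show ?case by (auto simp: equicontinuous_def)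
next
  case (Suc j)
  have bf: "uniformly_bounded (UNIV::unit set) (\<lambda>_. f)"
    using Suc.prems(1) by (rule uniform_C_bounded)
  obtain f' where df: "\<And>x. (f has_derivative f' x) (at x)"
    and Cf: "\<And>w. bounded_C j (\<lambda>x. f' x w)"
    using bounded_C_Suc_D[OF Suc.prems(1)] by blast
  from Suc.prems(2) obtain g' where bg: "uniformly_bounded I g"
    and dg: "\<And>i y. i \<in> I \<Longrightarrow> (g i has_derivative g' i y) (at y)"
    and Cg: "\<And>w. uniform_C j I (\<lambda>i y. g' i y w)" by auto
  have dL: "(L has_derivative L) (at y)" for y
    using L by (rule bounded_linear_imp_has_derivative)
  show ?case
  proof (rule uniform_C_Suc_I)
    show "uniformly_bounded I (\<lambda>i y. f (L y + g i y))"
      using bf by (auto simp: uniformly_bounded_def)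
    show "((\<lambda>y. f (L y + g i y)) has_derivative
       (\<lambda>w. \<Sum>b\<in>Basis. ((L w + g' i y w) \<bullet> b) *\<^sub>R f' (L y + g i y) b)) (at y)" if "i \<in> I" for i y
    proof -
      have "((\<lambda>y. f (L y + g i y)) has_derivative (\<lambda>w. f' (L y + g i y) (L w + g' i y w))) (at y)"
        by (rule has_derivative_compose[OF has_derivative_add[OF dL dg[OF that]] df])
      then show ?thesis
        by (subst (asm) linear_eq_sum_Basis[OF has_derivative_linear[OF df]])
    qed
    show "uniform_C j I (\<lambda>i y. \<Sum>b\<in>Basis. ((L w + g' i y w) \<bullet> b) *\<^sub>R f' (L y + g i y) b)" for w
      by (intro uniform_C_sum uniform_C_scaleR Suc.IH Cf Suc.prems(2)[THEN uniform_C_Suc_imp]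
            uniform_C_linear[OF bounded_linear_inner_left] uniform_C_add uniform_C_const Cg) auto
  qed
qed

text \<open>Pointwise differentiability with an equicontinuous derivative is differentiability uniformly in the index: by the
mean value inequality the remainder is controlled by the oscillation of the derivative near y.\<close>

lemma equicontinuous_derivative_Frechet:
  fixes g :: "'i \<Rightarrow> 'a::euclidean_space \<Rightarrow> 'b::euclidean_space"
  assumes d: "\<And>i y. i \<in> I \<Longrightarrow> (g i has_derivative g' i y) (at y)"
    and C: "\<And>w. equicontinuous I (\<lambda>i y. g' i y w)" and "e > 0"
  shows "\<forall>\<^sub>F z in at y. \<forall>i\<in>I. norm (g i z - g i y - g' i y (z - y)) \<le> e * norm (z - y)"
proof -
  \<comment> \<open>The norm of a linear map is at most the sum of its norms on the DIM('a) basis vectors.\<close>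
  define e' where "e' = e / DIM('a)"
  have "e' > 0" using \<open>e > 0\<close> by (simp add: e'_def)
  have "\<forall>\<^sub>F z in at y. \<forall>b\<in>Basis. \<forall>i\<in>I. dist (g' i z b) (g' i y b) < e'"
    using C \<open>e' > 0\<close> by (intro eventually_ball_finite) (auto simp: equicontinuous_def uniform_limit_iff)
  then obtain r where r: "r > 0"
    and lt: "\<And>z b i. z \<noteq> y \<Longrightarrow> dist z y < r \<Longrightarrow> b \<in> Basis \<Longrightarrow> i \<in> I \<Longrightarrow> dist (g' i z b) (g' i y b) < e'"
    unfolding eventually_at by blast
  have "norm (g i z - g i y - g' i y (z - y)) \<le> norm (z - y) * e" if z: "dist z y < r" and i: "i \<in> I" for z i
  proof (rule differentiable_bound_linearization[where S = "ball y r"])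
    show "y + t *\<^sub>R (z - y) \<in> ball y r" if t: "t \<in> {0..1}" for t
    proof -
      have "norm (t *\<^sub>R (z - y)) \<le> norm (z - y)" using t by (simp add: mult_left_le_one_le)
      then show ?thesis using z by (simp add: dist_norm)
    qed
    show "(g i has_derivative g' i x) (at x within ball y r)" for x
      by (rule has_derivative_at_withinI[OF d[OF i]])
    show "onorm (g' i x - g' i y) \<le> e" if x: "x \<in> ball y r" for x
    proof (rule onorm_le)
      fix w
      have lin: "linear (g' i x - g' i y)"
        unfolding fun_diff_def
        by (rule linear_compose_sub[OF has_derivative_linear[OF d[OF i]] has_derivative_linear[OF d[OF i]]])
      have "norm ((g' i x - g' i y) w) \<le> (\<Sum>b\<in>Basis. norm ((g' i x - g' i y) b)) * norm w"
        by (rule linear_norm_le_sum_Basis[OF lin])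
      also have "\<dots> \<le> (\<Sum>b\<in>(Basis::'a set). e') * norm w"
      proof (intro mult_right_mono sum_mono)
        fix b :: 'a assume "b \<in> Basis"
        then show "norm ((g' i x - g' i y) b) \<le> e'"
          using lt[of x b i] i x \<open>e' > 0\<close> by (cases "x = y") (auto simp: dist_norm norm_minus_commute)
      qed auto
      also have "\<dots> = e * norm w" by (simp add: e'_def)
      finally show "norm ((g' i x - g' i y) w) \<le> e * norm w" .
    qed
    show "y \<in> ball y r" using r by simp
  qed
  then show ?thesis
    unfolding eventually_at using r by (intro exI[of _ r]) (auto simp: mult.commute)
qed

text \<open>Two bounded derivatives give a Lipschitz derivative, and so a quadratic remainder that is uniform on the whole
space.\<close>

lemma bounded_C_Taylor:
  assumes C: "bounded_C (Suc (Suc j)) f" and d: "\<And>x. (f has_derivative f' x) (at x)"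
  obtains L where "L \<ge> 0"
    "\<And>p q w. norm (f' q w - f' p w) \<le> L * norm (q - p) * norm w"
    "\<And>p q. norm (f q - f p - f' p (q - p)) \<le> L * (norm (q - p))\<^sup>2"
proof -
  have "bounded_C (Suc j) (\<lambda>x. f' x w)" for w
    by (rule uniform_C_derivative[OF C d])
  then have "\<exists>K\<ge>0. \<forall>p q. norm (f' q w - f' p w) \<le> K * norm (q - p)" for w
    by (metis uniform_C_Suc_Lipschitz UNIV_I)
  then obtain K where K: "\<And>w. K w \<ge> 0" "\<And>w p q. norm (f' q w - f' p w) \<le> K w * norm (q - p)"
    by metis
  define L where "L = (\<Sum>b\<in>Basis. K b)"
  have L: "L \<ge> 0" unfolding L_def by (simp add: K sum_nonneg)
  have Lip: "norm (f' q w - f' p w) \<le> L * norm (q - p) * norm w" for p q w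
  proof -
    have "linear (\<lambda>w. f' q w - f' p w)"
      by (rule linear_compose_sub[OF has_derivative_linear[OF d] has_derivative_linear[OF d]])
    then have "norm (f' q w - f' p w) \<le> (\<Sum>b\<in>Basis. norm (f' q b - f' p b)) * norm w"
      by (rule linear_norm_le_sum_Basis)
    also have "\<dots> \<le> (\<Sum>b\<in>Basis. K b * norm (q - p)) * norm w"
      by (intro mult_right_mono sum_mono K) auto
    finally show ?thesis by (simp add: L_def sum_distrib_right)
  qed
  have "norm (f q - f p - f' p (q - p)) \<le> norm (q - p) * (L * norm (q - p))" for p q
  proof (rule differentiable_bound_linearization[where S = "cball p (norm (q - p))"])
    show "p + t *\<^sub>R (q - p) \<in> cball p (norm (q - p))" if t: "t \<in> {0..1}" for t
      using t by (simp add: dist_norm mult_left_le_one_le)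
    show "(f has_derivative f' x) (at x within cball p (norm (q - p)))" for x
      by (rule has_derivative_at_withinI[OF d])
    show "onorm (f' x - f' p) \<le> L * norm (q - p)" if x: "x \<in> cball p (norm (q - p))" for x
    proof (rule onorm_le)
      fix w
      have "norm ((f' x - f' p) w) \<le> L * norm (x - p) * norm w" using Lip by simp
      also have "\<dots> \<le> L * norm (q - p) * norm w"
        using x L by (intro mult_right_mono mult_left_mono) (auto simp: dist_norm norm_minus_commute)
      finally show "norm ((f' x - f' p) w) \<le> L * norm (q - p) * norm w" .
    qed
  qed simp
  then have "norm (f q - f p - f' p (q - p)) \<le> L * (norm (q - p))\<^sup>2" for p q
    by (simp add: power2_eq_square mult.commute mult.left_commute)
  with L Lip show thesis by (rule that)
qed

section \<open>Iterated directional derivatives\<close>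

lemma equicontinuous_isCont: "equicontinuous I g \<Longrightarrow> i \<in> I \<Longrightarrow> isCont (g i) y"
  by (fastforce simp: equicontinuous_def uniform_limit_iff isCont_def tendsto_iff elim: eventually_mono)

text \<open>The last direction of the list is the first one in which f is differentiated; peeling it off matches the
recursion of uniform_C.\<close>

lemma nderiv_snoc: "nderiv f (vs @ [v]) = nderiv (\<lambda>x. frechet_derivative f (at x) v) vs"
  by (induction vs) auto

lemma C_class_SucD:
  assumes "C_class (Suc r) f"
  shows "f differentiable (at x)" "C_class r (\<lambda>x. frechet_derivative f (at x) v)"
proof -
  show "f differentiable (at x)"
    using assms unfolding C_class_def by (metis length_0_conv nderiv.simps(1) zero_less_Suc)
  have "nderiv f (vs @ [v]) differentiable at x" if "length vs < r" for vs x
    using assms that unfolding C_class_def by auto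
  moreover have "continuous_on UNIV (nderiv f (vs @ [v]))" if "length vs \<le> r" for vs
    using assms that unfolding C_class_def by auto
  ultimately show "C_class r (\<lambda>x. frechet_derivative f (at x) v)"
    unfolding C_class_def by (simp add: nderiv_snoc)
qed

lemma uniform_C_imp_C_class: "uniform_C r I g \<Longrightarrow> i \<in> I \<Longrightarrow> C_class r (g i)"
proof (induction r arbitrary: g)
  case 0
  then show ?case
    using equicontinuous_isCont by (auto simp: C_class_def continuous_on_eq_continuous_at)
next
  case (Suc r)
  from Suc.prems(1) obtain g' where d: "\<And>i y. i \<in> I \<Longrightarrow> (g i has_derivative g' i y) (at y)"
    and C: "\<And>w. uniform_C r I (\<lambda>i y. g' i y w)" by auto
  have cont: "continuous_on UNIV (g i)"
    using equicontinuous_isCont[OF uniform_C_equicontinuous[OF Suc.prems(1)] Suc.prems(2)]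
    by (auto simp: continuous_on_eq_continuous_at)
  have "frechet_derivative (g i) (at x) = g' i x" for x
    using frechet_derivative_at[OF d[OF Suc.prems(2)]] by simp
  then have snoc: "nderiv (g i) (us @ [v]) = nderiv (\<lambda>x. g' i x v) us" for us v
    by (simp add: nderiv_snoc)
  have C': "C_class r (\<lambda>x. g' i x v)" for v by (rule Suc.IH[OF C Suc.prems(2)])
  have "nderiv (g i) vs differentiable at x" if "length vs < Suc r" for vs x
    using that C' differentiableI[OF d[OF Suc.prems(2)]]
    by (cases vs rule: rev_cases) (auto simp: snoc C_class_def)
  moreover have "continuous_on UNIV (nderiv (g i) vs)" if "length vs \<le> Suc r" for vs
    using that C' cont by (cases vs rule: rev_cases) (auto simp: snoc C_class_def)
  ultimately show ?case by (auto simp: C_class_def)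
qed

text \<open>Linearity in the function, needed to pass from basis directions to all directions of norm at most 1.\<close>

lemma nderiv_sum_scaleR:
  assumes "finite B" "\<And>b. b \<in> B \<Longrightarrow> C_class r (F b)" "length vs \<le> r"
  shows "nderiv (\<lambda>x. \<Sum>b\<in>B. c b *\<^sub>R F b x) vs = (\<lambda>x. \<Sum>b\<in>B. c b *\<^sub>R nderiv (F b) vs x)"
  using assms(3)
proof (induction vs)
  case (Cons v vs)
  have "(nderiv (F b) vs has_derivative frechet_derivative (nderiv (F b) vs) (at x)) (at x)" if "b \<in> B" for b x
    using assms(2)[OF that] Cons.prems
    by (intro frechet_derivative_works[THEN iffD1]) (auto simp: C_class_def)
  then have "((\<lambda>x. \<Sum>b\<in>B. c b *\<^sub>R nderiv (F b) vs x) has_derivative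
      (\<lambda>w. \<Sum>b\<in>B. c b *\<^sub>R frechet_derivative (nderiv (F b) vs) (at x) w)) (at x)" for x
    by (intro has_derivative_sum has_derivative_scaleR_right) auto
  from frechet_derivative_at[OF this, symmetric] show ?case
    using Cons by simp
qed auto

text \<open>The class provides one bound for each list of directions. Expanding the directions in the standard basis leaves
finitely many lists, so that one bound serves the whole unit ball.\<close>

lemma uniform_C_imp_nderiv_norm_le:
  "uniform_C r I g \<Longrightarrow> q \<le> r \<Longrightarrow> \<exists>K. \<forall>i\<in>I. \<forall>y. nderiv_norm_le q (g i) y K"
proof (induction q arbitrary: r g)
  case 0
  then show ?case
    using uniform_C_bounded[OF 0(1)] by (auto simp: uniformly_bounded_def nderiv_norm_le_def)
next
  case (Suc q)
  then obtain r' where r: "r = Suc r'" "q \<le> r'" by (cases r) auto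
  from Suc.prems(1) r obtain g' where d: "\<And>i y. i \<in> I \<Longrightarrow> (g i has_derivative g' i y) (at y)"
    and C: "\<And>w. uniform_C r' I (\<lambda>i y. g' i y w)" by auto
  have "\<forall>b. \<exists>K. \<forall>i\<in>I. \<forall>y. nderiv_norm_le q (\<lambda>y. g' i y b) y K"
    using Suc.IH[OF C r(2)] by blast
  then obtain K where K: "\<And>b i y. i \<in> I \<Longrightarrow> nderiv_norm_le q (\<lambda>y. g' i y b) y (K b)" by metis
  have "norm (nderiv (g i) vs y) \<le> (\<Sum>b\<in>Basis. K b)"
    if i: "i \<in> I" and vs: "length vs = Suc q" "\<forall>v\<in>set vs. norm v \<le> 1" for i y vs
  proof -
    obtain us v where us: "vs = us @ [v]" using vs(1) by (cases vs rule: rev_cases) auto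
    have v: "norm v \<le> 1" "length us = q" "\<forall>v\<in>set us. norm v \<le> 1" using vs us by auto
    have "frechet_derivative (g i) (at x) = g' i x" for x
      using frechet_derivative_at[OF d[OF i]] by simp
    then have "nderiv (g i) vs = nderiv (\<lambda>x. g' i x v) us"
      by (simp add: nderiv_snoc us)
    also have "\<dots> = nderiv (\<lambda>x. \<Sum>b\<in>Basis. (v \<bullet> b) *\<^sub>R g' i x b) us"
      by (subst linear_eq_sum_Basis[OF has_derivative_linear[OF d[OF i]]]) simp
    also have "\<dots> = (\<lambda>x. \<Sum>b\<in>Basis. (v \<bullet> b) *\<^sub>R nderiv (\<lambda>x. g' i x b) us x)"
      by (rule nderiv_sum_scaleR[where r = r'])
         (use uniform_C_imp_C_class[OF C i] v r in auto)
    finally have "norm (nderiv (g i) vs y) = norm (\<Sum>b\<in>Basis. (v \<bullet> b) *\<^sub>R nderiv (\<lambda>x. g' i x b) us y)"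
      by simp
    also have "\<dots> \<le> (\<Sum>b\<in>Basis. 1 * norm (nderiv (\<lambda>x. g' i x b) us y))"
      by (rule sum_norm_le) (use v in \<open>auto intro!: mult_left_le_one_le intro: order_trans[OF Basis_le_norm]\<close>)
    also have "\<dots> \<le> (\<Sum>b\<in>Basis. K b)"
      using K[OF i] v by (intro sum_mono) (auto simp: nderiv_norm_le_def)
    finally show ?thesis .
  qed
  then show ?case unfolding nderiv_norm_le_def by blast
qed

text \<open>Norm bounds of multilinear maps speak of directions of norm at most 1; all others follow by scaling.\<close>

lemma bounded_C_derivative_unit:
  assumes d: "\<And>x. (f has_derivative f' x) (at x)"
    and C: "\<And>v. norm v \<le> 1 \<Longrightarrow> bounded_C r (\<lambda>x. f' x v)"
  shows "bounded_C r (\<lambda>x. f' x v)"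
proof (cases "v = 0")
  case True
  then show ?thesis
    using has_derivative_linear[OF d] by (simp add: linear_0 uniform_C_const del: uniform_C.simps)
next
  case False
  have "bounded_C r (\<lambda>x. norm v *\<^sub>R f' x (inverse (norm v) *\<^sub>R v))"
    by (rule uniform_C_linear[OF bounded_linear_scaleR_right]) (rule C, use False in simp)
  then show ?thesis
    using False has_derivative_linear[OF d] by (simp add: linear_cmul del: uniform_C.simps)
qed

lemma C_class_imp_bounded_C:
  "C_class r f \<Longrightarrow> (\<And>q. q \<le> r \<Longrightarrow> \<exists>K. \<forall>x. nderiv_norm_le q f x K) \<Longrightarrow> bounded_C r f"
proof (induction r arbitrary: f)
  case 0
  have "continuous_on UNIV (nderiv f [])" using 0(1) unfolding C_class_def by blast
  then have "equicontinuous (UNIV::unit set) (\<lambda>_. f)"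
    by (auto simp: equicontinuous_def uniform_limit_iff continuous_on_eq_continuous_at isCont_def tendsto_iff)
  moreover have "uniformly_bounded (UNIV::unit set) (\<lambda>_. f)"
    using 0(2)[of 0] by (auto simp: uniformly_bounded_def nderiv_norm_le_def)
  ultimately show ?case by simp
next
  case (Suc r)
  let ?f' = "\<lambda>x. frechet_derivative f (at x)"
  have d: "(f has_derivative ?f' x) (at x)" for x
    using C_class_SucD(1)[OF Suc.prems(1)] frechet_derivative_works by blast
  have "bounded_C r (\<lambda>x. ?f' x v)" if v: "norm v \<le> 1" for v
  proof (rule Suc.IH)
    show "C_class r (\<lambda>x. ?f' x v)" by (rule C_class_SucD(2)[OF Suc.prems(1)])
    fix q assume "q \<le> r"
    then obtain K where "\<forall>x. nderiv_norm_le (Suc q) f x K" using Suc.prems(2)[of "Suc q"] by auto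
    then have "norm (nderiv f (us @ [v]) x) \<le> K" if "length us = q" "\<forall>v\<in>set us. norm v \<le> 1" for us x
      using that v by (auto simp: nderiv_norm_le_def)
    then show "\<exists>K. \<forall>x. nderiv_norm_le q (\<lambda>x. ?f' x v) x K"
      by (auto simp: nderiv_norm_le_def nderiv_snoc)
  qed
  then have "bounded_C r (\<lambda>x. ?f' x v)" for v
    by (rule bounded_C_derivative_unit[OF d])
  moreover have "uniformly_bounded (UNIV::unit set) (\<lambda>_. f)"
    using Suc.prems(2)[of 0] by (auto simp: uniformly_bounded_def nderiv_norm_le_def)
  ultimately show ?case using d by (intro uniform_C_Suc_I[where g' = "\<lambda>_. ?f'"])
qed

lemma C_class_imp_bounded_C_derivative:
  assumes "C_class (Suc r) f" "\<And>q. q \<in> {1..Suc r} \<Longrightarrow> \<exists>K. \<forall>x. nderiv_norm_le q f x K"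
  shows "bounded_C r (\<lambda>x. frechet_derivative f (at x) v)"
proof (rule bounded_C_derivative_unit[where f = f and f' = "\<lambda>x. frechet_derivative f (at x)"])
  let ?f' = "\<lambda>x. frechet_derivative f (at x)"
  show "(f has_derivative ?f' x) (at x)" for x
    using C_class_SucD(1)[OF assms(1)] frechet_derivative_works by blast
  show "bounded_C r (\<lambda>x. ?f' x v)" if v: "norm v \<le> 1" for v
  proof (rule C_class_imp_bounded_C)
    show "C_class r (\<lambda>x. ?f' x v)" by (rule C_class_SucD(2)[OF assms(1)])
    fix q assume "q \<le> r"
    then obtain K where "\<forall>x. nderiv_norm_le (Suc q) f x K" using assms(2)[of "Suc q"] by auto
    then have "norm (nderiv f (us @ [v]) x) \<le> K" if "length us = q" "\<forall>v\<in>set us. norm v \<le> 1" for us x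
      using that v by (auto simp: nderiv_norm_le_def)
    then show "\<exists>K. \<forall>x. nderiv_norm_le q (\<lambda>x. ?f' x v) x K"
      by (auto simp: nderiv_norm_le_def nderiv_snoc)
  qed
qed

section \<open>Linear equations: the stability estimate\<close>

text \<open>Every bounded v which solves v' = A(s) v on I up to an error of size G is controlled by its initial value and by
G. The conclusion does not depend on the bound B of v. On the half-line this is the property of equations
with an exponential dichotomy, which may well have growing solutions.\<close>

definition stable_on :: "real set \<Rightarrow> (real \<Rightarrow> 'b::real_normed_vector \<Rightarrow> 'b) \<Rightarrow> real \<Rightarrow> bool" where
  "stable_on I A C \<longleftrightarrow>
     (\<forall>v v' B G. (\<forall>s\<in>I. (v has_vector_derivative v' s) (at s within I) \<and> norm (v s) \<le> B \<and>
        norm (v' s - A s (v s)) \<le> G) \<longrightarrow> (\<forall>s\<in>I. norm (v s) \<le> C * (norm (v 0) + G)))"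

lemma stable_onD:
  assumes "stable_on I A C"
    "\<And>s. s \<in> I \<Longrightarrow> (v has_vector_derivative v' s) (at s within I)"
    "\<And>s. s \<in> I \<Longrightarrow> norm (v s) \<le> B"
    "\<And>s. s \<in> I \<Longrightarrow> norm (v' s - A s (v s)) \<le> G" "s \<in> I"
  shows "norm (v s) \<le> C * (norm (v 0) + G)"
  using assms unfolding stable_on_def by blast

text \<open>The function exp (-(2 K + 1) s) (|v|^2 + G^2) is nonincreasing. Squares make the norm differentiable, and the
derivative of v is used only in the open interval, so that the lemma applies between two crossings.\<close>

lemma Gronwall_norm:
  fixes v :: "real \<Rightarrow> 'b::real_inner"
  assumes cont: "continuous_on {0..R} v"
    and der: "\<And>s. 0 < s \<Longrightarrow> s < R \<Longrightarrow> (v has_vector_derivative v' s) (at s)"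
    and le: "\<And>s. 0 < s \<Longrightarrow> s < R \<Longrightarrow> norm (v' s) \<le> K * norm (v s) + G"
    and "K \<ge> 0" "G \<ge> 0" "0 \<le> s" "s \<le> R"
  shows "norm (v s) \<le> exp ((K + 1) * s) * (norm (v 0) + G)"
proof -
  define q where "q = (\<lambda>s. exp (- ((2 * K + 1) * s)) * (v s \<bullet> v s + G\<^sup>2))"
  have "q s \<le> q 0"
  proof (cases "s = 0")
    case False
    show ?thesis
    proof (rule DERIV_nonpos_imp_decreasing_open[where f = q])
      show "continuous_on {0..s} q"
        unfolding q_def by (intro continuous_intros continuous_on_subset[OF cont]) (use assms in auto)
      fix x assume x: "0 < x" "x < s"
      have dv: "(v has_derivative (\<lambda>h. h *\<^sub>R v' x)) (at x)"
        using der[of x] x \<open>s \<le> R\<close> by (simp add: has_vector_derivative_def)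
      have dvv: "((\<lambda>s. v s \<bullet> v s) has_derivative (\<lambda>h. v x \<bullet> (h *\<^sub>R v' x) + (h *\<^sub>R v' x) \<bullet> v x)) (at x)"
        by (rule has_derivative_inner[OF dv dv])
      then have dvv: "((\<lambda>s. v s \<bullet> v s) has_real_derivative 2 * (v x \<bullet> v' x)) (at x)"
        unfolding has_field_derivative_def
        by (rule has_derivative_eq_rhs) (auto simp: fun_eq_iff inner_commute)
      have "(q has_real_derivative exp (- ((2 * K + 1) * x)) *
          (2 * (v x \<bullet> v' x) - (2 * K + 1) * (v x \<bullet> v x + G\<^sup>2))) (at x)"
        unfolding q_def by (auto intro!: derivative_eq_intros dvv simp: algebra_simps)
      moreover have "2 * (v x \<bullet> v' x) \<le> (2 * K + 1) * (v x \<bullet> v x + G\<^sup>2)"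
      proof -
        have "v x \<bullet> v' x \<le> norm (v x) * norm (v' x)" by (rule norm_cauchy_schwarz)
        also have "\<dots> \<le> norm (v x) * (K * norm (v x) + G)"
          using le[of x] x \<open>s \<le> R\<close> by (intro mult_left_mono) auto
        finally have "2 * (v x \<bullet> v' x) \<le> 2 * K * (norm (v x))\<^sup>2 + 2 * norm (v x) * G"
          by (simp add: algebra_simps power2_eq_square)
        also have "2 * norm (v x) * G \<le> (norm (v x))\<^sup>2 + G\<^sup>2"
          by (rule sum_squares_bound)
        also have "2 * K * (norm (v x))\<^sup>2 + ((norm (v x))\<^sup>2 + G\<^sup>2) \<le> (2 * K + 1) * ((norm (v x))\<^sup>2 + G\<^sup>2)"
          using \<open>K \<ge> 0\<close> by (simp add: algebra_simps)
        finally show ?thesis by (simp add: power2_norm_eq_inner)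
      qed
      ultimately show "\<exists>y. (q has_real_derivative y) (at x) \<and> y \<le> 0"
        by (intro exI conjI) (auto intro: mult_nonneg_nonpos)
    qed (use False assms in auto)
  qed auto
  then have "exp ((2 * K + 1) * s) * q s \<le> exp ((2 * K + 1) * s) * q 0" by simp
  then have "v s \<bullet> v s + G\<^sup>2 \<le> exp ((2 * K + 1) * s) * (v 0 \<bullet> v 0 + G\<^sup>2)"
    unfolding q_def by (simp add: mult.assoc[symmetric] exp_add[symmetric])
  then have "(norm (v s))\<^sup>2 \<le> exp ((2 * K + 1) * s) * ((norm (v 0))\<^sup>2 + G\<^sup>2)"
    using zero_le_power2[of G] by (simp only: power2_norm_eq_inner)
  also have "\<dots> \<le> exp (2 * ((K + 1) * s)) * (norm (v 0) + G)\<^sup>2"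
    using assms by (intro mult_mono) (auto simp: power2_sum algebra_simps)
  also have "\<dots> = (exp ((K + 1) * s) * (norm (v 0) + G))\<^sup>2"
    by (simp add: power_mult_distrib exp_double)
  finally show ?thesis
    by (rule power2_le_imp_le) (use assms in auto)
qed

lemma stable_on_interval:
  fixes A :: "real \<Rightarrow> 'b::euclidean_space \<Rightarrow> 'b"
  assumes "K \<ge> 0" and A: "\<And>s x. s \<in> {0..R} \<Longrightarrow> norm (A s x) \<le> K * norm x"
  shows "stable_on {0..R} A (exp ((K + 1) * R))"
  unfolding stable_on_def
proof (intro allI impI ballI)
  fix v v' :: "real \<Rightarrow> 'b" and B G s
  assume v: "\<forall>s\<in>{0..R}. (v has_vector_derivative v' s) (at s within {0..R}) \<and> norm (v s) \<le> B \<and>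
        norm (v' s - A s (v s)) \<le> G" and s: "s \<in> {0..R}"
  have "G \<ge> 0" using v s by (meson norm_ge_zero order_trans)
  have "norm (v s) \<le> exp ((K + 1) * s) * (norm (v 0) + G)"
  proof (rule Gronwall_norm[where v' = v' and R = R])
    show "continuous_on {0..R} v"
      using v by (intro continuous_on_vector_derivative) auto
    show "(v has_vector_derivative v' s) (at s)" if "0 < s" "s < R" for s
      using bspec[OF v, of s] that at_within_Icc_at[of 0 s R] by auto
    show "norm (v' s) \<le> K * norm (v s) + G" if "0 < s" "s < R" for s
    proof -
      have "norm (v' s) \<le> norm (A s (v s)) + norm (v' s - A s (v s))"
        using norm_triangle_ineq[of "A s (v s)" "v' s - A s (v s)"] by simp
      also have "\<dots> \<le> K * norm (v s) + G" using A v that by (intro add_mono) auto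
      finally show ?thesis .
    qed
  qed (use s \<open>G \<ge> 0\<close> \<open>K \<ge> 0\<close> in auto)
  also have "\<dots> \<le> exp ((K + 1) * R) * (norm (v 0) + G)"
    using s \<open>K \<ge> 0\<close> \<open>G \<ge> 0\<close> by (intro mult_right_mono) auto
  finally show "norm (v s) \<le> exp ((K + 1) * R) * (norm (v 0) + G)" .
qed

text \<open>The function exp (- l s) z has derivative exp (- l s) g. If Re l < 0, integrate from 0 to s. If Re l > 0,
integrate from s to infinity, where the boundary term vanishes because z is bounded.\<close>

lemma bounded_scalar_solution:
  fixes z g :: "real \<Rightarrow> complex"
  assumes der: "\<And>s. s \<ge> 0 \<Longrightarrow> (z has_vector_derivative l * z s + g s) (at s within {0..})"
    and B: "\<And>s. s \<ge> 0 \<Longrightarrow> norm (z s) \<le> B" and G: "\<And>s. s \<ge> 0 \<Longrightarrow> norm (g s) \<le> G"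
    and l: "\<bar>Re l\<bar> \<ge> \<delta>" "\<delta> > 0" and "s \<ge> 0"
  shows "norm (z s) \<le> norm (z 0) + G / \<delta>"
proof -
  define a where "a = Re l"
  define y where "y = (\<lambda>s. exp (of_real s * - l) * z s)"
  have "a \<noteq> 0" using l by (auto simp: a_def)
  have "G \<ge> 0" using G[of 0] norm_ge_zero[of "g 0"] by linarith
  have y_norm: "norm (y s) = exp (- a * s) * norm (z s)" for s
    by (simp add: y_def norm_mult a_def mult.commute)
  have dy: "(y has_vector_derivative exp (of_real s * - l) * g s) (at s within {0..})" if "s \<ge> 0" for s
  proof -
    have "((\<lambda>s. exp (of_real s * - l)) has_vector_derivative - l * exp (of_real s * - l)) (at s within {0..})"
      using exp_scaleR_has_vector_derivative_right[of "- l" s "{0..}"]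
      by (simp add: scaleR_conv_of_real mult.commute)
    from has_vector_derivative_mult[OF this der[OF that]] show ?thesis
      unfolding y_def by (simp add: algebra_simps)
  qed
  \<comment> \<open>The right-hand side is the integral of G exp (- a x) over {s..t}, for either sign of a.\<close>
  have diff: "norm (y t - y s) \<le> - (G / a) * exp (- a * t) + (G / a) * exp (- a * s)"
    if "0 \<le> s" "s < t" for s t
  proof -
    have "norm (y t - y s) \<le> - (G / a) * exp (- a * t) - - (G / a) * exp (- a * s)"
    proof (rule differentiable_bound_general[OF that(2)])
      show "continuous_on {s..t} y"
        by (rule continuous_on_subset[of "{0..}"])
           (use dy that in \<open>auto intro!: continuous_on_vector_derivative\<close>)
      show "continuous_on {s..t} (\<lambda>t. - (G / a) * exp (- a * t))"
        by (intro continuous_intros)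
      fix x assume x: "s < x" "x < t"
      show "(y has_vector_derivative exp (of_real x * - l) * g x) (at x)"
        using dy[of x] x that at_within_interior[of x "{0..}"] by (simp add: interior_real_atLeast)
      show "((\<lambda>t. - (G / a) * exp (- a * t)) has_vector_derivative G * exp (- a * x)) (at x)"
        using \<open>a \<noteq> 0\<close> unfolding has_real_derivative_iff_has_vector_derivative[symmetric]
        by (auto intro!: derivative_eq_intros)
      show "norm (exp (of_real x * - l) * g x) \<le> G * exp (- a * x)"
        using G[of x] x that by (simp add: norm_mult a_def mult.commute)
    qed
    then show ?thesis by simp
  qed
  have *: "G / \<bar>a\<bar> \<le> G / \<delta>" using l \<open>G \<ge> 0\<close> unfolding a_def by (intro divide_left_mono) auto
  have ee: "exp (a * s) * exp (- a * s) = 1" by (simp add: exp_add[symmetric])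
  consider "a < 0" | "a > 0" using \<open>a \<noteq> 0\<close> by linarith
  then show ?thesis
  proof cases
    case 1
    show ?thesis
    proof (cases "s = 0")
      case True
      then show ?thesis using \<open>G \<ge> 0\<close> l by simp
    next
      case False
      then have "norm (y s - y 0) \<le> - (G / a) * exp (- a * s) + (G / a) * exp (- a * 0)"
        using diff[of 0 s] \<open>s \<ge> 0\<close> by simp
      also have "\<dots> \<le> - (G / a) * exp (- a * s)"
        using 1 \<open>G \<ge> 0\<close> by (simp add: divide_nonneg_neg)
      finally have "norm (y s) \<le> norm (y 0) + - (G / a) * exp (- a * s)"
        using norm_triangle_sub[of "y s" "y 0"] by linarith
      then have "exp (a * s) * (exp (- a * s) * norm (z s)) \<le> exp (a * s) * (norm (z 0) + - (G / a) * exp (- a * s))"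
        unfolding y_norm by (intro mult_left_mono) auto
      moreover have "exp (a * s) * (norm (z 0) + - (G / a) * exp (- a * s)) = exp (a * s) * norm (z 0) + G / \<bar>a\<bar>"
      proof -
        have "exp (a * s) * (- (G / a) * exp (- a * s)) = - (G / a) * (exp (a * s) * exp (- a * s))"
          by (simp only: mult.left_commute)
        also have "\<dots> = G / \<bar>a\<bar>" using 1 unfolding ee by simp
        finally show ?thesis by (simp only: distrib_left)
      qed
      ultimately have "norm (z s) \<le> exp (a * s) * norm (z 0) + G / \<bar>a\<bar>"
        by (simp only: mult.assoc[symmetric] ee mult_1)
      also have "exp (a * s) * norm (z 0) \<le> 1 * norm (z 0)"
        using 1 \<open>s \<ge> 0\<close> by (intro mult_right_mono) (auto simp: mult_nonpos_nonneg)
      finally show ?thesis using * by simp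
    qed
  next
    case 2
    have "norm (y s) \<le> (G / a) * exp (- a * s)"
    proof (rule tendsto_lowerbound)
      have "((\<lambda>t. exp (- a * t)) \<longlongrightarrow> 0) at_top"
        using 2 by real_asymp
      then have "((\<lambda>t. exp (- a * t) * B + (G / a) * exp (- a * s)) \<longlongrightarrow> 0 * B + (G / a) * exp (- a * s)) at_top"
        by (intro tendsto_intros)
      then show "((\<lambda>t. exp (- a * t) * B + (G / a) * exp (- a * s)) \<longlongrightarrow> (G / a) * exp (- a * s)) at_top"
        by simp
      show "\<forall>\<^sub>F t in at_top. norm (y s) \<le> exp (- a * t) * B + (G / a) * exp (- a * s)"
        using eventually_gt_at_top[of s]
      proof eventually_elim
        case (elim t)
        have "norm (y s) \<le> norm (y t) + norm (y t - y s)"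
          by (metis norm_minus_commute norm_triangle_sub)
        also have "\<dots> \<le> exp (- a * t) * B + (- (G / a) * exp (- a * t) + (G / a) * exp (- a * s))"
          using diff[of s t] elim \<open>s \<ge> 0\<close> B[of t] by (intro add_mono) (auto simp: y_norm)
        also have "\<dots> \<le> exp (- a * t) * B + (G / a) * exp (- a * s)"
          using 2 \<open>G \<ge> 0\<close> by simp
        finally show ?case .
      qed
    qed simp
    then have "exp (a * s) * (exp (- a * s) * norm (z s)) \<le> exp (a * s) * ((G / a) * exp (- a * s))"
      unfolding y_norm by (intro mult_left_mono) auto
    then have "norm (z s) \<le> G / a"
      by (simp only: mult.left_commute[of "exp (a * s)" "G / a"] ee mult_1_right)
         (simp only: mult.assoc[symmetric] ee mult_1)
    also have "\<dots> \<le> norm (z 0) + G / \<delta>" using * 2 by (simp add: add_increasing)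
    finally show ?thesis .
  qed
qed

section \<open>Hyperbolic matrices\<close>

text \<open>The product of the factors M - l, over all l in the list, applied to x.\<close>

primrec deflate :: "complex^'n^'n \<Rightarrow> complex list \<Rightarrow> complex^'n \<Rightarrow> complex^'n" where
  "deflate M [] x = x"
| "deflate M (l # ls) x = deflate M ls (M *v x - l *s x)"

lemma linear_matrix_complex: "linear (\<lambda>x::complex^'n. M *v x)"
proof (rule linearI)
  show "M *v (r *\<^sub>R x) = r *\<^sub>R (M *v x)" for r and x :: "complex^'n"
    by (simp add: matrix_vector_mult_def vec_eq_iff scaleR_sum_right)
qed (rule matrix_vector_right_distrib)

lemma norm_vector_smult: "norm (c *s (x::complex^'n)) = norm c * norm x"
  by (simp add: norm_vec_def norm_mult L2_set_right_distrib)

text \<open>A bounded solution v of v' = M v + g that is annihilated by the product of the factors M - l. The bounds are part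
of the definition, so that constants can be chosen before the matrix and the solution.\<close>

definition deflated_solution where
  "deflated_solution K \<delta> M ls v g B G \<longleftrightarrow>
    (\<forall>x. norm (M *v x) \<le> K * norm x) \<and> (\<forall>l\<in>set ls. norm l \<le> K \<and> \<bar>Re l\<bar> \<ge> \<delta>) \<and>
    (\<forall>s\<ge>0. (v has_vector_derivative M *v v s + g s) (at s within {0..}) \<and> norm (v s) \<le> B \<and>
       norm (g s) \<le> G \<and> deflate M ls (v s) = 0)"

text \<open>Let w = (M - l) v for the first l in the list. Then w solves the same equation with g replaced by (M - l) g, and is
annihilated by the remaining factors, so that induction bounds w. But v' = l v + (w + g) is a system of decoupled
scalar equations for the components of v. No eigenvector appears, so that the constant does
not deteriorate when eigenvalues come close to each other.\<close>

lemma deflated_solution_bound: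
  assumes "K \<ge> 0" "\<delta> > 0"
  shows "\<exists>C\<ge>0. \<forall>(M::complex^'n^'n) ls v g B G s.
    length ls \<le> d \<longrightarrow> deflated_solution K \<delta> M ls v g B G \<longrightarrow> s \<ge> 0 \<longrightarrow>
    norm (v s) \<le> C * (norm (v 0) + G)"
proof (induction d)
  case 0
  show ?case by (rule exI[of _ 0]) (auto simp: deflated_solution_def)
next
  case (Suc d)
  then obtain C where C: "C \<ge> 0" and IH:
    "\<And>(M::complex^'n^'n) ls v g B G s. length ls \<le> d \<Longrightarrow> deflated_solution K \<delta> M ls v g B G \<Longrightarrow>
      s \<ge> 0 \<Longrightarrow> norm (v s) \<le> C * (norm (v 0) + G)"
    by blast
  define n where "n = real CARD('n)"
  define C' where "C' = n * (1 + (2 * K * C + 1) / \<delta>) + C"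
  have "C' \<ge> 0" unfolding C'_def n_def using C assms by (intro add_nonneg_nonneg mult_nonneg_nonneg) auto
  moreover have "norm (v s) \<le> C' * (norm (v 0) + G)"
    if len: "length ls \<le> Suc d" and ds: "deflated_solution K \<delta> M ls v g B G" and "s \<ge> 0"
    for M :: "complex^'n^'n" and ls v g B G s
  proof -
    from ds have M: "\<And>x. norm (M *v x) \<le> K * norm x"
      and ls: "\<And>l. l \<in> set ls \<Longrightarrow> norm l \<le> K \<and> \<bar>Re l\<bar> \<ge> \<delta>"
      and v: "\<And>s. s \<ge> 0 \<Longrightarrow> (v has_vector_derivative M *v v s + g s) (at s within {0..}) \<and> norm (v s) \<le> B \<and>
       norm (g s) \<le> G \<and> deflate M ls (v s) = 0"
      unfolding deflated_solution_def by blast+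
    have G: "G \<ge> 0" using v[of 0] norm_ge_zero[of "g 0"] by linarith
    show ?thesis
    proof (cases ls)
      case Nil
      then show ?thesis using v[OF \<open>s \<ge> 0\<close>] \<open>C' \<ge> 0\<close> G by simp
    next
      case (Cons l ks)
      have l: "norm l \<le> K" "\<bar>Re l\<bar> \<ge> \<delta>" using ls Cons by auto
      interpret T: bounded_linear "\<lambda>x. M *v x - l *s x"
        unfolding linear_conv_bounded_linear[symmetric]
        by (intro linear_compose_sub linear_matrix_complex linearI)
           (auto simp: vec_eq_iff vector_add_ldistrib)
      have T_norm: "norm (M *v x - l *s x) \<le> 2 * K * norm x" for x
      proof -
        have "norm (M *v x - l *s x) \<le> norm (M *v x) + norm (l *s x)" by (rule norm_triangle_ineq4)
        also have "\<dots> \<le> K * norm x + K * norm x"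
          unfolding norm_vector_smult using M l by (intro add_mono mult_right_mono) auto
        finally show ?thesis by simp
      qed
      define w where "w = (\<lambda>s. M *v v s - l *s v s)"
      have w: "norm (w s) \<le> C * (norm (w 0) + 2 * K * G)" if "s \<ge> 0" for s
      proof (rule IH)
        show "deflated_solution K \<delta> M ks w (\<lambda>s. M *v g s - l *s g s) (2 * K * B) (2 * K * G)"
          unfolding deflated_solution_def
        proof (intro conjI allI impI ballI)
          fix s :: real assume s: "s \<ge> 0"
          have "(w has_vector_derivative M *v (M *v v s + g s) - l *s (M *v v s + g s)) (at s within {0..})"
            unfolding w_def using v[OF s] by (intro T.has_vector_derivative) auto
          moreover have "M *v (M *v v s + g s) - l *s (M *v v s + g s) = M *v w s + (M *v g s - l *s g s)"
            by (simp add: w_def matrix_vector_right_distrib matrix_vector_mult_diff_distrib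
                vector_scalar_commute vector_add_ldistrib)
          ultimately show "(w has_vector_derivative M *v w s + (M *v g s - l *s g s)) (at s within {0..})"
            by (simp only:)
          show "norm (w s) \<le> 2 * K * B" "norm (M *v g s - l *s g s) \<le> 2 * K * G"
            unfolding w_def using v[OF s] \<open>K \<ge> 0\<close>
            by (auto intro!: order_trans[OF T_norm] mult_left_mono)
          show "deflate M ks (w s) = 0" using v[OF s] by (simp add: Cons w_def)
        qed (use Cons M ls in auto)
      qed (use len Cons that in auto)
      have w': "norm (w s + g s) \<le> (2 * K * C + 1) * (norm (v 0) + G)" if "s \<ge> 0" for s
      proof -
        have "norm (w s + g s) \<le> C * (norm (w 0) + 2 * K * G) + G"
          using w[OF that] v[OF that] by (intro order_trans[OF norm_triangle_ineq] add_mono) auto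
        also have "\<dots> \<le> C * (2 * K * norm (v 0) + 2 * K * G) + G"
          using T_norm[of "v 0"] C \<open>K \<ge> 0\<close> by (intro add_mono mult_left_mono) (auto simp: w_def)
        also have "\<dots> \<le> (2 * K * C + 1) * (norm (v 0) + G)"
          by (simp add: algebra_simps)
        finally show ?thesis .
      qed
      have comp: "norm (v s $ i) \<le> (1 + (2 * K * C + 1) / \<delta>) * (norm (v 0) + G)" for i
      proof -
        have "norm (v s $ i) \<le> norm (v 0 $ i) + ((2 * K * C + 1) * (norm (v 0) + G)) / \<delta>"
        proof (rule bounded_scalar_solution[where l = l and g = "\<lambda>s. (w s + g s) $ i"])
          fix s :: real assume s: "s \<ge> 0"
          have "((\<lambda>s. v s $ i) has_vector_derivative (M *v v s + g s) $ i) (at s within {0..})"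
            using v[OF s] by (intro bounded_linear.has_vector_derivative[OF bounded_linear_vec_nth]) auto
          then show "((\<lambda>s. v s $ i) has_vector_derivative l * v s $ i + (w s + g s) $ i) (at s within {0..})"
            by (simp add: w_def)
          show "norm (v s $ i) \<le> B" using v[OF s] Finite_Cartesian_Product.norm_nth_le order_trans by blast
          show "norm ((w s + g s) $ i) \<le> (2 * K * C + 1) * (norm (v 0) + G)"
            using w'[OF s] Finite_Cartesian_Product.norm_nth_le order_trans by blast
        qed (use l assms \<open>s \<ge> 0\<close> in auto)
        also have "norm (v 0 $ i) \<le> norm (v 0) + G"
          using Finite_Cartesian_Product.norm_nth_le[of "v 0" i] G by linarith
        finally show ?thesis by (simp add: algebra_simps)
      qed
      have "norm (v s) \<le> (\<Sum>i\<in>UNIV. norm (v s $ i))"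
        unfolding norm_vec_def by (rule L2_set_le_sum) simp
      also have "\<dots> \<le> (\<Sum>i\<in>(UNIV::'n set). (1 + (2 * K * C + 1) / \<delta>) * (norm (v 0) + G))"
        by (intro sum_mono comp)
      also have "\<dots> = n * (1 + (2 * K * C + 1) / \<delta>) * (norm (v 0) + G)"
        by (simp add: n_def)
      also have "\<dots> \<le> C' * (norm (v 0) + G)"
        unfolding C'_def using C G by (intro mult_right_mono) auto
      finally show ?thesis .
    qed
  qed
  ultimately show ?case by blast
qed

lemma deflation_steps_commute:
  fixes M :: "complex^'n^'n"
  shows "M *v (M *v x - l *s x) - k *s (M *v x - l *s x) = M *v (M *v x - k *s x) - l *s (M *v x - k *s x)"
  by (simp add: matrix_vector_mult_diff_distrib vector_scalar_commute vec_eq_iff algebra_simps)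

lemma deflate_commute:
  "deflate M ls (M *v x - l *s x) = M *v deflate M ls x - l *s deflate M ls x"
proof (induction ls arbitrary: x)
  case (Cons k ls)
  show ?case
    by (simp only: deflate.simps deflation_steps_commute[of M x l k] Cons)
qed simp

lemma deflate_remove1:
  "l \<in> set ls \<Longrightarrow> deflate M ls x = M *v deflate M (remove1 l ls) x - l *s deflate M (remove1 l ls) x"
proof (induction ls arbitrary: x)
  case (Cons k ls)
  show ?case
  proof (cases "k = l")
    case True
    then show ?thesis by (simp add: deflate_commute)
  next
    case False
    with Cons.prems have "l \<in> set ls" by simp
    from Cons.IH[OF this, of "M *v x - k *s x"] False show ?thesis by simp
  qed
qed simp

lemma deflate_diff: "deflate M ls (x - y) = deflate M ls x - deflate M ls y"
proof (induction ls arbitrary: x y)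
  case (Cons l ls)
  have "M *v (x - y) - l *s (x - y) = (M *v x - l *s x) - (M *v y - l *s y)"
    by (simp add: matrix_vector_mult_diff_distrib vec_eq_iff algebra_simps)
  then show ?case by (simp add: Cons)
qed simp

text \<open>The polynomial p, evaluated at the matrix M and applied to x, for degree at most d.\<close>

definition poly_act :: "nat \<Rightarrow> complex poly \<Rightarrow> complex^'n^'n \<Rightarrow> complex^'n \<Rightarrow> complex^'n" where
  "poly_act d p M x = (\<Sum>i\<le>d. coeff p i *s (((*v) M) ^^ i) x)"

lemma poly_act_prod_eq_deflate:
  "poly_act (length ls) (\<Prod>l\<leftarrow>ls. [:- l, 1:]) M x = deflate M ls x"
proof (induction ls arbitrary: x)
  case Nil
  then show ?case by (simp add: poly_act_def)
next
  case (Cons l ls)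
  define q where "q = (\<Prod>l\<leftarrow>ls. [:- l, 1:])"
  have deg: "degree q \<le> length ls"
    unfolding q_def
  proof (induction ls)
    case (Cons l ls)
    have "degree ([:- l, 1:] * (\<Prod>l\<leftarrow>ls. [:- l, 1:])) \<le> degree [:- l, 1:] + degree (\<Prod>l\<leftarrow>ls. [:- l, 1:])"
      by (rule degree_mult_le)
    then show ?case using Cons by (simp del: mult_pCons_left)
  qed simp
  then have top: "coeff q (Suc (length ls)) = 0" by (simp add: coeff_eq_0)
  have prod: "(\<Prod>l\<leftarrow>l # ls. [:- l, 1:]) = pCons 0 q - smult l q" by (simp add: q_def)
  have "poly_act (length (l # ls)) (pCons 0 q - smult l q) M x =
     (\<Sum>i\<le>Suc (length ls). coeff (pCons 0 q) i *s (((*v) M) ^^ i) x)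
     - (\<Sum>i\<le>Suc (length ls). (l * coeff q i) *s (((*v) M) ^^ i) x)"
    by (simp add: poly_act_def vector_sub_rdistrib sum_subtractf)
  also have "(\<Sum>i\<le>Suc (length ls). coeff (pCons 0 q) i *s (((*v) M) ^^ i) x) =
     (\<Sum>i\<le>length ls. coeff q i *s (((*v) M) ^^ i) (M *v x))"
    by (subst sum.atMost_Suc_shift) (simp add: funpow_swap1)
  also have "(\<Sum>i\<le>Suc (length ls). (l * coeff q i) *s (((*v) M) ^^ i) x) =
     (\<Sum>i\<le>length ls. (l * coeff q i) *s (((*v) M) ^^ i) x)"
    using top by simp
  also have "\<dots> = l *s (\<Sum>i\<le>length ls. coeff q i *s (((*v) M) ^^ i) x)"
    by (simp add: vec.scale_sum_right)
  also have "(\<Sum>i\<le>length ls. coeff q i *s (((*v) M) ^^ i) (M *v x)) = deflate M ls (M *v x)"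
    using Cons[of "M *v x"] by (simp add: q_def poly_act_def)
  also have "(\<Sum>i\<le>length ls. coeff q i *s (((*v) M) ^^ i) x) = deflate M ls x"
    using Cons[of x] by (simp add: q_def poly_act_def)
  also have "l *s deflate M ls x = deflate M ls (l *s x)"
  proof (induction ls arbitrary: x)
    case (Cons k ks)
    have "l *s (M *v x - k *s x) = M *v (l *s x) - k *s (l *s x)"
      by (simp add: vec_eq_iff vector_scalar_commute algebra_simps)
    then show ?case by (simp add: Cons[of "M *v x - k *s x"])
  qed simp
  finally show ?case by (simp only: prod deflate.simps deflate_diff)
qed

definition complexify :: "real^'n^'m \<Rightarrow> complex^'n^'m" where
  "complexify A = (\<chi> i j. of_real (A $ i $ j))"

lemma complexify_mult: "complexify (A ** B) = complexify A ** complexify B"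
  by (simp add: complexify_def matrix_matrix_mult_def vec_eq_iff)

text \<open>There are more powers than the dimension of the space of matrices: either two of them coincide, or they are
linearly dependent.\<close>

lemma matrix_powers_dependent:
  fixes A :: "real^'n^'n"
  shows "\<exists>a. (\<exists>i\<le>DIM(real^'n^'n). a i \<noteq> 0) \<and>
    (\<Sum>i\<le>DIM(real^'n^'n). a i *\<^sub>R (((**) A) ^^ i) (mat 1)) = 0"
proof -
  let ?D = "DIM(real^'n^'n)" and ?P = "\<lambda>i. (((**) A) ^^ i) (mat 1 :: real^'n^'n)"
  show ?thesis
  proof (cases "inj_on ?P {..?D}")
    case True
    then have "card (?P ` {..?D}) = Suc ?D" by (simp add: card_image)
    then have "dependent (?P ` {..?D})" by (intro dependent_biggerset) auto
    then obtain u where u: "\<exists>v\<in>?P ` {..?D}. u v \<noteq> 0" "(\<Sum>v\<in>?P ` {..?D}. u v *\<^sub>R v) = 0"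
      by (subst (asm) dependent_finite) auto
    have "(\<Sum>i\<le>?D. u (?P i) *\<^sub>R ?P i) = 0"
      using u(2) sum.reindex[OF True, of "\<lambda>v. u v *\<^sub>R v"] by (simp only: comp_def)
    with u(1) show ?thesis by (intro exI[of _ "\<lambda>i. u (?P i)"]) auto
  next
    case False
    then obtain i j where ij: "i \<le> ?D" "j \<le> ?D" "i \<noteq> j" "?P i = ?P j"
      unfolding inj_on_def by auto
    have "(\<Sum>k\<le>?D. (of_bool (k = i) - of_bool (k = j)) *\<^sub>R ?P k) =
      (\<Sum>k\<le>?D. of_bool (k = i) *\<^sub>R ?P k) - (\<Sum>k\<le>?D. of_bool (k = j) *\<^sub>R ?P k)"
      by (simp add: scaleR_diff_left sum_subtractf)
    also have "\<dots> = (\<Sum>k\<le>?D. if k = i then ?P k else 0) - (\<Sum>k\<le>?D. if k = j then ?P k else 0)"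
      by (intro arg_cong2[where f = minus] sum.cong) auto
    also have "\<dots> = 0" using ij by simp
    finally show ?thesis
      using ij by (intro exI[of _ "\<lambda>k. of_bool (k = i) - of_bool (k = j)"]) (auto intro!: exI[of _ i])
  qed
qed

text \<open>Some nonzero real polynomial annihilates A, because its powers live in a finite-dimensional space. Its complex
roots form a list that annihilates. In a list of minimal length every entry is an eigenvalue: otherwise the factor
M - l would be injective, and could be cancelled.\<close>

lemma deflating_eigenvalues_exist:
  fixes A :: "real^'n^'n"
  obtains ls where "length ls \<le> DIM(real^'n^'n)" "\<And>x. deflate (complexify A) ls x = 0"
    "\<And>l. l \<in> set ls \<Longrightarrow> \<exists>x. x \<noteq> 0 \<and> complexify A *v x = l *s x"
proof -
  let ?D = "DIM(real^'n^'n)" and ?P = "\<lambda>i. (((**) A) ^^ i) (mat 1 :: real^'n^'n)"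
  let ?M = "complexify A"
  obtain a where a: "\<exists>i\<le>?D. a i \<noteq> 0" "(\<Sum>i\<le>?D. a i *\<^sub>R ?P i) = 0"
    using matrix_powers_dependent[of A] by blast
  define p where "p = (\<Sum>i\<le>?D. monom (complex_of_real (a i)) i)"
  have coeff_p: "coeff p i = (if i \<le> ?D then of_real (a i) else 0)" for i
    by (simp add: p_def coeff_sum)
  have "p \<noteq> 0" using a(1) coeff_p by (metis coeff_0 of_real_eq_0_iff)
  have deg: "degree p \<le> ?D" by (rule degree_le) (simp add: coeff_p)
  have pow: "(((*v) ?M) ^^ i) x = complexify (?P i) *v x" for i x
  proof (induction i)
    case 0
    have "complexify (mat 1) = (mat 1 :: complex^'n^'n)"
      by (simp add: complexify_def mat_def vec_eq_iff)
    then show ?case by simp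
  next
    case (Suc i)
    then show ?case by (simp add: complexify_mult matrix_vector_mul_assoc)
  qed
  have "poly_act ?D p ?M x = 0" for x
  proof -
    have zero: "(\<Sum>i\<le>?D. a i * ?P i $ k $ l) = 0" for k l
      using arg_cong[OF a(2), of "\<lambda>Z. Z $ k $ l"] by simp
    have "poly_act ?D p ?M x $ k = 0" for k
    proof -
      have "poly_act ?D p ?M x $ k = (\<Sum>i\<le>?D. \<Sum>l\<in>UNIV. of_real (a i) * (of_real (?P i $ k $ l) * x $ l))"
      proof -
        have "poly_act ?D p ?M x $ k = (\<Sum>i\<le>?D. of_real (a i) * (complexify (?P i) *v x) $ k)"
          by (simp add: poly_act_def coeff_p pow)
        then show ?thesis
          by (simp add: matrix_vector_mult_def complexify_def sum_distrib_left)
      qed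
      also have "\<dots> = (\<Sum>l\<in>UNIV. of_real (\<Sum>i\<le>?D. a i * ?P i $ k $ l) * x $ l)"
        by (subst sum.swap) (simp add: sum_distrib_right mult.assoc)
      finally show ?thesis by (simp only: zero of_real_0 mult_zero_left sum.neutral_const)
    qed
    then show ?thesis by (simp add: vec_eq_iff)
  qed
  moreover have "poly_act ?D p ?M x = poly_act (degree p) p ?M x" for x
    unfolding poly_act_def
    by (rule sum.mono_neutral_right) (use deg in \<open>auto simp: coeff_eq_0\<close>)
  ultimately have act0: "poly_act (degree p) p ?M x = 0" for x by simp
  obtain rs where rs: "mset rs = proots p" using ex_mset by blast
  have p_eq: "p = smult (lead_coeff p) (\<Prod>l\<leftarrow>rs. [:- l, 1:])"
    using complex_poly_decompose_multiset[of p]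
    unfolding rs[symmetric] mset_map[symmetric] prod_mset_prod_list by (rule sym)
  have len_rs: "length rs = degree p" using size_proots_complex[of p] by (simp flip: rs)
  have "lead_coeff p *s deflate ?M rs x = poly_act (degree p) p ?M x" for x
  proof -
    have "poly_act (degree p) p ?M x = poly_act (degree p) (smult (lead_coeff p) (\<Prod>l\<leftarrow>rs. [:- l, 1:])) ?M x"
      using p_eq by simp
    also have "\<dots> = lead_coeff p *s poly_act (degree p) (\<Prod>l\<leftarrow>rs. [:- l, 1:]) ?M x"
      by (simp add: poly_act_def vec.scale_sum_right)
    finally show ?thesis by (simp add: len_rs[symmetric] poly_act_prod_eq_deflate)
  qed
  then have "lead_coeff p *s deflate ?M rs x = 0" for x using act0 by simp
  then have rs0: "deflate ?M rs x = 0" for x using \<open>p \<noteq> 0\<close> by (simp add: vec.scale_eq_0_iff)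
  let ?Q = "\<lambda>ls. \<forall>x. deflate ?M ls x = 0"
  define ls where "ls = arg_min length ?Q"
  have ls: "?Q ls" unfolding ls_def by (rule arg_min_natI[of ?Q rs]) (use rs0 in simp)
  have least: "length ls \<le> length ks" if "?Q ks" for ks
    unfolding ls_def by (rule arg_min_nat_le) (use that in simp)
  have "\<exists>x. x \<noteq> 0 \<and> ?M *v x = l *s x" if l: "l \<in> set ls" for l
  proof (rule ccontr)
    assume no: "\<not> ?thesis"
    have "deflate ?M (remove1 l ls) x = 0" for x
    proof -
      have "?M *v deflate ?M (remove1 l ls) x = l *s deflate ?M (remove1 l ls) x"
        using ls deflate_remove1[OF l, of ?M x] by simp
      then show ?thesis using no by blast
    qed
    then have "length ls \<le> length (remove1 l ls)" using least by blast
    then show False using l by (simp add: length_remove1) (metis length_pos_if_in_set Suc_pred not_less_eq_eq order_refl)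
  qed
  moreover have "length ls \<le> ?D" using least[of rs] rs0 len_rs deg by auto
  ultimately show thesis using that ls by blast
qed

lemma poly_det:
  fixes P :: "complex poly^'n^'n"
  shows "poly (det P) l = det (\<chi> i j. poly (P $ i $ j) l)"
proof -
  have "poly (of_int k :: complex poly) l = of_int k" for k
    by (simp add: of_int_poly)
  then show ?thesis by (simp add: det_def poly_sum poly_prod)
qed

text \<open>The multiset of eigenvalues consists of the roots of the characteristic polynomial. This polynomial is not zero,
since it would then have no roots in the multiset, whereas the splitting counts at least one.\<close>

lemma hyperbolic_splitting_eigenvalue:
  fixes A :: "real^'n^'n"
  assumes h: "hyperbolic_splitting k \<delta> A" and x: "x \<noteq> 0" "complexify A *v x = l *s x"
  shows "\<bar>Re l\<bar> > \<delta>"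
proof -
  have "charpoly A \<noteq> 0"
  proof
    assume "charpoly A = 0"
    then have "eigenvalues A = {#}" by (simp add: eigenvalues_def)
    with h have "k = 0" "CARD('n) - k = 0" by (auto simp: hyperbolic_splitting_def)
    then show False by simp
  qed
  moreover have "poly (charpoly A) l = 0"
  proof -
    have "poly (charpoly A) l = det (mat l - complexify A)"
      unfolding charpoly_def poly_det
      by (rule arg_cong[where f = det]) (auto simp: vec_eq_iff mat_def complexify_def)
    moreover have "(mat l - complexify A) *v x = 0"
    proof -
      have "mat l *v x = l *s x"
        by (simp add: vec_eq_iff matrix_vector_mult_def mat_def mult_delta_left)
      with x(2) show ?thesis by (simp add: matrix_vector_mult_diff_rdistrib)
    qed
    then have "\<not> invertible (mat l - complexify A)"
      using x(1) matrix_left_invertible_ker[of "mat l - complexify A"] by (auto simp: invertible_def)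
    ultimately show ?thesis by (simp add: invertible_det_nz)
  qed
  ultimately have "l \<in># eigenvalues A" by (simp add: eigenvalues_def)
  with h show ?thesis by (auto simp: hyperbolic_splitting_def)
qed

text \<open>The part of hyperbolicity that the estimates use. It is invariant under A \<mapsto> - A, which is what time reversal does
to the linearization.\<close>

definition spectral_gap :: "real \<Rightarrow> real^'n^'n \<Rightarrow> bool" where
  "spectral_gap \<delta> A \<longleftrightarrow> (\<forall>l x. x \<noteq> 0 \<and> complexify A *v x = l *s x \<longrightarrow> \<delta> \<le> \<bar>Re l\<bar>)"

lemma hyperbolic_splitting_imp_spectral_gap: "hyperbolic_splitting k \<delta> A \<Longrightarrow> spectral_gap \<delta> A"
  using hyperbolic_splitting_eigenvalue unfolding spectral_gap_def by (blast intro: less_imp_le)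

lemma spectral_gap_uminus:
  fixes A :: "real^'n^'n"
  assumes "spectral_gap \<delta> A"
  shows "spectral_gap \<delta> (- A)"
  unfolding spectral_gap_def
proof (intro allI impI; elim conjE)
  fix l and x :: "complex^'n" assume x: "x \<noteq> 0" "complexify (- A) *v x = l *s x"
  have "complexify (- A) *v x = - (complexify A *v x)"
    by (simp add: complexify_def matrix_vector_mult_def vec_eq_iff sum_negf)
  with x(2) have "complexify A *v x = (- l) *s x" by (metis minus_equation_iff vector_sneg_minus1 vec.scale_minus_left)
  with assms x(1) have "\<delta> \<le> \<bar>Re (- l)\<bar>" unfolding spectral_gap_def by blast
  then show "\<delta> \<le> \<bar>Re l\<bar>" by simp
qed

definition complex_vec :: "real^'n \<Rightarrow> complex^'n" where
  "complex_vec x = (\<chi> i. of_real (x $ i))"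

lemma norm_complex_vec: "norm (complex_vec x) = norm x"
  by (simp add: complex_vec_def norm_vec_def)

lemma bounded_linear_complex_vec: "bounded_linear (complex_vec :: real^'n \<Rightarrow> complex^'n)"
  unfolding linear_conv_bounded_linear[symmetric]
  by (rule linearI) (simp_all add: complex_vec_def vec_eq_iff, simp add: scaleR_conv_of_real)

lemma complexify_mult_complex_vec: "complexify A *v complex_vec x = complex_vec (A *v x)"
  by (simp add: complexify_def complex_vec_def matrix_vector_mult_def vec_eq_iff)

text \<open>Real and imaginary parts of x are mapped separately.\<close>

lemma norm_complexify_mult_le:
  fixes A :: "real^'n^'n"
  assumes "\<And>x. norm (A *v x) \<le> K * norm x" "K \<ge> 0"
  shows "norm (complexify A *v x) \<le> 2 * K * norm x"
proof -
  define a b where "a = (\<chi> i. Re (x $ i))" and "b = (\<chi> i. Im (x $ i))"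
  have x: "x = complex_vec a + \<i> *s complex_vec b"
    by (simp add: vec_eq_iff a_def b_def complex_vec_def complex_eq_iff)
  have "norm a \<le> norm x" "norm b \<le> norm x"
    unfolding norm_vec_def a_def b_def by (auto intro!: L2_set_mono abs_Re_le_cmod abs_Im_le_cmod)
  have "complexify A *v x = complex_vec (A *v a) + \<i> *s complex_vec (A *v b)"
    by (subst x) (simp add: matrix_vector_right_distrib vector_scalar_commute complexify_mult_complex_vec)
  then have "norm (complexify A *v x) \<le> norm (A *v a) + norm (A *v b)"
    using norm_triangle_ineq[of "complex_vec (A *v a)" "\<i> *s complex_vec (A *v b)"]
    by (simp add: norm_vector_smult norm_complex_vec)
  also have "\<dots> \<le> K * norm x + K * norm x"
    using assms \<open>norm a \<le> norm x\<close> \<open>norm b \<le> norm x\<close>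
    by (intro add_mono order_trans[OF assms(1)] mult_left_mono) auto
  finally show ?thesis by simp
qed

text \<open>The perturbation is treated as a part of the inhomogeneity. Since v is bounded, its supremum S is finite, and
S \<le> C (|v(0)| + G + \<epsilon> S) can be solved for S when C \<epsilon> \<le> 1/2. The constants depend on K and \<delta> only, which
makes the final bounds uniform in y.\<close>

lemma stable_on_spectral_gap:
  assumes "K \<ge> 0" "\<delta> > 0"
  shows "\<exists>C>0. \<exists>\<epsilon>>0. \<forall>(A\<^sub>0::real^'n^'n) A. (\<forall>x. norm (A\<^sub>0 *v x) \<le> K * norm x) \<longrightarrow>
    spectral_gap \<delta> A\<^sub>0 \<longrightarrow> (\<forall>s\<ge>0. \<forall>x. norm (A s x - A\<^sub>0 *v x) \<le> \<epsilon> * norm x) \<longrightarrow>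
    stable_on {0..} A C"
proof -
  obtain C\<^sub>0 where C\<^sub>0: "C\<^sub>0 \<ge> 0" and bound:
    "\<And>(M::complex^'n^'n) ls v g B G s. length ls \<le> DIM(real^'n^'n) \<Longrightarrow>
      deflated_solution (2 * K) \<delta> M ls v g B G \<Longrightarrow> s \<ge> 0 \<Longrightarrow> norm (v s) \<le> C\<^sub>0 * (norm (v 0) + G)"
    using deflated_solution_bound[of "2 * K" \<delta>] assms by (metis mult_nonneg_nonneg zero_le_numeral)
  define \<epsilon> where "\<epsilon> = inverse (2 * (C\<^sub>0 + 1))"
  have eps: "\<epsilon> > 0" "C\<^sub>0 * \<epsilon> \<le> 1 / 2" using C\<^sub>0 by (auto simp: \<epsilon>_def field_simps)
  have stab: "stable_on {0..} A (2 * (C\<^sub>0 + 1))"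
    if A0: "\<And>x. norm (A\<^sub>0 *v x) \<le> K * norm x" and hyp: "spectral_gap \<delta> A\<^sub>0"
      and A: "\<And>s x. s \<ge> 0 \<Longrightarrow> norm (A s x - A\<^sub>0 *v x) \<le> \<epsilon> * norm x" for A\<^sub>0 :: "real^'n^'n" and A
    unfolding stable_on_def
  proof (intro allI impI ballI)
    fix v v' :: "real \<Rightarrow> real^'n" and B G s
    assume "\<forall>s\<in>{0..}. (v has_vector_derivative v' s) (at s within {0..}) \<and> norm (v s) \<le> B \<and>
        norm (v' s - A s (v s)) \<le> G" and s: "s \<in> {(0::real)..}"
    then have v: "(v has_vector_derivative v' s) (at s within {0..})" "norm (v s) \<le> B"
      "norm (v' s - A s (v s)) \<le> G" if "s \<ge> 0" for s using that by auto
    have G: "G \<ge> 0" using v(3)[of 0] norm_ge_zero order_trans by blast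
    define S where "S = (SUP s\<in>{0..}. norm (v s))"
    have bdd: "bdd_above ((\<lambda>s. norm (v s)) ` {0..})" using v(2) by (intro bdd_aboveI2[where M = B]) auto
    have S: "norm (v s) \<le> S" if "s \<ge> 0" for s
      unfolding S_def by (rule cSUP_upper[OF _ bdd]) (use that in auto)
    obtain ls where ls: "length ls \<le> DIM(real^'n^'n)" "\<And>x. deflate (complexify A\<^sub>0) ls x = 0"
      "\<And>l. l \<in> set ls \<Longrightarrow> \<exists>x. x \<noteq> 0 \<and> complexify A\<^sub>0 *v x = l *s x"
      using deflating_eigenvalues_exist[of A\<^sub>0] by blast
    have "norm (v s) \<le> C\<^sub>0 * (norm (v 0) + (G + \<epsilon> * S))" if "s \<ge> 0" for s
    proof -
      have "deflated_solution (2 * K) \<delta> (complexify A\<^sub>0) ls (\<lambda>s. complex_vec (v s))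
          (\<lambda>s. complex_vec (v' s - A\<^sub>0 *v v s)) B (G + \<epsilon> * S)"
        unfolding deflated_solution_def
      proof (intro conjI allI ballI impI)
        show "norm (complexify A\<^sub>0 *v x) \<le> 2 * K * norm x" for x
          by (rule norm_complexify_mult_le[OF A0 \<open>K \<ge> 0\<close>])
        show "norm l \<le> 2 * K" if l: "l \<in> set ls" for l
        proof -
          obtain x where x: "x \<noteq> 0" "complexify A\<^sub>0 *v x = l *s x" using ls(3)[OF l] by blast
          have "norm l * norm x \<le> 2 * K * norm x"
            using norm_complexify_mult_le[OF A0 \<open>K \<ge> 0\<close>, of x] by (simp add: x(2) norm_vector_smult)
          then show ?thesis using x(1) by simp
        qed
        show "\<bar>Re l\<bar> \<ge> \<delta>" if l: "l \<in> set ls" for l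
          using ls(3)[OF l] hyp unfolding spectral_gap_def by blast
        fix s :: real assume s: "s \<ge> 0"
        have "complexify A\<^sub>0 *v complex_vec (v s) + complex_vec (v' s - A\<^sub>0 *v v s) = complex_vec (v' s)"
          unfolding complexify_mult_complex_vec by (simp add: complex_vec_def vec_eq_iff)
        then show "((\<lambda>s. complex_vec (v s)) has_vector_derivative
            complexify A\<^sub>0 *v complex_vec (v s) + complex_vec (v' s - A\<^sub>0 *v v s)) (at s within {0..})"
          using bounded_linear.has_vector_derivative[OF bounded_linear_complex_vec v(1)[OF s]] by simp
        show "norm (complex_vec (v s)) \<le> B" using v(2)[OF s] by (simp add: norm_complex_vec)
        have "norm (v' s - A\<^sub>0 *v v s) \<le> norm (v' s - A s (v s)) + norm (A s (v s) - A\<^sub>0 *v v s)"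
          using norm_triangle_ineq[of "v' s - A s (v s)" "A s (v s) - A\<^sub>0 *v v s"] by simp
        also have "\<dots> \<le> G + \<epsilon> * norm (v s)" using v(3)[OF s] A[OF s] by (rule add_mono)
        also have "\<dots> \<le> G + \<epsilon> * S" using S[OF s] eps by simp
        finally show "norm (complex_vec (v' s - A\<^sub>0 *v v s)) \<le> G + \<epsilon> * S" by (simp add: norm_complex_vec)
        show "deflate (complexify A\<^sub>0) ls (complex_vec (v s)) = 0" by (rule ls(2))
      qed
      from bound[OF ls(1) this that] show ?thesis by (simp add: norm_complex_vec)
    qed
    then have "S \<le> C\<^sub>0 * (norm (v 0) + (G + \<epsilon> * S))"
      unfolding S_def by (intro cSUP_least) auto
    also have "\<dots> = C\<^sub>0 * (norm (v 0) + G) + (C\<^sub>0 * \<epsilon>) * S" by (simp add: algebra_simps)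
    also have "(C\<^sub>0 * \<epsilon>) * S \<le> 1 / 2 * S"
      using eps S[of 0] norm_ge_zero[of "v 0"] by (intro mult_right_mono) linarith+
    finally have "S \<le> 2 * C\<^sub>0 * (norm (v 0) + G)" by simp
    also have "\<dots> \<le> 2 * (C\<^sub>0 + 1) * (norm (v 0) + G)"
      using G by (intro mult_right_mono) auto
    finally show "norm (v s) \<le> 2 * (C\<^sub>0 + 1) * (norm (v 0) + G)" using S[of s] s by auto
  qed
  show ?thesis
  proof (intro exI conjI allI impI)
    show "2 * (C\<^sub>0 + 1) > 0" "\<epsilon> > 0" using C\<^sub>0 eps by auto
    fix A\<^sub>0 :: "real^'n^'n" and A :: "real \<Rightarrow> real^'n \<Rightarrow> real^'n"
    assume "\<forall>x. norm (A\<^sub>0 *v x) \<le> K * norm x" "spectral_gap \<delta> A\<^sub>0"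
      "\<forall>s\<ge>0. \<forall>x. norm (A s x - A\<^sub>0 *v x) \<le> \<epsilon> * norm x"
    then show "stable_on {0..} A (2 * (C\<^sub>0 + 1))" by (intro stab) auto
  qed
qed

section \<open>Smooth dependence on parameters\<close>

text \<open>The difference quotients D n of z in direction w satisfy D' = A D + R w up to an error that tends to 0
uniformly in time. The difference of two of them solves v' = A v up to a small error, so that stability makes
them Cauchy, uniformly in time. The limit is a solution of the variational equation that is bounded in time, which is
the property on which the next application of stability relies.\<close>

lemma stable_difference_quotient_limit:
  fixes z :: "real \<Rightarrow> 'e::euclidean_space \<Rightarrow> 'b::euclidean_space"
  assumes I: "convex I" "0 \<in> I" and st: "stable_on I A C" "C \<ge> 0"
    and A: "\<And>s. s \<in> I \<Longrightarrow> linear (A s)" "\<And>s x. s \<in> I \<Longrightarrow> norm (A s x) \<le> K * norm x"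
    and der: "\<And>s p. s \<in> I \<Longrightarrow> ((\<lambda>s. z s p) has_vector_derivative z' s p) (at s within I)"
    and bd: "\<And>p. \<exists>B. \<forall>s\<in>I. norm (z s p) \<le> B"
    and R: "\<And>s. s \<in> I \<Longrightarrow> linear (R s)"
    and rem: "\<And>e. e > 0 \<Longrightarrow> \<forall>\<^sub>F p in at y. \<forall>s\<in>I.
       norm (z' s p - z' s y - A s (z s p - z s y) - R s (p - y)) \<le> e * norm (p - y)"
    and init: "(z 0 has_derivative Z) (at y)"
  shows "\<exists>f. f 0 = Z w \<and> (\<forall>s\<in>I. (f has_vector_derivative A s (f s) + R s w) (at s within I)) \<and>
    (\<exists>B. \<forall>s\<in>I. norm (f s) \<le> B)"
proof (cases "w = 0")
  case True
  have "Z 0 = 0" using has_derivative_linear[OF init] by (rule linear_0)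
  moreover have "A s 0 + R s 0 = 0" if "s \<in> I" for s
    using linear_0[OF A(1)[OF that]] linear_0[OF R[OF that]] by simp
  ultimately show ?thesis using True by (intro exI[of _ "\<lambda>_. 0"]) auto
next
  case False
  \<comment> \<open>Any null sequence of positive numbers would do.\<close>
  define h :: "nat \<Rightarrow> real" where "h = (\<lambda>n. inverse (real (Suc n)))"
  define p where "p = (\<lambda>n. y + h n *\<^sub>R w)"
  define D where "D = (\<lambda>n s. (1 / h n) *\<^sub>R (z s (p n) - z s y))"
  define D' where "D' = (\<lambda>n s. (1 / h n) *\<^sub>R (z' s (p n) - z' s y))"
  have h: "h n > 0" for n by (simp add: h_def)
  have "p \<longlonglongrightarrow> y + 0 *\<^sub>R w" unfolding p_def h_def by (intro tendsto_intros LIMSEQ_inverse_real_of_nat)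
  moreover have "p n \<noteq> y" for n using False h[of n] by (simp add: p_def)
  ultimately have p: "filterlim p (at y) sequentially" by (simp add: filterlim_at)
  have quot: "\<forall>\<^sub>F n in sequentially. \<forall>s\<in>I. norm (D' n s - A s (D n s) - R s w) \<le> e" if "e > 0" for e
  proof -
    have "\<forall>\<^sub>F n in sequentially. \<forall>s\<in>I. norm (z' s (p n) - z' s y - A s (z s (p n) - z s y) - R s (p n - y))
        \<le> (e / norm w) * norm (p n - y)"
      using filterlim_iff[THEN iffD1, OF p, rule_format, OF rem[of "e / norm w"]] that False by simp
    then show ?thesis
    proof eventually_elim
      case (elim n)
      show ?case
      proof
        fix s assume s: "s \<in> I"
        have "D' n s - A s (D n s) - R s w =
          (1 / h n) *\<^sub>R (z' s (p n) - z' s y - A s (z s (p n) - z s y) - R s (p n - y))"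
        proof -
          have "A s (D n s) = (1 / h n) *\<^sub>R A s (z s (p n) - z s y)"
            unfolding D_def by (rule linear_cmul[OF A(1)[OF s]])
          moreover have "R s w = (1 / h n) *\<^sub>R R s (p n - y)"
            using h[of n] by (simp add: p_def linear_cmul[OF R[OF s]])
          ultimately show ?thesis by (simp only: D'_def scaleR_diff_right)
        qed
        then have "norm (D' n s - A s (D n s) - R s w) =
          (1 / h n) * norm (z' s (p n) - z' s y - A s (z s (p n) - z s y) - R s (p n - y))"
          using h[of n] by simp
        also have "\<dots> \<le> (1 / h n) * ((e / norm w) * norm (p n - y))"
          using elim s h[of n] by (intro mult_left_mono) auto
        also have "\<dots> = e" using h[of n] False by (simp add: p_def)
        finally show "norm (D' n s - A s (D n s) - R s w) \<le> e" .
      qed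
    qed
  qed
  have quot0: "\<forall>\<^sub>F n in sequentially. norm (D n 0 - Z w) \<le> e" if "e > 0" for e
  proof -
    have "\<forall>\<^sub>F q in at y. norm (z 0 q - z 0 y - Z (q - y)) \<le> (e / norm w) * norm (q - y)"
    proof -
      have "e / norm w > 0" using that False by simp
      then show ?thesis using init unfolding has_derivative_within_alt2 by blast
    qed
    then have "\<forall>\<^sub>F n in sequentially. norm (z 0 (p n) - z 0 y - Z (p n - y)) \<le> (e / norm w) * norm (p n - y)"
      using filterlim_iff[THEN iffD1, OF p, rule_format] by blast
    then show ?thesis
    proof eventually_elim
      case (elim n)
      have "D n 0 - Z w = (1 / h n) *\<^sub>R (z 0 (p n) - z 0 y - Z (p n - y))"
        using h[of n] by (simp add: D_def p_def linear_cmul[OF has_derivative_linear[OF init]] scaleR_diff_right)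
      then have "norm (D n 0 - Z w) = (1 / h n) * norm (z 0 (p n) - z 0 y - Z (p n - y))"
        using h[of n] by simp
      also have "\<dots> \<le> (1 / h n) * ((e / norm w) * norm (p n - y))"
        using elim h[of n] by (intro mult_left_mono) auto
      also have "\<dots> = e" using h[of n] False by (simp add: p_def)
      finally show ?case .
    qed
  qed
  have derD: "(D n has_vector_derivative D' n s) (at s within I)" if "s \<in> I" for n s
    unfolding D_def D'_def
    by (intro bounded_linear.has_vector_derivative[OF bounded_linear_scaleR_right] has_vector_derivative_diff der that)
  have bdD: "\<exists>B. \<forall>s\<in>I. norm (D n s) \<le> B" for n
  proof -
    obtain B1 B2 where "\<forall>s\<in>I. norm (z s (p n)) \<le> B1" "\<forall>s\<in>I. norm (z s y) \<le> B2" using bd by metis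
    then have "\<forall>s\<in>I. norm (D n s) \<le> (1 / h n) * (B1 + B2)"
      using h[of n] unfolding D_def by (auto intro!: divide_right_mono norm_triangle_le_diff add_mono)
    then show ?thesis by blast
  qed
  have Cauchy: "uniformly_Cauchy_on I D"
  proof (rule uniformly_Cauchy_onI)
    fix e :: real assume e: "e > 0"
    define e' where "e' = e / (4 * (C + 1))"
    have "e' > 0" using e st by (simp add: e'_def)
    from eventually_conj[OF quot[OF this] quot0[OF this]] obtain N where
      N: "\<And>n s. n \<ge> N \<Longrightarrow> s \<in> I \<Longrightarrow> norm (D' n s - A s (D n s) - R s w) \<le> e'"
        "\<And>n. n \<ge> N \<Longrightarrow> norm (D n 0 - Z w) \<le> e'"
      unfolding eventually_sequentially by auto
    have "norm (D m s - D n s) < e" if "m \<ge> N" "n \<ge> N" "s \<in> I" for m n s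
    proof -
      obtain B1 B2 where B: "\<forall>s\<in>I. norm (D m s) \<le> B1" "\<forall>s\<in>I. norm (D n s) \<le> B2" using bdD by metis
      have "norm (D m s - D n s) \<le> C * (norm (D m 0 - D n 0) + 2 * e')"
      proof (rule stable_onD[OF st(1), where B = "B1 + B2" and v' = "\<lambda>s. D' m s - D' n s"])
        fix s assume s: "s \<in> I"
        show "((\<lambda>s. D m s - D n s) has_vector_derivative D' m s - D' n s) (at s within I)"
          by (intro has_vector_derivative_diff derD s)
        show "norm (D m s - D n s) \<le> B1 + B2"
          using B s by (intro norm_triangle_le_diff add_mono) auto
        have "D' m s - D' n s - A s (D m s - D n s) =
            (D' m s - A s (D m s) - R s w) - (D' n s - A s (D n s) - R s w)"
          by (simp add: linear_diff[OF A(1)[OF s]])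
        also have "norm \<dots> \<le> e' + e'"
          by (rule norm_triangle_le_diff[OF add_mono[OF N(1)[OF that(1) s] N(1)[OF that(2) s]]])
        finally show "norm (D' m s - D' n s - A s (D m s - D n s)) \<le> 2 * e'" by simp
      qed fact
      also have "norm (D m 0 - D n 0) \<le> 2 * e'"
        using N(2)[OF that(1)] N(2)[OF that(2)] norm_triangle_ineq4[of "D m 0 - Z w" "D n 0 - Z w"] by simp
      finally have "norm (D m s - D n s) \<le> C * (4 * e')" using st by (simp add: mult_left_mono)
      also have "\<dots> < (C + 1) * (4 * e')" using \<open>e' > 0\<close> by simp
      also have "\<dots> = e" using st by (simp add: e'_def field_simps)
      finally show ?thesis .
    qed
    then show "\<exists>M. \<forall>x\<in>I. \<forall>m\<ge>M. \<forall>n\<ge>M. dist (D m x) (D n x) < e"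
      unfolding dist_norm by blast
  qed
  obtain f where f: "uniform_limit I D f sequentially"
    using Cauchy_uniformly_convergent[OF Cauchy] unfolding uniformly_convergent_on_def by blast
  have lim: "(\<lambda>n. D n s) \<longlonglongrightarrow> f s" if "s \<in> I" for s
    using tendsto_uniform_limitI[OF f that] .
  have "\<exists>g. \<forall>s\<in>I. (\<lambda>n. D n s) \<longlonglongrightarrow> g s \<and> (g has_derivative (\<lambda>t. t *\<^sub>R (A s (f s) + R s w))) (at s within I)"
  proof (rule has_derivative_sequence[where f = D and f' = "\<lambda>n s t. t *\<^sub>R D' n s" and l = "f 0"])
    show "convex I" "0 \<in> I" "(\<lambda>n. D n 0) \<longlonglongrightarrow> f 0" using I lim by auto
    show "(D n has_derivative (\<lambda>t. t *\<^sub>R D' n s)) (at s within I)" if "s \<in> I" for n s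
      using derD[OF that] by (simp add: has_vector_derivative_def)
    fix e :: real assume e: "e > 0"
    define e' where "e' = e / (\<bar>K\<bar> + 1)"
    have "e' > 0" using e by (simp add: e'_def)
    show "\<forall>\<^sub>F n in sequentially. \<forall>s\<in>I. \<forall>t. norm (t *\<^sub>R D' n s - t *\<^sub>R (A s (f s) + R s w)) \<le> e * norm t"
      using eventually_conj[OF quot[OF \<open>e' > 0\<close>] uniform_limitD[OF f \<open>e' > 0\<close>]]
    proof eventually_elim
      case (elim n)
      show ?case
      proof (intro ballI allI)
        fix s t assume s: "s \<in> I"
        have "D' n s - (A s (f s) + R s w) = (D' n s - A s (D n s) - R s w) + A s (D n s - f s)"
          by (simp add: linear_diff[OF A(1)[OF s]])
        also have "norm \<dots> \<le> e' + \<bar>K\<bar> * e'"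
        proof (intro norm_triangle_le add_mono)
          have "norm (A s (D n s - f s)) \<le> K * norm (D n s - f s)" by (rule A(2)[OF s])
          also have "\<dots> \<le> \<bar>K\<bar> * e'"
            using elim s by (intro mult_mono) (auto simp: dist_norm intro: less_imp_le)
          finally show "norm (A s (D n s - f s)) \<le> \<bar>K\<bar> * e'" .
        qed (use elim s in auto)
        also have "\<dots> = (\<bar>K\<bar> + 1) * e'" by (simp add: algebra_simps)
        also have "\<dots> = e" by (simp add: e'_def)
        finally show "norm (t *\<^sub>R D' n s - t *\<^sub>R (A s (f s) + R s w)) \<le> e * norm t"
          unfolding scaleR_diff_right[symmetric] norm_scaleR real_norm_def mult.commute[of e]
          by (rule mult_left_mono) simp
      qed
    qed
  qed
  then obtain g where g: "\<And>s. s \<in> I \<Longrightarrow> (\<lambda>n. D n s) \<longlonglongrightarrow> g s"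
    "\<And>s. s \<in> I \<Longrightarrow> (g has_vector_derivative A s (f s) + R s w) (at s within I)"
    unfolding has_vector_derivative_def by blast
  have gf: "g s = f s" if "s \<in> I" for s using LIMSEQ_unique[OF g(1) lim] that by blast
  have "(g has_vector_derivative A s (g s) + R s w) (at s within I)" if "s \<in> I" for s
    using g(2)[OF that] gf[OF that] by simp
  moreover have "g 0 = Z w"
  proof (rule LIMSEQ_unique[OF g(1)[OF I(2)]])
    show "(\<lambda>n. D n 0) \<longlonglongrightarrow> Z w"
    proof (rule tendstoI)
      fix e :: real assume "e > 0"
      then have "e / 2 > 0" by simp
      from quot0[OF this] show "\<forall>\<^sub>F n in sequentially. dist (D n 0) (Z w) < e"
        by eventually_elim (use \<open>e > 0\<close> in \<open>simp add: dist_norm\<close>)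
    qed
  qed
  moreover have "\<exists>B. \<forall>s\<in>I. norm (g s) \<le> B"
  proof -
    obtain n where n: "\<forall>s\<in>I. dist (D n s) (f s) < 1"
      using uniform_limitD[OF f, of 1] unfolding eventually_sequentially by auto
    obtain B where B: "\<forall>s\<in>I. norm (D n s) \<le> B" using bdD by blast
    have "norm (g s) \<le> B + 1" if "s \<in> I" for s
    proof -
      have "norm (g s) \<le> norm (D n s) + dist (D n s) (f s)"
        using gf[OF that] norm_triangle_sub[of "f s" "D n s"] by (simp add: dist_norm norm_minus_commute)
      then show ?thesis using n B that by fastforce
    qed
    then show ?thesis by blast
  qed
  ultimately show ?thesis by blast
qed

text \<open>The limits for the various w depend linearly on w, because by stability the only bounded solution of v' = A v
that vanishes at 0 is 0. The remainder z p - z y - \<zeta> (p - y) satisfies the equation up to o(|p - y|), so that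
stability turns directional into Frechet differentiability.\<close>

lemma stable_ode_differentiable:
  fixes z :: "real \<Rightarrow> 'e::euclidean_space \<Rightarrow> 'b::euclidean_space"
  assumes I: "convex I" "0 \<in> I" and st: "stable_on I A C" "C \<ge> 0"
    and A: "\<And>s. s \<in> I \<Longrightarrow> linear (A s)" "\<And>s x. s \<in> I \<Longrightarrow> norm (A s x) \<le> K * norm x"
    and der: "\<And>s p. s \<in> I \<Longrightarrow> ((\<lambda>s. z s p) has_vector_derivative z' s p) (at s within I)"
    and bd: "\<And>p. \<exists>B. \<forall>s\<in>I. norm (z s p) \<le> B"
    and R: "\<And>s. s \<in> I \<Longrightarrow> linear (R s)"
    and rem: "\<And>e. e > 0 \<Longrightarrow> \<forall>\<^sub>F p in at y. \<forall>s\<in>I.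
       norm (z' s p - z' s y - A s (z s p - z s y) - R s (p - y)) \<le> e * norm (p - y)"
    and init: "(z 0 has_derivative Z) (at y)"
  shows "\<exists>\<zeta>. (\<forall>s\<in>I. (z s has_derivative \<zeta> s) (at y)) \<and> \<zeta> 0 = Z \<and>
    (\<forall>w. \<forall>s\<in>I. ((\<lambda>s. \<zeta> s w) has_vector_derivative A s (\<zeta> s w) + R s w) (at s within I)) \<and>
    (\<forall>w. \<exists>B. \<forall>s\<in>I. norm (\<zeta> s w) \<le> B)"
proof -
  have "\<forall>w. \<exists>f. f 0 = Z w \<and> (\<forall>s\<in>I. (f has_vector_derivative A s (f s) + R s w) (at s within I)) \<and>
    (\<exists>B. \<forall>s\<in>I. norm (f s) \<le> B)"
    by (intro allI stable_difference_quotient_limit[OF I st A der bd R rem init])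
  then obtain \<xi> where \<xi>: "\<And>w. \<xi> w 0 = Z w"
    "\<And>w s. s \<in> I \<Longrightarrow> (\<xi> w has_vector_derivative A s (\<xi> w s) + R s w) (at s within I)"
    "\<And>w. \<exists>B. \<forall>s\<in>I. norm (\<xi> w s) \<le> B"
    by metis
  have Z: "linear Z" by (rule has_derivative_linear[OF init])
  have zero: "v s = 0"
    if "\<And>s. s \<in> I \<Longrightarrow> (v has_vector_derivative A s (v s)) (at s within I)"
      "\<And>s. s \<in> I \<Longrightarrow> norm (v s) \<le> B" "v 0 = 0" "s \<in> I" for v s B
    using stable_onD[OF st(1), where v = v and B = B and v' = "\<lambda>s. A s (v s)" and G = 0] that by auto
  have lin: "linear (\<lambda>w. \<xi> w s)" if s: "s \<in> I" for s
  proof (rule linearI)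
    fix w1 w2 :: 'e and c :: real
    obtain B1 where B1: "\<And>s. s \<in> I \<Longrightarrow> norm (\<xi> w1 s) \<le> B1" using \<xi>(3)[of w1] by blast
    obtain B2 where B2: "\<And>s. s \<in> I \<Longrightarrow> norm (\<xi> w2 s) \<le> B2" using \<xi>(3)[of w2] by blast
    obtain B3 where B3: "\<And>s. s \<in> I \<Longrightarrow> norm (\<xi> (w1 + w2) s) \<le> B3" using \<xi>(3)[of "w1 + w2"] by blast
    obtain B4 where B4: "\<And>s. s \<in> I \<Longrightarrow> norm (\<xi> (c *\<^sub>R w1) s) \<le> B4" using \<xi>(3)[of "c *\<^sub>R w1"] by blast
    have "\<xi> (w1 + w2) s - \<xi> w1 s - \<xi> w2 s = 0"
    proof (rule zero[where v = "\<lambda>s. \<xi> (w1 + w2) s - \<xi> w1 s - \<xi> w2 s" and B = "B3 + B1 + B2"])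
      fix s assume s: "s \<in> I"
      have "((\<lambda>s. \<xi> (w1 + w2) s - \<xi> w1 s - \<xi> w2 s) has_vector_derivative
        (A s (\<xi> (w1 + w2) s) + R s (w1 + w2)) - (A s (\<xi> w1 s) + R s w1) - (A s (\<xi> w2 s) + R s w2)) (at s within I)"
        by (intro has_vector_derivative_diff \<xi>(2) s)
      then show "((\<lambda>s. \<xi> (w1 + w2) s - \<xi> w1 s - \<xi> w2 s) has_vector_derivative
        A s (\<xi> (w1 + w2) s - \<xi> w1 s - \<xi> w2 s)) (at s within I)"
        by (rule has_vector_derivative_eq_rhs)
           (simp add: linear_diff[OF A(1)[OF s]] linear_add[OF R[OF s]])
      show "norm (\<xi> (w1 + w2) s - \<xi> w1 s - \<xi> w2 s) \<le> B3 + B1 + B2"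
        by (intro norm_triangle_le_diff add_mono B1 B2 B3 s)
    qed (use s \<xi>(1) linear_add[OF Z] in auto)
    then show "\<xi> (w1 + w2) s = \<xi> w1 s + \<xi> w2 s" by (simp add: algebra_simps)
    have "\<xi> (c *\<^sub>R w1) s - c *\<^sub>R \<xi> w1 s = 0"
    proof (rule zero[where v = "\<lambda>s. \<xi> (c *\<^sub>R w1) s - c *\<^sub>R \<xi> w1 s" and B = "B4 + \<bar>c\<bar> * B1"])
      fix s assume s: "s \<in> I"
      have "((\<lambda>s. \<xi> (c *\<^sub>R w1) s - c *\<^sub>R \<xi> w1 s) has_vector_derivative
        (A s (\<xi> (c *\<^sub>R w1) s) + R s (c *\<^sub>R w1)) - c *\<^sub>R (A s (\<xi> w1 s) + R s w1)) (at s within I)"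
        by (intro has_vector_derivative_diff bounded_linear.has_vector_derivative[OF bounded_linear_scaleR_right] \<xi>(2) s)
      then show "((\<lambda>s. \<xi> (c *\<^sub>R w1) s - c *\<^sub>R \<xi> w1 s) has_vector_derivative
        A s (\<xi> (c *\<^sub>R w1) s - c *\<^sub>R \<xi> w1 s)) (at s within I)"
        by (rule has_vector_derivative_eq_rhs)
           (simp add: linear_diff[OF A(1)[OF s]] linear_cmul[OF A(1)[OF s]] linear_cmul[OF R[OF s]]
             scaleR_add_right)
      show "norm (\<xi> (c *\<^sub>R w1) s - c *\<^sub>R \<xi> w1 s) \<le> B4 + \<bar>c\<bar> * B1"
        using B1[OF s] by (intro norm_triangle_le_diff add_mono B4 s) (simp add: mult_left_mono)
    qed (use s \<xi>(1) linear_cmul[OF Z] in auto)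
    then show "\<xi> (c *\<^sub>R w1) s = c *\<^sub>R \<xi> w1 s" by simp
  qed
  have "(z s has_derivative (\<lambda>w. \<xi> w s)) (at y)" if s: "s \<in> I" for s
    unfolding has_derivative_within_alt2
  proof (intro conjI allI impI)
    show "bounded_linear (\<lambda>w. \<xi> w s)" using lin[OF s] by (simp add: linear_conv_bounded_linear)
    fix e :: real assume e: "e > 0"
    define e' where "e' = e / (2 * (C + 1))"
    have e': "e' > 0" using e st by (simp add: e'_def)
    have "\<forall>\<^sub>F p in at y. norm (z 0 p - z 0 y - Z (p - y)) \<le> e' * norm (p - y)"
      using init e' unfolding has_derivative_within_alt2 by simp
    from eventually_conj[OF this rem[OF e']]
    show "\<forall>\<^sub>F p in at y. norm (z s p - z s y - \<xi> (p - y) s) \<le> e * norm (p - y)"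
    proof eventually_elim
      case (elim p)
      obtain B1 where B1: "\<And>s. s \<in> I \<Longrightarrow> norm (z s p) \<le> B1" using bd[of p] by blast
      obtain B2 where B2: "\<And>s. s \<in> I \<Longrightarrow> norm (z s y) \<le> B2" using bd[of y] by blast
      obtain B3 where B3: "\<And>s. s \<in> I \<Longrightarrow> norm (\<xi> (p - y) s) \<le> B3" using \<xi>(3)[of "p - y"] by blast
      have "norm (z s p - z s y - \<xi> (p - y) s) \<le> C * (norm (z 0 p - z 0 y - \<xi> (p - y) 0) + e' * norm (p - y))"
      proof (rule stable_onD[OF st(1), where B = "B1 + B2 + B3" and
            v' = "\<lambda>s. z' s p - z' s y - (A s (\<xi> (p - y) s) + R s (p - y))"])
        fix s assume s: "s \<in> I"
        show "((\<lambda>s. z s p - z s y - \<xi> (p - y) s) has_vector_derivative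
            z' s p - z' s y - (A s (\<xi> (p - y) s) + R s (p - y))) (at s within I)"
          by (intro has_vector_derivative_diff der \<xi>(2) s)
        show "norm (z s p - z s y - \<xi> (p - y) s) \<le> B1 + B2 + B3"
          by (intro norm_triangle_le_diff add_mono B1 B2 B3 s)
        have "norm (z' s p - z' s y - A s (z s p - z s y) - R s (p - y)) \<le> e' * norm (p - y)"
          using elim s by blast
        moreover have "A s (z s p - z s y - \<xi> (p - y) s) = A s (z s p - z s y) - A s (\<xi> (p - y) s)"
          by (rule linear_diff[OF A(1)[OF s]])
        ultimately show "norm (z' s p - z' s y - (A s (\<xi> (p - y) s) + R s (p - y)) - A s (z s p - z s y - \<xi> (p - y) s))
            \<le> e' * norm (p - y)"
          by (simp add: algebra_simps)
      qed fact
      also have "\<dots> \<le> C * (e' * norm (p - y) + e' * norm (p - y))"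
        using elim st e' by (intro mult_left_mono add_mono) (auto simp: \<xi>(1))
      also have "\<dots> = C * (2 * e') * norm (p - y)" by simp
      also have "\<dots> \<le> (C + 1) * (2 * e') * norm (p - y)"
        using e' by (intro mult_right_mono) auto
      also have "(C + 1) * (2 * e') = e" using st by (simp add: e'_def field_simps)
      finally show ?case .
    qed
  qed
  then show ?thesis
    by (intro exI[of _ "\<lambda>s w. \<xi> w s"]) (use \<xi> in auto)
qed

text \<open>The operator is given through its values a b on the basis vectors b, so that its smoothness is that of vector-valued
families. For j = 0 stability applies to the difference of two solutions. In the step, the derivative of z in
direction w solves an equation with the same operator and with an inhomogeneity of class C^j, since z itself
is of class C^j by the induction hypothesis.\<close>

lemma linear_ode_uniform_C:
  fixes z g :: "real \<Rightarrow> 'e::euclidean_space \<Rightarrow> 'b::euclidean_space" and a :: "'b \<Rightarrow> real \<Rightarrow> 'e \<Rightarrow> 'b"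
  assumes I: "convex I" "0 \<in> I" and C: "C \<ge> 0"
    and st: "\<And>y. stable_on I (\<lambda>s v. \<Sum>b\<in>Basis. (v \<bullet> b) *\<^sub>R a b s y) C"
  shows "(\<And>b. b \<in> Basis \<Longrightarrow> uniform_C j I (a b)) \<Longrightarrow> uniform_C j I g \<Longrightarrow>
    (\<And>y s. s \<in> I \<Longrightarrow> ((\<lambda>s. z s y) has_vector_derivative
       (\<Sum>b\<in>Basis. (z s y \<bullet> b) *\<^sub>R a b s y) + g s y) (at s within I)) \<Longrightarrow>
    (\<And>y. \<exists>B. \<forall>s\<in>I. norm (z s y) \<le> B) \<Longrightarrow> uniform_C j I (\<lambda>s. z 0) \<Longrightarrow> uniform_C j I z"
proof (induction j arbitrary: g z)
  case 0
  let ?A = "\<lambda>s y v. \<Sum>b\<in>Basis. (v \<bullet> b) *\<^sub>R a b s y"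
  obtain Kg where Kg: "\<And>s y. s \<in> I \<Longrightarrow> norm (g s y) \<le> Kg"
    using 0(2) by (auto simp: uniformly_bounded_def)
  obtain K0 where K0: "\<And>y. norm (z 0 y) \<le> K0"
    using 0(5) I(2) by (auto simp: uniformly_bounded_def)
  have z_bd: "norm (z s y) \<le> C * (K0 + Kg)" if s: "s \<in> I" for s y
  proof -
    obtain B where B: "\<And>s. s \<in> I \<Longrightarrow> norm (z s y) \<le> B" using 0(4)[of y] by blast
    have "norm (z s y) \<le> C * (norm (z 0 y) + Kg)"
      by (rule stable_onD[OF st[of y] 0(3) B _ s]) (auto simp: Kg)
    also have "\<dots> \<le> C * (K0 + Kg)" using K0 C by (intro mult_left_mono) auto
    finally show ?thesis .
  qed
  define Z where "Z = \<bar>C * (K0 + Kg)\<bar>"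
  have Z: "norm (z s y) \<le> Z" if "s \<in> I" for s y
    unfolding Z_def by (rule order_trans[OF z_bd[OF that] abs_ge_self])
  have "Z \<ge> 0" by (simp add: Z_def)
  define d where "d = real (DIM('b))"
  have "uniform_limit I (\<lambda>p s. z s p) (\<lambda>s. z s y) (at y)" for y
  proof (rule uniform_limitI)
    fix e :: real assume e: "e > 0"
    \<comment> \<open>The errors of the d coefficients, of g and of the initial value add up to at most (2 + d Z) e', and C magnifies them.\<close>
    define e' where "e' = e / ((C + 1) * (2 + d * Z))"
    have den: "C + 1 > 0" "2 + d * Z > 0" using C \<open>Z \<ge> 0\<close> by (auto simp: d_def intro: add_pos_nonneg)
    then have e': "e' > 0" using e by (simp add: e'_def)
    have "\<forall>\<^sub>F p in at y. \<forall>b\<in>Basis. \<forall>s\<in>I. dist (a b s p) (a b s y) < e'"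
      using 0(1) e' by (intro eventually_ball_finite) (auto simp: equicontinuous_def uniform_limit_iff)
    moreover have "\<forall>\<^sub>F p in at y. \<forall>s\<in>I. dist (g s p) (g s y) < e'"
      "\<forall>\<^sub>F p in at y. \<forall>s\<in>I. dist (z 0 p) (z 0 y) < e'"
      using 0(2,5) e' by (auto simp: equicontinuous_def uniform_limit_iff)
    ultimately show "\<forall>\<^sub>F p in at y. \<forall>s\<in>I. dist (z s p) (z s y) < e"
    proof eventually_elim
      case (elim p)
      show ?case
      proof
        fix s assume s: "s \<in> I"
        have "norm (z s p - z s y) \<le> C * (norm (z 0 p - z 0 y) + (d * (Z * e') + e'))"
        proof (rule stable_onD[OF st[of y], where B = "Z + Z" and
              v' = "\<lambda>s. ?A s p (z s p) + g s p - (?A s y (z s y) + g s y)"])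
          fix s assume s: "s \<in> I"
          show "((\<lambda>s. z s p - z s y) has_vector_derivative
              ?A s p (z s p) + g s p - (?A s y (z s y) + g s y)) (at s within I)"
            by (intro has_vector_derivative_diff 0(3) s)
          show "norm (z s p - z s y) \<le> Z + Z" by (intro norm_triangle_le_diff add_mono Z s)
          have "?A s p (z s p) + g s p - (?A s y (z s y) + g s y) - ?A s y (z s p - z s y)
            = (\<Sum>b\<in>Basis. (z s p \<bullet> b) *\<^sub>R (a b s p - a b s y)) + (g s p - g s y)"
            by (simp add: inner_diff_left scaleR_diff_left scaleR_diff_right sum_subtractf)
          also have "norm \<dots> \<le> (\<Sum>b\<in>(Basis::'b set). Z * e') + e'"
          proof (intro norm_triangle_le add_mono sum_norm_le)
            fix b :: 'b assume b: "b \<in> Basis"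
            have "\<bar>z s p \<bullet> b\<bar> \<le> Z" using Basis_le_norm[OF b, of "z s p"] Z[OF s, of p] by linarith
            moreover have "norm (a b s p - a b s y) \<le> e'" using elim b s by (auto simp: dist_norm intro: less_imp_le)
            ultimately show "norm ((z s p \<bullet> b) *\<^sub>R (a b s p - a b s y)) \<le> Z * e'"
              using \<open>Z \<ge> 0\<close> by (auto intro: mult_mono)
          next
            show "norm (g s p - g s y) \<le> e'" using elim s by (auto simp: dist_norm intro: less_imp_le)
          qed
          also have "\<dots> = d * (Z * e') + e'" by (simp add: d_def)
          finally show "norm (?A s p (z s p) + g s p - (?A s y (z s y) + g s y) - ?A s y (z s p - z s y))
              \<le> d * (Z * e') + e'" .
        qed fact
        also have "\<dots> \<le> C * (e' + (d * (Z * e') + e'))"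
          using elim I C by (intro mult_left_mono add_right_mono) (auto simp: dist_norm intro: less_imp_le)
        also have "\<dots> = C * (e' * (2 + d * Z))" by (simp add: algebra_simps)
        also have "\<dots> < (C + 1) * (e' * (2 + d * Z))"
          using e' den by (intro mult_strict_right_mono mult_pos_pos) auto
        also have "\<dots> = e" using den by (simp add: e'_def)
        finally show "dist (z s p) (z s y) < e" by (simp add: dist_norm)
      qed
    qed
  qed
  then show ?case using Z by (auto simp: equicontinuous_def uniformly_bounded_def)
next
  case (Suc j)
  let ?A = "\<lambda>s y v. \<Sum>b\<in>Basis. (v \<bullet> b) *\<^sub>R a b s y"
  have zj: "uniform_C j I z"
    by (rule Suc.IH[of g]) (use Suc.prems in \<open>auto intro: uniform_C_Suc_imp simp del: uniform_C.simps\<close>)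
  have D: "\<exists>g' K. (\<forall>s\<in>I. \<forall>y. (g s has_derivative g' s y) (at y)) \<and>
     (\<forall>w. uniform_C j I (\<lambda>s y. g' s y w)) \<and> K \<ge> 0 \<and> (\<forall>s\<in>I. \<forall>y w. norm (g' s y w) \<le> K * norm w)"
    if "uniform_C (Suc j) I g" for g :: "real \<Rightarrow> 'e \<Rightarrow> 'b"
    by (rule uniform_C_Suc_D[OF that]) blast
  obtain g' where g': "\<And>s y. s \<in> I \<Longrightarrow> (g s has_derivative g' s y) (at y)"
    "\<And>w. uniform_C j I (\<lambda>s y. g' s y w)"
    using D[OF Suc.prems(2)] by blast
  have "\<forall>b\<in>Basis. \<exists>a' K. (\<forall>s\<in>I. \<forall>y. (a b s has_derivative a' s y) (at y)) \<and>
     (\<forall>w. uniform_C j I (\<lambda>s y. a' s y w)) \<and> K \<ge> 0 \<and> (\<forall>s\<in>I. \<forall>y w. norm (a' s y w) \<le> K * norm w)"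
    using D[OF Suc.prems(1)] by blast
  then obtain a' Ka' where a': "\<And>b s y. b \<in> Basis \<Longrightarrow> s \<in> I \<Longrightarrow> (a b s has_derivative a' b s y) (at y)"
     "\<And>b w. b \<in> Basis \<Longrightarrow> uniform_C j I (\<lambda>s y. a' b s y w)" "\<And>b. b \<in> Basis \<Longrightarrow> Ka' b \<ge> 0"
     "\<And>b s y w. b \<in> Basis \<Longrightarrow> s \<in> I \<Longrightarrow> norm (a' b s y w) \<le> Ka' b * norm w"
    by metis
  have "\<forall>b. \<exists>K. b \<in> Basis \<longrightarrow> (\<forall>s\<in>I. \<forall>y. norm (a b s y) \<le> K)"
    using uniform_C_bounded[OF Suc.prems(1)] unfolding uniformly_bounded_def by metis
  then obtain Ka where Ka: "\<And>b s y. b \<in> Basis \<Longrightarrow> s \<in> I \<Longrightarrow> norm (a b s y) \<le> Ka b" by metis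
  obtain Z0 where Z0: "\<And>s y. s \<in> I \<Longrightarrow> norm (z s y) \<le> Z0"
    using uniform_C_bounded[OF zj] by (auto simp: uniformly_bounded_def)
  have Z0_nn: "Z0 \<ge> 0" using Z0[OF I(2)] norm_ge_zero order_trans by blast
  obtain z0' where z0': "\<And>s y. s \<in> I \<Longrightarrow> (z 0 has_derivative z0' s y) (at y)"
    "\<And>w. uniform_C j I (\<lambda>s y. z0' s y w)"
    using D[OF Suc.prems(5)] by blast
  define d where "d = real (DIM('b))"
  define K' where "K' = (\<Sum>b\<in>(Basis::'b set). Ka' b)"
  have K': "K' \<ge> 0" "\<And>b. b \<in> (Basis::'b set) \<Longrightarrow> Ka' b \<le> K'"
    unfolding K'_def using a'(3) by (auto intro: sum_nonneg member_le_sum)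
  let ?R = "\<lambda>s y w. (\<Sum>b\<in>Basis. (z s y \<bullet> b) *\<^sub>R a' b s y w) + g' s y w"
  have ex: "\<exists>\<zeta>. (\<forall>s\<in>I. (z s has_derivative \<zeta> s) (at y)) \<and> \<zeta> 0 = z0' 0 y \<and>
    (\<forall>w. \<forall>s\<in>I. ((\<lambda>s. \<zeta> s w) has_vector_derivative ?A s y (\<zeta> s w) + ?R s y w) (at s within I)) \<and>
    (\<forall>w. \<exists>B. \<forall>s\<in>I. norm (\<zeta> s w) \<le> B)" for y
  proof (rule stable_ode_differentiable[OF I st[of y] C, where z' = "\<lambda>s p. ?A s p (z s p) + g s p"
        and K = "\<Sum>b\<in>Basis. Ka b"])
    show "linear (\<lambda>v. ?A s y v)" for s
      by (rule linearI) (simp_all add: inner_add_left scaleR_add_left sum.distrib scaleR_sum_right)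
    show "norm (?A s y x) \<le> (\<Sum>b\<in>Basis. Ka b) * norm x" if s: "s \<in> I" for s x
      unfolding sum_distrib_right
    proof (rule sum_norm_le)
      fix b :: 'b assume b: "b \<in> Basis"
      show "norm ((x \<bullet> b) *\<^sub>R a b s y) \<le> Ka b * norm x"
        unfolding norm_scaleR mult.commute[of "Ka b"] real_norm_def
        by (rule mult_mono[OF Basis_le_norm[OF b] Ka[OF b s]]) auto
    qed
    show "((\<lambda>s. z s p) has_vector_derivative ?A s p (z s p) + g s p) (at s within I)" if "s \<in> I" for s p
      by (rule Suc.prems(3)[OF that])
    show "\<exists>B. \<forall>s\<in>I. norm (z s p) \<le> B" for p by (rule Suc.prems(4))
    show "linear (?R s y)" if s: "s \<in> I" for s
    proof (rule linear_compose_add)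
      show "linear (g' s y)" by (rule has_derivative_linear[OF g'(1)[OF s]])
      have "linear (a' b s y)" if "b \<in> Basis" for b
        by (rule has_derivative_linear[OF a'(1)[OF that s]])
      then show "linear (\<lambda>w. \<Sum>b\<in>Basis. (z s y \<bullet> b) *\<^sub>R a' b s y w)"
        by (intro linear_compose_sum ballI linear_compose_scale_right) auto
    qed
    show "(z 0 has_derivative z0' 0 y) (at y)" by (rule z0'(1)[OF I(2)])
    fix e :: real assume e: "e > 0"
    \<comment> \<open>Each of the d products contributes a remainder of a b, weighted by Z0, and a mixed term, weighted by K'.\<close>
    define e' where "e' = e / (d * (Z0 + K') + 1)"
    have den: "d * (Z0 + K') + 1 > 0" using Z0_nn K' by (simp add: d_def add_nonneg_pos)
    have e': "e' > 0" using e den by (simp add: e'_def)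
    have "\<forall>\<^sub>F p in at y. \<forall>b\<in>Basis. \<forall>s\<in>I. norm (a b s p - a b s y - a' b s y (p - y)) \<le> e' * norm (p - y)"
      using equicontinuous_derivative_Frechet[OF a'(1) uniform_C_equicontinuous[OF a'(2)] e']
      by (intro eventually_ball_finite) auto
    moreover have "\<forall>\<^sub>F p in at y. \<forall>s\<in>I. norm (g s p - g s y - g' s y (p - y)) \<le> e' * norm (p - y)"
      by (rule equicontinuous_derivative_Frechet[OF g'(1) uniform_C_equicontinuous[OF g'(2)] e'])
    moreover have "\<forall>\<^sub>F p in at y. \<forall>s\<in>I. dist (z s p) (z s y) < e'"
      using uniform_C_equicontinuous[OF zj] e' by (auto simp: equicontinuous_def uniform_limit_iff)
    ultimately show "\<forall>\<^sub>F p in at y. \<forall>s\<in>I. norm (?A s p (z s p) + g s p - (?A s y (z s y) + g s y)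
       - ?A s y (z s p - z s y) - ?R s y (p - y)) \<le> e * norm (p - y)"
    proof eventually_elim
      case (elim p)
      show ?case
      proof
        fix s assume s: "s \<in> I"
        have "?A s p (z s p) + g s p - (?A s y (z s y) + g s y) - ?A s y (z s p - z s y) - ?R s y (p - y) =
          (\<Sum>b\<in>Basis. (z s p \<bullet> b) *\<^sub>R (a b s p - a b s y - a' b s y (p - y)) +
             ((z s p - z s y) \<bullet> b) *\<^sub>R a' b s y (p - y)) + (g s p - g s y - g' s y (p - y))"
          by (simp add: inner_diff_left scaleR_diff_left scaleR_diff_right sum_subtractf sum.distrib)
        also have "norm \<dots> \<le> (\<Sum>b\<in>(Basis::'b set). (Z0 + K') * (e' * norm (p - y))) + e' * norm (p - y)"
        proof (rule norm_triangle_le[OF add_mono[OF sum_norm_le]])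
          fix b :: 'b assume b: "b \<in> Basis"
          have "norm ((z s p \<bullet> b) *\<^sub>R (a b s p - a b s y - a' b s y (p - y))) \<le> Z0 * (e' * norm (p - y))"
            unfolding norm_scaleR
          proof (rule mult_mono)
            show "\<bar>z s p \<bullet> b\<bar> \<le> Z0" using Basis_le_norm[OF b, of "z s p"] Z0[OF s, of p] by simp
            show "norm (a b s p - a b s y - a' b s y (p - y)) \<le> e' * norm (p - y)" using elim b s by blast
          qed (use Z0_nn in auto)
          moreover have "norm (((z s p - z s y) \<bullet> b) *\<^sub>R a' b s y (p - y)) \<le> e' * (K' * norm (p - y))"
            unfolding norm_scaleR
          proof (rule mult_mono)
            have "norm (z s p - z s y) \<le> e'" using elim s by (auto simp: dist_norm intro: less_imp_le)
            then show "\<bar>(z s p - z s y) \<bullet> b\<bar> \<le> e'" using Basis_le_norm[OF b, of "z s p - z s y"] by simp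
            have "norm (a' b s y (p - y)) \<le> Ka' b * norm (p - y)" by (rule a'(4)[OF b s])
            also have "\<dots> \<le> K' * norm (p - y)" using K'(2)[OF b] by (rule mult_right_mono) simp
            finally show "norm (a' b s y (p - y)) \<le> K' * norm (p - y)" .
          qed (use e' in auto)
          ultimately show "norm ((z s p \<bullet> b) *\<^sub>R (a b s p - a b s y - a' b s y (p - y)) +
             ((z s p - z s y) \<bullet> b) *\<^sub>R a' b s y (p - y)) \<le> (Z0 + K') * (e' * norm (p - y))"
            by (intro norm_triangle_le) (simp add: algebra_simps)
        qed (use elim s in blast)
        also have "\<dots> = (d * (Z0 + K') + 1) * e' * norm (p - y)" by (simp add: d_def algebra_simps)
        also have "(d * (Z0 + K') + 1) * e' = e" using den by (simp add: e'_def)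
        finally show "norm (?A s p (z s p) + g s p - (?A s y (z s y) + g s y)
           - ?A s y (z s p - z s y) - ?R s y (p - y)) \<le> e * norm (p - y)" .
      qed
    qed
  qed
  then have "\<forall>y. \<exists>\<zeta>. (\<forall>s\<in>I. (z s has_derivative \<zeta> s) (at y)) \<and> \<zeta> 0 = z0' 0 y \<and>
    (\<forall>w. \<forall>s\<in>I. ((\<lambda>s. \<zeta> s w) has_vector_derivative ?A s y (\<zeta> s w) + ?R s y w) (at s within I)) \<and>
    (\<forall>w. \<exists>B. \<forall>s\<in>I. norm (\<zeta> s w) \<le> B)" by blast
  then obtain \<zeta> where \<zeta>: "\<forall>y. (\<forall>s\<in>I. (z s has_derivative \<zeta> y s) (at y)) \<and> \<zeta> y 0 = z0' 0 y \<and>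
    (\<forall>w. \<forall>s\<in>I. ((\<lambda>s. \<zeta> y s w) has_vector_derivative ?A s y (\<zeta> y s w) + ?R s y w) (at s within I)) \<and>
    (\<forall>w. \<exists>B. \<forall>s\<in>I. norm (\<zeta> y s w) \<le> B)"
    by (rule choice[THEN exE])
  show ?case
  proof (rule uniform_C_Suc_I[where g' = "\<lambda>s y. \<zeta> y s"])
    show "uniformly_bounded I z" by (rule uniform_C_bounded[OF zj])
    show "(z s has_derivative \<zeta> y s) (at y)" if "s \<in> I" for s y using \<zeta> that by blast
    show "uniform_C j I (\<lambda>s y. \<zeta> y s w)" for w
    proof (rule Suc.IH[where g = "\<lambda>s y. ?R s y w"])
      show "uniform_C j I (a b)" if "b \<in> Basis" for b by (rule uniform_C_Suc_imp[OF Suc.prems(1)[OF that]])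
      show "uniform_C j I (\<lambda>s y. ?R s y w)"
        by (intro uniform_C_add g'(2) uniform_C_sum uniform_C_scaleR a'(2)
              uniform_C_linear[OF bounded_linear_inner_left zj]) auto
      show "((\<lambda>s. \<zeta> y s w) has_vector_derivative ?A s y (\<zeta> y s w) + ?R s y w) (at s within I)"
        if "s \<in> I" for s y using \<zeta> that by blast
      show "\<exists>B. \<forall>s\<in>I. norm (\<zeta> y s w) \<le> B" for y using \<zeta> by blast
      have "z0' s y = z0' 0 y" if "s \<in> I" for s y
        by (rule has_derivative_unique[OF z0'(1)[OF that] z0'(1)[OF I(2)]])
      with z0'(2)[of w] show "uniform_C j I (\<lambda>s y. \<zeta> y 0 w)"
        by (elim uniform_C_cong[rotated]) (simp add: \<zeta>)
    qed
  qed
qed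

text \<open>The difference of two solutions solves the linearized equation up to a quadratic error. Under the a priori
closeness \<epsilon> this error is absorbed by stability, which makes u Lipschitz in y uniformly in time. Then the error is
quadratic in p - y, so that u is differentiable, and its derivative \<zeta> solves the variational equation. The
coefficients of that equation are as smooth as u, and linear_ode_uniform_C raises the smoothness of u step by step
up to that of f.\<close>

lemma nonlinear_ode_uniform_C:
  fixes f :: "'b::euclidean_space \<times> 'e::euclidean_space \<Rightarrow> 'b" and u :: "real \<Rightarrow> 'e \<Rightarrow> 'b"
  assumes I: "convex I" "0 \<in> I" and C: "C \<ge> 0"
    and f: "bounded_C (Suc (Suc r)) f" and f': "\<And>p. (f has_derivative f' p) (at p)"
    and L: "L \<ge> 0" "\<And>p q. norm (f q - f p - f' p (q - p)) \<le> L * (norm (q - p))\<^sup>2"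
    and st: "\<And>y. stable_on I (\<lambda>s v. f' (u s y, y) (v, 0)) C"
    and der: "\<And>y s. s \<in> I \<Longrightarrow> ((\<lambda>s. u s y) has_vector_derivative f (u s y, y)) (at s within I)"
    and bd: "uniformly_bounded I u"
    and init: "uniform_C (Suc (Suc r)) I (\<lambda>s. u 0)"
    and small: "C * (L * \<epsilon>) \<le> 1 / 2" "\<And>y. \<forall>\<^sub>F p in at y. \<forall>s\<in>I. norm (u s p - u s y) \<le> \<epsilon>"
  shows "uniform_C (Suc (Suc r)) I u"
proof -
  have f'_lin: "linear (f' p)" for p by (rule has_derivative_linear[OF f'])
  have f'_C: "bounded_C (Suc r) (\<lambda>p. f' p w)" for w by (rule uniform_C_derivative[OF f f'])
  obtain K where K: "K \<ge> 0" "\<And>p w. norm (f' p w) \<le> K * norm w"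
    using uniformly_bounded_Basis[of "UNIV :: unit set" "\<lambda>_. f'"] f'_lin uniform_C_bounded[OF f'_C] by auto
  obtain B where B: "\<And>s y. s \<in> I \<Longrightarrow> norm (u s y) \<le> B" using bd by (auto simp: uniformly_bounded_def)
  obtain L0 where L0: "L0 \<ge> 0" "\<And>y p. norm (u 0 p - u 0 y) \<le> L0 * norm (p - y)"
    using uniform_C_Suc_Lipschitz[OF init] I(2) by metis
  define M where "M = 2 * C * (L0 + K + L)"
  have M: "M \<ge> 0" using C L0 K L by (simp add: M_def)
  have norm_pair: "(norm (v, w))\<^sup>2 = (norm v)\<^sup>2 + (norm w)\<^sup>2" for v :: 'b and w :: 'e
    by (simp add: norm_Pair)
  have Taylor: "norm (f (u s p, p) - f (u s y, y) - f' (u s y, y) (u s p - u s y, 0) - f' (u s y, y) (0, p - y))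
     \<le> L * ((norm (u s p - u s y))\<^sup>2 + (norm (p - y))\<^sup>2)" for s p y
  proof -
    have "f' (u s y, y) (u s p - u s y, p - y) = f' (u s y, y) (u s p - u s y, 0) + f' (u s y, y) (0, p - y)"
      using linear_add[OF f'_lin, of "(u s y, y)" "(u s p - u s y, 0)" "(0, p - y)"] by simp
    then show ?thesis using L(2)[of "(u s p, p)" "(u s y, y)"] by (simp add: norm_pair algebra_simps)
  qed
  have Lip: "\<forall>\<^sub>F p in at y. \<forall>s\<in>I. norm (u s p - u s y) \<le> M * norm (p - y)" for y
  proof -
    have "\<forall>\<^sub>F p in at y. dist p y < 1" by (auto simp: eventually_at intro: exI[of _ 1])
    with small(2)[of y] show ?thesis
    proof eventually_elim
      case (elim p)
      define d where "d = norm (p - y)"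
      have d: "0 \<le> d" "d \<le> 1" using elim by (auto simp: d_def dist_norm)
      \<comment> \<open>One factor of the squared difference is estimated by \<epsilon>, the other by the supremum, which is then absorbed.\<close>
      define S where "S = (SUP s\<in>I. norm (u s p - u s y))"
      have S: "norm (u s p - u s y) \<le> S" if "s \<in> I" for s
        unfolding S_def
        by (rule cSUP_upper[OF that bdd_aboveI2[where M = \<epsilon>]]) (use elim in auto)
      have "norm (u s p - u s y) \<le> C * (L0 * d + (L * (\<epsilon> * S + d) + K * d))" if s: "s \<in> I" for s
      proof -
        have "norm (u s p - u s y) \<le> C * (norm (u 0 p - u 0 y) + (L * (\<epsilon> * S + d) + K * d))"
        proof (rule stable_onD[OF st[of y], where B = \<epsilon> and v' = "\<lambda>s. f (u s p, p) - f (u s y, y)"])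
          fix s assume s: "s \<in> I"
          show "((\<lambda>s. u s p - u s y) has_vector_derivative f (u s p, p) - f (u s y, y)) (at s within I)"
            by (intro has_vector_derivative_diff der s)
          show v: "norm (u s p - u s y) \<le> \<epsilon>" using elim s by blast
          have "norm (f (u s p, p) - f (u s y, y) - f' (u s y, y) (u s p - u s y, 0)) \<le>
              norm (f (u s p, p) - f (u s y, y) - f' (u s y, y) (u s p - u s y, 0) - f' (u s y, y) (0, p - y))
              + norm (f' (u s y, y) (0, p - y))"
            by (metis diff_add_cancel norm_triangle_ineq)
          also have "\<dots> \<le> L * ((norm (u s p - u s y))\<^sup>2 + (norm (p - y))\<^sup>2) + K * norm (0::'b, p - y)"
            by (intro add_mono Taylor K)
          also have "\<dots> \<le> L * (\<epsilon> * S + d) + K * d"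
          proof (intro add_mono mult_left_mono)
            show "(norm (u s p - u s y))\<^sup>2 \<le> \<epsilon> * S"
              unfolding power2_eq_square using v S[OF s] order_trans[OF norm_ge_zero v] by (intro mult_mono) auto
            show "(norm (p - y))\<^sup>2 \<le> d" unfolding power2_eq_square using d by (simp add: d_def mult_left_le)
          qed (use L K in \<open>auto simp: d_def norm_Pair\<close>)
          finally show "norm (f (u s p, p) - f (u s y, y) - f' (u s y, y) (u s p - u s y, 0))
              \<le> L * (\<epsilon> * S + d) + K * d" .
        qed fact
        also have "\<dots> \<le> C * (L0 * d + (L * (\<epsilon> * S + d) + K * d))"
          unfolding d_def by (intro mult_left_mono[OF _ C] add_right_mono L0)
        finally show ?thesis .
      qed
      then have "S \<le> C * (L0 * d + (L * (\<epsilon> * S + d) + K * d))"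
        unfolding S_def by (intro cSUP_least) (use I(2) in auto)
      also have "\<dots> = C * (L0 + K + L) * d + C * (L * \<epsilon>) * S" by (simp add: algebra_simps)
      also have "C * (L * \<epsilon>) * S \<le> 1 / 2 * S"
        using S[OF I(2)] by (intro mult_right_mono small order_trans[OF norm_ge_zero])
      finally have "S \<le> M * d" by (simp add: M_def)
      then show ?case using S unfolding d_def by (meson order_trans)
    qed
  qed
  have ex: "\<exists>\<zeta>. (\<forall>s\<in>I. (u s has_derivative \<zeta> s) (at y)) \<and> \<zeta> 0 = frechet_derivative (u 0) (at y) \<and>
    (\<forall>w. \<forall>s\<in>I. ((\<lambda>s. \<zeta> s w) has_vector_derivative f' (u s y, y) (\<zeta> s w, 0) + f' (u s y, y) (0, w)) (at s within I)) \<and>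
    (\<forall>w. \<exists>B. \<forall>s\<in>I. norm (\<zeta> s w) \<le> B)" for y
  proof (rule stable_ode_differentiable[OF I st C, where z' = "\<lambda>s p. f (u s p, p)" and K = K])
    have "linear (\<lambda>v::'b. (v, 0::'e))" "linear (\<lambda>w::'e. (0::'b, w))" by (auto intro!: linearI)
    from linear_compose[OF this(1) f'_lin] linear_compose[OF this(2) f'_lin]
    show "linear (\<lambda>v. f' (u s y, y) (v, 0))" "linear (\<lambda>w. f' (u s y, y) (0, w))" for s
      by (simp_all add: comp_def)
    show "norm (f' (u s y, y) (x, 0)) \<le> K * norm x" for s x
      using K(2)[of "(u s y, y)" "(x, 0)"] by (simp add: norm_Pair)
    show "((\<lambda>s. u s p) has_vector_derivative f (u s p, p)) (at s within I)" if "s \<in> I" for s p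
      by (rule der[OF that])
    show "\<exists>B. \<forall>s\<in>I. norm (u s p) \<le> B" for p using B by blast
    obtain u0' where "\<And>y. (u 0 has_derivative u0' y) (at y)"
      using uniform_C_Suc_D[OF init] I(2) by metis
    then have "u 0 differentiable (at y)" by (rule differentiableI)
    then show "(u 0 has_derivative frechet_derivative (u 0) (at y)) (at y)"
      using frechet_derivative_works by blast
    fix e :: real assume e: "e > 0"
    define c where "c = L * (M\<^sup>2 + 1) + 1"
    have c: "c > 0" using L by (simp add: c_def add_nonneg_pos)
    have "\<forall>\<^sub>F p in at y. dist p y < e / c" using e c by (auto simp: eventually_at intro!: exI[of _ "e / c"])
    with Lip[of y] show "\<forall>\<^sub>F p in at y. \<forall>s\<in>I. norm (f (u s p, p) - f (u s y, y) -
       f' (u s y, y) (u s p - u s y, 0) - f' (u s y, y) (0, p - y)) \<le> e * norm (p - y)"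
    proof eventually_elim
      case (elim p)
      show ?case
      proof
        fix s assume s: "s \<in> I"
        have "L * ((norm (u s p - u s y))\<^sup>2 + (norm (p - y))\<^sup>2) \<le> L * ((M * norm (p - y))\<^sup>2 + (norm (p - y))\<^sup>2)"
          using elim s L by (intro mult_left_mono add_right_mono power_mono) auto
        also have "\<dots> = (c - 1) * norm (p - y) * norm (p - y)"
          by (simp add: c_def power_mult_distrib algebra_simps power2_eq_square)
        also have "\<dots> \<le> c * (e / c) * norm (p - y)"
          using elim c L by (intro mult_mono mult_right_mono) (auto simp: c_def dist_norm)
        also have "\<dots> = e * norm (p - y)" using c by simp
        finally show "norm (f (u s p, p) - f (u s y, y) - f' (u s y, y) (u s p - u s y, 0)
            - f' (u s y, y) (0, p - y)) \<le> e * norm (p - y)"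
          using Taylor order_trans by blast
      qed
    qed
  qed
  then obtain \<zeta> where \<zeta>: "\<forall>y. (\<forall>s\<in>I. (u s has_derivative \<zeta> y s) (at y)) \<and> \<zeta> y 0 = frechet_derivative (u 0) (at y) \<and>
    (\<forall>w. \<forall>s\<in>I. ((\<lambda>s. \<zeta> y s w) has_vector_derivative f' (u s y, y) (\<zeta> y s w, 0) + f' (u s y, y) (0, w)) (at s within I)) \<and>
    (\<forall>w. \<exists>B. \<forall>s\<in>I. norm (\<zeta> y s w) \<le> B)"
    by (rule choice[OF allI, THEN exE])
  have "uniform_C j I u" if "j \<le> Suc (Suc r)" for j
    using that
  proof (induction j)
    case 0
    have "uniform_limit I (\<lambda>p s. u s p) (\<lambda>s. u s y) (at y)" for y
    proof (rule uniform_limitI)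
      fix e :: real assume e: "e > 0"
      have "\<forall>\<^sub>F p in at y. dist p y < e / (M + 1)"
        using e M by (auto simp: eventually_at intro!: exI[of _ "e / (M + 1)"])
      with Lip[of y] show "\<forall>\<^sub>F p in at y. \<forall>s\<in>I. dist (u s p) (u s y) < e"
      proof eventually_elim
        case (elim p)
        have "M * norm (p - y) \<le> M * (e / (M + 1))"
          using elim M by (intro mult_left_mono) (auto simp: dist_norm)
        also have "\<dots> < (M + 1) * (e / (M + 1))" using e M by (intro mult_strict_right_mono) auto
        also have "\<dots> = e" using M by simp
        finally show ?case using elim by (auto simp: dist_norm intro: le_less_trans)
      qed
    qed
    with bd show ?case by (simp add: equicontinuous_def)
  next
    case (Suc j)
    then have uj: "uniform_C j I u" by simp
    have coef: "uniform_C j I (\<lambda>s y. f' (u s y, y) v)" for v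
    proof -
      have "uniform_C j I (\<lambda>s y. (\<lambda>p. f' p v) ((\<lambda>y. (0, y)) y + (\<lambda>s y. (u s y, 0)) s y))"
      proof (rule uniform_C_compose)
        show "bounded_linear (\<lambda>y::'e. (0::'b, y))"
          by (intro bounded_linear_Pair bounded_linear_zero bounded_linear_ident)
        show "bounded_C j (\<lambda>p. f' p v)" by (rule uniform_C_mono[OF f'_C]) (use Suc.prems in simp)
        show "uniform_C j I (\<lambda>s y. (u s y, 0::'e))"
          by (rule uniform_C_linear[OF _ uj, of "\<lambda>x. (x, 0)"])
             (intro bounded_linear_Pair bounded_linear_zero bounded_linear_ident)
      qed
      then show ?thesis by simp
    qed
    have sum_eq: "(\<Sum>b\<in>Basis. (v \<bullet> b) *\<^sub>R f' p (b, 0)) = f' p (v, 0)" for p v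
    proof -
      have "linear (\<lambda>v::'b. (v, 0::'e))" by (auto intro!: linearI)
      from linear_eq_sum_Basis[OF linear_compose[OF this f'_lin[of p]], of v]
      show ?thesis by (simp add: comp_def)
    qed
    show ?case
    proof (rule uniform_C_Suc_I[OF bd, where g' = "\<lambda>s y. \<zeta> y s"])
      show "(u s has_derivative \<zeta> y s) (at y)" if "s \<in> I" for s y using \<zeta> that by blast
      show "uniform_C j I (\<lambda>s y. \<zeta> y s w)" for w
      proof (rule linear_ode_uniform_C[OF I C, where a = "\<lambda>b s y. f' (u s y, y) (b, 0)"
            and g = "\<lambda>s y. f' (u s y, y) (0, w)"])
        show "stable_on I (\<lambda>s v. \<Sum>b\<in>Basis. (v \<bullet> b) *\<^sub>R f' (u s y, y) (b, 0)) C" for y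
          unfolding sum_eq by (rule st)
        show "((\<lambda>s. \<zeta> y s w) has_vector_derivative
            (\<Sum>b\<in>Basis. (\<zeta> y s w \<bullet> b) *\<^sub>R f' (u s y, y) (b, 0)) + f' (u s y, y) (0, w)) (at s within I)"
          if "s \<in> I" for s y
          unfolding sum_eq using \<zeta> that by blast
        show "\<exists>B. \<forall>s\<in>I. norm (\<zeta> y s w) \<le> B" for y using \<zeta> by blast
        have "uniform_C j I (\<lambda>s y. frechet_derivative (u 0) (at y) w)"
        proof (rule uniform_C_derivative)
          show "uniform_C (Suc j) I (\<lambda>s. u 0)" by (rule uniform_C_mono[OF init]) (use Suc.prems in simp)
          fix s y assume "s \<in> I"
          obtain u0' where "\<And>y. (u 0 has_derivative u0' y) (at y)"
            using uniform_C_Suc_D[OF init] I(2) by metis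
          then have "u 0 differentiable (at y)" by (rule differentiableI)
          then show "(u 0 has_derivative frechet_derivative (u 0) (at y)) (at y)"
            using frechet_derivative_works by blast
        qed
        then show "uniform_C j I (\<lambda>s y. \<zeta> y 0 w)" using \<zeta> by simp
      qed (rule coef)+
    qed
  qed
  from this[OF order_refl] show ?thesis .
qed

text \<open>From here on smooth families are combined by the closure rules, without unfolding the recursion.\<close>

declare uniform_C.simps(2) [simp del]

section \<open>Global solutions\<close>

lemma has_vector_derivative_affine:
  assumes "(v has_vector_derivative D) (at (a + c * s))"
  shows "((\<lambda>s. v (a + c * s)) has_vector_derivative c *\<^sub>R D) (at s)"
proof -
  have "((\<lambda>s. a + c * s) has_vector_derivative c) (at s)"
    by (auto intro!: derivative_eq_intros simp: has_real_derivative_iff_has_vector_derivative[symmetric])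
  from vector_diff_chain_at[OF this assms] show ?thesis by (simp add: comp_def)
qed

text \<open>The signed integral from 0 to s; one of the two terms vanishes, depending on the sign of s.\<close>

definition antideriv :: "(real \<Rightarrow> 'b::euclidean_space) \<Rightarrow> real \<Rightarrow> 'b" where
  "antideriv g s = integral {0..s} g - integral {s..0} g"

lemma has_vector_derivative_antideriv:
  assumes "continuous_on UNIV g"
  shows "(antideriv g has_vector_derivative g s) (at s)"
proof -
  define R where "R = \<bar>s\<bar> + 1"
  have cont: "continuous_on S g" for S using assms continuous_on_subset by blast
  have int: "g integrable_on {a..b}" for a b by (rule integrable_continuous_real[OF cont])
  have "((\<lambda>u. integral {- R..u} g) has_vector_derivative g s) (at s within {- R..R})"
    by (rule integral_has_vector_derivative[OF cont]) (auto simp: R_def)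
  moreover have "at s within {- R..R} = at s" by (rule at_within_Icc_at) (auto simp: R_def)
  ultimately have "((\<lambda>u. integral {- R..u} g - integral {- R..0} g) has_vector_derivative g s - 0) (at s)"
    by (intro has_vector_derivative_diff has_vector_derivative_const) simp
  then have d: "((\<lambda>u. integral {- R..u} g - integral {- R..0} g) has_vector_derivative g s) (at s)" by simp
  show ?thesis
  proof (rule has_vector_derivative_transform_within_open[OF d])
    show "open {- R<..<R}" "s \<in> {- R<..<R}" by (auto simp: R_def)
    fix u assume u: "u \<in> {- R<..<R}"
    show "integral {- R..u} g - integral {- R..0} g = antideriv g u"
    proof (cases "u \<ge> 0")
      case True
      then have "integral {- R..0} g + integral {0..u} g = integral {- R..u} g"
        by (intro Henstock_Kurzweil_Integration.integral_combine int) (auto simp: R_def)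
      moreover have "integral {u..0} g = 0" using True by (cases "u = 0") auto
      ultimately show ?thesis by (simp add: antideriv_def algebra_simps)
    next
      case False
      then have "integral {- R..u} g + integral {u..0} g = integral {- R..0} g"
        using u by (intro Henstock_Kurzweil_Integration.integral_combine int) auto
      then show ?thesis using False by (simp add: antideriv_def algebra_simps)
    qed
  qed
qed

lemma exponential_growth_bound:
  fixes v :: "real \<Rightarrow> 'b::euclidean_space"
  assumes v0: "v 0 = 0" and d: "\<And>s. (v has_vector_derivative v' s) (at s)"
    and le: "\<And>s. norm (v' s) \<le> c * exp (k * \<bar>s\<bar>)" and k: "k > 0"
  shows "norm (v s) \<le> c / k * exp (k * \<bar>s\<bar>)"
proof -
  have c: "c \<ge> 0" using le[of 0] norm_ge_zero[of "v' 0"] by (simp del: norm_ge_zero)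
  have pos: "norm (v s) \<le> c / k * exp (k * s)"
    if s: "s \<ge> 0" and v0: "v 0 = 0" and d: "\<And>s. (v has_vector_derivative v' s) (at s)"
      and le: "\<And>s. norm (v' s) \<le> c * exp (k * \<bar>s\<bar>)" for v v' :: "real \<Rightarrow> 'b" and s
  proof (cases "s = 0")
    case True
    then show ?thesis using v0 c k by simp
  next
    case False
    have "norm (v s - v 0) \<le> c / k * exp (k * s) - c / k * exp (k * 0)"
    proof (rule differentiable_bound_general)
      show "continuous_on {0..s} v"
        by (intro continuous_at_imp_continuous_on ballI has_vector_derivative_continuous[OF d])
      show "continuous_on {0..s} (\<lambda>s. c / k * exp (k * s))" by (intro continuous_intros)
      fix x :: real assume "0 < x"
      then show "norm (v' x) \<le> c * exp (k * x)" using le[of x] by simp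
      show "((\<lambda>s. c / k * exp (k * s)) has_vector_derivative c * exp (k * x)) (at x)"
        using k unfolding has_real_derivative_iff_has_vector_derivative[symmetric]
        by (auto intro!: derivative_eq_intros)
    qed (use False s d in auto)
    also have "\<dots> \<le> c / k * exp (k * s)" using c k by simp
    finally show ?thesis using v0 by simp
  qed
  show ?thesis
  proof (cases "s \<ge> 0")
    case True
    then show ?thesis using pos[OF True v0 d le] by simp
  next
    case False
    have d': "((\<lambda>s. v (- s)) has_vector_derivative - v' (- s)) (at s)" for s
      using has_vector_derivative_affine[of v "v' (- s)" 0 "-1" s] d by simp
    have "norm (v (- (- s))) \<le> c / k * exp (k * (- s))"
      by (rule pos[OF _ _ d']) (use False v0 le[of "- s" for s] in auto)
    then show ?thesis using False by simp
  qed
qed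

text \<open>Writing x(s) = exp (k |s|) v(s) with k twice the Lipschitz constant turns the integral equation into a
fixed point problem for bounded continuous v in which the operator contracts by the factor 1/2 on the whole
line. Negative times are included because differentiating the flow at the crossing time needs both sides.\<close>

lemma global_solution_exists:
  fixes f :: "'b::euclidean_space \<Rightarrow> 'b"
  assumes Lip: "\<And>x y. norm (f x - f y) \<le> L * norm (x - y)"
  shows "\<exists>x. x 0 = x0 \<and> (\<forall>s. (x has_vector_derivative f (x s)) (at s))"
proof -
  define K where "K = \<bar>L\<bar> + 1"
  have K: "K > 0" by (simp add: K_def)
  have LipK: "norm (f x - f y) \<le> K * norm (x - y)" for x y
    by (rule order_trans[OF Lip]) (auto intro!: mult_right_mono simp: K_def)
  define k where "k = 2 * K"
  have k: "k > 0" using K by (simp add: k_def)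
  have contf: "continuous_on UNIV f"
  proof (rule lipschitz_on_continuous_on)
    show "K-lipschitz_on UNIV f" using LipK K by (intro lipschitz_onI) (auto simp: dist_norm)
  qed
  \<comment> \<open>The integral operator for x, transported to v.\<close>
  define P where "P = (\<lambda>v s. exp (- k * \<bar>s\<bar>) *\<^sub>R (x0 + antideriv (\<lambda>r. f (exp (k * \<bar>r\<bar>) *\<^sub>R v r)) s))"
  have contg: "continuous_on UNIV (\<lambda>r. f (exp (k * \<bar>r\<bar>) *\<^sub>R apply_bcontfun v r))" for v :: "real \<Rightarrow>\<^sub>C 'b"
    by (rule continuous_on_compose2[OF contf]) (auto intro!: continuous_intros)
  have da: "(antideriv (\<lambda>r. f (exp (k * \<bar>r\<bar>) *\<^sub>R apply_bcontfun v r)) has_vector_derivative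
      f (exp (k * \<bar>s\<bar>) *\<^sub>R apply_bcontfun v s)) (at s)" for v :: "real \<Rightarrow>\<^sub>C 'b" and s
    by (rule has_vector_derivative_antideriv[OF contg])
  have ant0: "antideriv g 0 = 0" for g :: "real \<Rightarrow> 'b" by (simp add: antideriv_def)
  have ee: "exp (- k * \<bar>s\<bar>) * exp (k * \<bar>s\<bar>) = 1" for s by (simp add: exp_minus)
  have P_in: "P (apply_bcontfun v) \<in> bcontfun" for v :: "real \<Rightarrow>\<^sub>C 'b"
  proof -
    define c where "c = norm (f 0) + K * dist v 0"
    have "norm (f (exp (k * \<bar>s\<bar>) *\<^sub>R apply_bcontfun v s)) \<le> c * exp (k * \<bar>s\<bar>)" for s
    proof -
      have "norm (f (exp (k * \<bar>s\<bar>) *\<^sub>R apply_bcontfun v s)) \<le>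
          norm (f 0) + norm (f (exp (k * \<bar>s\<bar>) *\<^sub>R apply_bcontfun v s) - f 0)"
        by (rule norm_triangle_sub)
      also have "\<dots> \<le> norm (f 0) + K * norm (exp (k * \<bar>s\<bar>) *\<^sub>R apply_bcontfun v s - 0)"
        by (intro add_left_mono LipK)
      also have "\<dots> = norm (f 0) * 1 + K * norm (apply_bcontfun v s) * exp (k * \<bar>s\<bar>)" by simp
      also have "\<dots> \<le> norm (f 0) * exp (k * \<bar>s\<bar>) + K * dist v 0 * exp (k * \<bar>s\<bar>)"
        using dist_bounded[of v s 0] K k by (intro add_mono mult_left_mono mult_right_mono) auto
      also have "\<dots> = c * exp (k * \<bar>s\<bar>)" by (simp add: c_def algebra_simps)
      finally show ?thesis .
    qed
    from exponential_growth_bound[OF ant0 da this k]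
    have g: "norm (antideriv (\<lambda>r. f (exp (k * \<bar>r\<bar>) *\<^sub>R apply_bcontfun v r)) s) \<le> c / k * exp (k * \<bar>s\<bar>)" for s .
    show ?thesis
    proof (rule bcontfun_normI[where b = "norm x0 + c / k"])
      have "continuous_on UNIV (antideriv (\<lambda>r. f (exp (k * \<bar>r\<bar>) *\<^sub>R apply_bcontfun v r)))"
        by (intro continuous_at_imp_continuous_on ballI has_vector_derivative_continuous[OF da])
      then show "continuous_on UNIV (P (apply_bcontfun v))"
        unfolding P_def by (intro continuous_intros)
      fix s
      have "norm (P (apply_bcontfun v) s) \<le> exp (- k * \<bar>s\<bar>) *
          (norm x0 + norm (antideriv (\<lambda>r. f (exp (k * \<bar>r\<bar>) *\<^sub>R apply_bcontfun v r)) s))"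
        by (simp add: P_def norm_triangle_ineq)
      also have "\<dots> \<le> exp (- k * \<bar>s\<bar>) * (norm x0 + c / k * exp (k * \<bar>s\<bar>))"
        by (intro mult_left_mono add_left_mono g) auto
      also have "\<dots> = exp (- k * \<bar>s\<bar>) * norm x0 + c / k * (exp (- k * \<bar>s\<bar>) * exp (k * \<bar>s\<bar>))"
        by (simp only: distrib_left mult.left_commute)
      also have "\<dots> \<le> 1 * norm x0 + c / k"
        unfolding ee using k by (intro add_mono mult_right_mono) auto
      finally show "norm (P (apply_bcontfun v) s) \<le> norm x0 + c / k" by simp
    qed
  qed
  define Q :: "(real \<Rightarrow>\<^sub>C 'b) \<Rightarrow> (real \<Rightarrow>\<^sub>C 'b)" where "Q = (\<lambda>v. Bcontfun (P (apply_bcontfun v)))"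
  have Q: "apply_bcontfun (Q v) = P (apply_bcontfun v)" for v
    unfolding Q_def by (rule Bcontfun_inverse[OF P_in])
  have "dist (Q v) (Q w) \<le> 1 / 2 * dist v w" for v w
  proof (rule dist_bound)
    fix s
    let ?g = "\<lambda>v. antideriv (\<lambda>r. f (exp (k * \<bar>r\<bar>) *\<^sub>R apply_bcontfun v r))"
    have "norm (?g v s - ?g w s) \<le> (K * dist v w) / k * exp (k * \<bar>s\<bar>)"
    proof (rule exponential_growth_bound[OF _ has_vector_derivative_diff[OF da da] _ k])
      show "norm (f (exp (k * \<bar>s\<bar>) *\<^sub>R apply_bcontfun v s) - f (exp (k * \<bar>s\<bar>) *\<^sub>R apply_bcontfun w s))
          \<le> K * dist v w * exp (k * \<bar>s\<bar>)" for s
      proof -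
        have "norm (f (exp (k * \<bar>s\<bar>) *\<^sub>R apply_bcontfun v s) - f (exp (k * \<bar>s\<bar>) *\<^sub>R apply_bcontfun w s))
          \<le> K * norm (exp (k * \<bar>s\<bar>) *\<^sub>R apply_bcontfun v s - exp (k * \<bar>s\<bar>) *\<^sub>R apply_bcontfun w s)"
          by (rule LipK)
        also have "\<dots> = K * dist (apply_bcontfun v s) (apply_bcontfun w s) * exp (k * \<bar>s\<bar>)"
          by (simp add: dist_norm flip: scaleR_diff_right)
        also have "\<dots> \<le> K * dist v w * exp (k * \<bar>s\<bar>)"
          using K by (intro mult_right_mono mult_left_mono dist_bounded) auto
        finally show ?thesis .
      qed
    qed (simp add: ant0)
    also have "(K * dist v w) / k = 1 / 2 * dist v w" using K by (simp add: k_def)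
    finally have "exp (- k * \<bar>s\<bar>) * norm (?g v s - ?g w s) \<le> exp (- k * \<bar>s\<bar>) * (1 / 2 * dist v w * exp (k * \<bar>s\<bar>))"
      by (rule mult_left_mono) simp
    also have "\<dots> = 1 / 2 * dist v w"
      by (simp only: mult.left_commute[of "exp (- k * \<bar>s\<bar>)"] ee mult_1_right)
    also have "exp (- k * \<bar>s\<bar>) * norm (?g v s - ?g w s) = dist (Q v s) (Q w s)"
      unfolding Q P_def dist_norm by (simp flip: scaleR_diff_right)
    finally show "dist (Q v s) (Q w s) \<le> 1 / 2 * dist v w" .
  qed
  then obtain v where v: "Q v = v"
    using banach_fix_type[of "1 / 2" Q] by auto
  define x where "x = (\<lambda>s. x0 + antideriv (\<lambda>r. f (exp (k * \<bar>r\<bar>) *\<^sub>R apply_bcontfun v r)) s)"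
  have xv: "x s = exp (k * \<bar>s\<bar>) *\<^sub>R apply_bcontfun v s" for s
  proof -
    have "apply_bcontfun v s = exp (- k * \<bar>s\<bar>) *\<^sub>R x s"
      using fun_cong[OF Q[of v], of s] unfolding v P_def x_def by simp
    then show ?thesis using ee[of s] by (simp add: mult.commute)
  qed
  have "(x has_vector_derivative f (x s)) (at s)" for s
  proof -
    have "(x has_vector_derivative 0 + f (exp (k * \<bar>s\<bar>) *\<^sub>R apply_bcontfun v s)) (at s)"
      unfolding x_def by (intro has_vector_derivative_add has_vector_derivative_const da)
    then show ?thesis by (simp only: xv[of s] add_0_left)
  qed
  moreover have "x 0 = x0" by (simp add: x_def ant0)
  ultimately show ?thesis by blast
qed

lemma solution_unique:
  fixes v1 v2 :: "real \<Rightarrow> 'b::euclidean_space"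
  assumes Lip: "\<And>x y. norm (f x - f y) \<le> L * norm (x - y)" "L \<ge> 0"
    and cont: "continuous_on {0..R} v1" "continuous_on {0..R} v2"
    and d: "\<And>s. 0 < s \<Longrightarrow> s < R \<Longrightarrow> (v1 has_vector_derivative f (v1 s)) (at s)"
      "\<And>s. 0 < s \<Longrightarrow> s < R \<Longrightarrow> (v2 has_vector_derivative f (v2 s)) (at s)"
    and "v1 0 = v2 0" "0 \<le> s" "s \<le> R"
  shows "v1 s = v2 s"
proof -
  have "norm (v1 s - v2 s) \<le> exp ((L + 1) * s) * (norm (v1 0 - v2 0) + 0)"
  proof (rule Gronwall_norm[where v = "\<lambda>s. v1 s - v2 s" and v' = "\<lambda>s. f (v1 s) - f (v2 s)" and R = R])
    show "continuous_on {0..R} (\<lambda>s. v1 s - v2 s)" using cont by (intro continuous_intros)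
    show "((\<lambda>s. v1 s - v2 s) has_vector_derivative f (v1 s) - f (v2 s)) (at s)" if "0 < s" "s < R" for s
      by (intro has_vector_derivative_diff d that)
    show "norm (f (v1 s) - f (v2 s)) \<le> L * norm (v1 s - v2 s) + 0" for s using Lip by simp
  qed (use assms in auto)
  then show ?thesis using assms by simp
qed

text \<open>On a bounded interval Gronwall's inequality provides the stability estimate, the boundedness of u and its
Lipschitz continuity in y, which makes the a priori closeness hold for every \<epsilon>.\<close>

lemma finite_time_uniform_C:
  fixes f :: "'b::euclidean_space \<times> 'e::euclidean_space \<Rightarrow> 'b" and u :: "real \<Rightarrow> 'e \<Rightarrow> 'b"
  assumes f: "bounded_C (Suc (Suc r)) f"
    and der: "\<And>y s. s \<in> {0..R} \<Longrightarrow> ((\<lambda>s. u s y) has_vector_derivative f (u s y, y)) (at s within {0..R})"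
    and init: "bounded_C (Suc (Suc r)) (u 0)" and R: "R \<ge> 0"
  shows "uniform_C (Suc (Suc r)) {0..R} u"
proof -
  obtain f' where f': "\<And>p. (f has_derivative f' p) (at p)" using bounded_C_Suc_D[OF f] by blast
  have f'_C: "bounded_C (Suc r) (\<lambda>p. f' p w)" for w by (rule uniform_C_derivative[OF f f'])
  obtain K where K: "K \<ge> 0" "\<And>p w. norm (f' p w) \<le> K * norm w"
    using uniformly_bounded_Basis[of "UNIV :: unit set" "\<lambda>_. f'"] has_derivative_linear[OF f']
      uniform_C_bounded[OF f'_C] by auto
  have Lip: "norm (f p - f q) \<le> K * norm (p - q)" for p q
    by (rule Lipschitz_from_derivative_bound[OF f' K(2)])
  obtain L where L: "L \<ge> 0" "\<And>p q w. norm (f' q w - f' p w) \<le> L * norm (q - p) * norm w"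
    "\<And>p q. norm (f q - f p - f' p (q - p)) \<le> L * (norm (q - p))\<^sup>2"
    by (rule bounded_C_Taylor[OF f f']) (rule that)
  obtain F where F: "\<And>p. norm (f p) \<le> F" using uniform_C_bounded[OF f] by (auto simp: uniformly_bounded_def)
  obtain B where B: "\<And>y. norm (u 0 y) \<le> B" using uniform_C_bounded[OF init] by (auto simp: uniformly_bounded_def)
  have init': "uniform_C (Suc (Suc r)) {0..R} (\<lambda>s. u 0)" by (rule uniform_C_const_family[OF init])
  obtain L0 where L0: "L0 \<ge> 0" "\<And>y p. norm (u 0 p - u 0 y) \<le> L0 * norm (p - y)"
    using uniform_C_Suc_Lipschitz[OF init] by (metis UNIV_I)
  define C where "C = exp ((K + 1) * R)"
  have C: "C > 0" by (simp add: C_def)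
  define \<epsilon> where "\<epsilon> = inverse (2 * (C * L + 1))"
  have CL: "C * L + 1 > 0" using C L by (simp add: add_nonneg_pos)
  have eps: "\<epsilon> > 0" "C * (L * \<epsilon>) \<le> 1 / 2"
    using CL by (auto simp: \<epsilon>_def field_simps)
  have cont: "continuous_on {0..R} (\<lambda>s. u s y)" for y
    by (rule continuous_on_vector_derivative[OF der])
  have der': "((\<lambda>s. u s y) has_vector_derivative f (u s y, y)) (at s)" if "0 < s" "s < R" for s y
    using der[of s y] that at_within_Icc_at[of 0 s R] by auto
  show ?thesis
  proof (rule nonlinear_ode_uniform_C[OF _ _ less_imp_le[OF C] f f' L(1,3) _ der _ init' eps(2)])
    show "convex {0..R}" "0 \<in> {0..R}" using R by auto
    show "stable_on {0..R} (\<lambda>s v. f' (u s y, y) (v, 0)) C" for y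
      unfolding C_def
    proof (rule stable_on_interval[OF K(1)])
      show "norm (f' (u s y, y) (x, 0)) \<le> K * norm x" for s x
        using K(2)[of "(u s y, y)" "(x, 0)"] by (simp add: norm_Pair)
    qed
    have "norm (u s y) \<le> exp (0 + 1 * R) * (B + F)" if s: "s \<in> {0..R}" for s y
    proof -
      have "norm (u s y) \<le> exp ((0 + 1) * s) * (norm (u 0 y) + F)"
        by (rule Gronwall_norm[OF cont der']) (use F order_trans[OF norm_ge_zero F] s in auto)
      also have "\<dots> \<le> exp (0 + 1 * R) * (B + F)"
        using s B order_trans[OF norm_ge_zero B] order_trans[OF norm_ge_zero F] by (intro mult_mono add_mono) auto
      finally show ?thesis .
    qed
    then show "uniformly_bounded {0..R} u" unfolding uniformly_bounded_def by blast
    have diff: "norm (u s p - u s y) \<le> C * ((L0 + K) * norm (p - y))" if s: "s \<in> {0..R}" for s p y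
    proof -
      have "norm (u s p - u s y) \<le> exp ((K + 1) * s) * (norm (u 0 p - u 0 y) + K * norm (p - y))"
      proof (rule Gronwall_norm[where v' = "\<lambda>s. f (u s p, p) - f (u s y, y)" and R = R])
        show "continuous_on {0..R} (\<lambda>s. u s p - u s y)" by (intro continuous_intros cont)
        show "((\<lambda>s. u s p - u s y) has_vector_derivative f (u s p, p) - f (u s y, y)) (at s)"
          if "0 < s" "s < R" for s by (intro has_vector_derivative_diff der' that)
        show "norm (f (u s p, p) - f (u s y, y)) \<le> K * norm (u s p - u s y) + K * norm (p - y)" for s
        proof -
          have "norm (f (u s p, p) - f (u s y, y)) \<le> K * norm (u s p - u s y, p - y)"
            using Lip[of "(u s p, p)" "(u s y, y)"] by simp
          also have "\<dots> \<le> K * (norm (u s p - u s y) + norm (p - y))"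
            using K(1) by (intro mult_left_mono norm_Pair_le)
          finally show ?thesis by (simp add: distrib_left)
        qed
      qed (use K s in auto)
      also have "\<dots> \<le> C * (L0 * norm (p - y) + K * norm (p - y))"
        unfolding C_def using s K(1) L0 by (intro mult_mono add_mono) auto
      finally show ?thesis by (simp add: distrib_right)
    qed
    show "\<forall>\<^sub>F p in at y. \<forall>s\<in>{0..R}. norm (u s p - u s y) \<le> \<epsilon>" for y
    proof -
      have "((\<lambda>p. C * ((L0 + K) * norm (p - y))) \<longlongrightarrow> C * ((L0 + K) * norm (y - y))) (at y)"
        by (intro tendsto_intros)
      then have "\<forall>\<^sub>F p in at y. C * ((L0 + K) * norm (p - y)) < \<epsilon>"
        using eps(1) by (intro order_tendstoD(2)) auto
      then show ?thesis
        by eventually_elim (auto intro!: order_trans[OF diff])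
    qed
  qed
qed

section \<open>Implicit functions and evaluation of flows at variable times\<close>

text \<open>Differentiating F(\<theta>(y), y) = 0 gives \<theta>' as a quotient whose denominator is at least \<eta>. Continuity of \<theta> is assumed:
it selects the branch. The formula for \<theta>' then lifts the smoothness of \<theta> step by step. Only the
derivatives of F are bounded, as for h, whose values may be unbounded in y.\<close>

lemma implicit_function_bounded_C:
  fixes F :: "real \<times> 'e::euclidean_space \<Rightarrow> real" and \<theta> :: "'e \<Rightarrow> real"
  assumes F: "\<And>p. (F has_derivative F' p) (at p)" and C: "\<And>w. bounded_C r (\<lambda>p. F' p w)"
    and \<theta>: "continuous_on UNIV \<theta>" "\<And>y. \<bar>\<theta> y\<bar> \<le> B"
    and zero: "\<And>y. F (\<theta> y, y) = 0" and pos: "\<And>y. F' (\<theta> y, y) (1, 0) \<ge> \<eta>" "\<eta> > 0"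
  shows "bounded_C (Suc r) \<theta>"
proof -
  define \<theta>' where "\<theta>' = (\<lambda>y w. - (inverse (F' (\<theta> y, y) (1, 0)) *\<^sub>R F' (\<theta> y, y) (0, w)))"
  have lin: "linear (F' p)" for p by (rule has_derivative_linear[OF F])
  have d: "(\<theta> has_derivative \<theta>' y) (at y)" for y
    unfolding has_derivative_within_alt2
  proof (intro conjI allI impI)
    let ?p = "(\<theta> y, y)"
    define a where "a = F' ?p (1, 0)"
    have a: "a \<ge> \<eta>" "a > 0" using pos(1)[of y] pos(2) by (auto simp: a_def)
    have "bounded_linear (\<lambda>w. F' ?p (0, w))"
      by (rule bounded_linear_compose[OF has_derivative_bounded_linear[OF F]])
         (intro bounded_linear_Pair bounded_linear_zero bounded_linear_ident)
    then show "bounded_linear (\<theta>' y)"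
      unfolding \<theta>'_def by (intro bounded_linear_minus bounded_linear_compose[OF bounded_linear_scaleR_right])
    obtain K where K: "K \<ge> 0" "\<And>w. norm (F' ?p w) \<le> norm w * K"
      using bounded_linear.nonneg_bounded[OF has_derivative_bounded_linear[OF F]] by blast
    fix e :: real assume e: "e > 0"
    \<comment> \<open>With e1 at most \<eta>/2 the increment of \<theta> is at most c times that of y; the second bound on e1 gives the remainder.\<close>
    define c where "c = 2 * K / \<eta> + 1"
    have c: "c \<ge> 1" using K pos(2) by (simp add: c_def)
    define e1 where "e1 = min (\<eta> / 2) (e * \<eta> / (c + 1))"
    have "e1 \<le> e * \<eta> / (c + 1)" unfolding e1_def by (rule min.cobounded2)
    moreover have "e1 \<le> \<eta> / 2" unfolding e1_def by (rule min.cobounded1)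
    moreover have "e1 > 0" using e pos(2) c by (simp add: e1_def)
    ultimately have e1: "e1 > 0" "e1 \<le> \<eta> / 2" "e1 * (c + 1) \<le> e * \<eta>"
      using c pos_le_divide_eq[of "c + 1" e1 "e * \<eta>"] by auto
    have "\<forall>\<^sub>F q in nhds ?p. norm (F q - F ?p - F' ?p (q - ?p)) \<le> e1 * norm (q - ?p)"
    proof -
      have "\<forall>\<^sub>F q in at ?p. norm (F q - F ?p - F' ?p (q - ?p)) \<le> e1 * norm (q - ?p)"
        using F[of ?p] e1(1) unfolding has_derivative_within_alt2 by simp
      then show ?thesis unfolding eventually_at_filter
        by eventually_elim (use linear_0[OF lin] in auto)
    qed
    moreover have "((\<lambda>z. (\<theta> z, z)) \<longlongrightarrow> ?p) (at y)"
      using \<theta>(1) by (intro tendsto_Pair tendsto_ident_at) (auto simp: continuous_on_eq_continuous_at isCont_def)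
    ultimately have "\<forall>\<^sub>F z in at y. norm (F (\<theta> z, z) - F ?p - F' ?p ((\<theta> z, z) - ?p)) \<le> e1 * norm ((\<theta> z, z) - ?p)"
      by (auto simp: filterlim_iff)
    then show "\<forall>\<^sub>F z in at y. norm (\<theta> z - \<theta> y - \<theta>' y (z - y)) \<le> e * norm (z - y)"
    proof eventually_elim
      case (elim z)
      define \<delta> where "\<delta> = \<theta> z - \<theta> y"
      define \<Delta> where "\<Delta> = norm (z - y)"
      have "\<Delta> \<ge> 0" by (simp add: \<Delta>_def)
      define b where "b = F' ?p (0, z - y)"
      have "F' ?p (\<delta>, z - y) = \<delta> * a + b"
      proof -
        have "F' ?p (\<delta>, z - y) = F' ?p (\<delta> *\<^sub>R (1, 0) + (0, z - y))" by simp
        then show ?thesis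
          by (simp only: linear_add[OF lin] linear_cmul[OF lin] a_def b_def) simp
      qed
      then have "\<bar>\<delta> * a + b\<bar> \<le> e1 * norm (\<delta>, z - y)"
        using elim zero by (simp add: \<delta>_def abs_minus_commute)
      also have "\<dots> \<le> e1 * (\<bar>\<delta>\<bar> + \<Delta>)"
        using norm_Pair_le[of \<delta> "z - y"] e1(1) by (intro mult_left_mono) (auto simp: \<Delta>_def)
      finally have main: "\<bar>\<delta> * a + b\<bar> \<le> e1 * (\<bar>\<delta>\<bar> + \<Delta>)" .
      have b: "\<bar>b\<bar> \<le> K * \<Delta>" using K(2)[of "(0, z - y)"] by (simp add: b_def \<Delta>_def norm_Pair mult.commute)
      have \<delta>c: "\<bar>\<delta>\<bar> \<le> c * \<Delta>"
      proof -
        have "\<eta> * \<bar>\<delta>\<bar> \<le> \<bar>\<delta> * a\<bar>" using a pos(2) by (simp add: abs_mult mult.commute[of "\<bar>\<delta>\<bar>"] mult_right_mono)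
        also have "\<dots> \<le> \<bar>\<delta> * a + b\<bar> + \<bar>b\<bar>" by linarith
        also have "\<dots> \<le> e1 * (\<bar>\<delta>\<bar> + \<Delta>) + K * \<Delta>" by (rule add_mono[OF main b])
        also have "\<dots> \<le> \<eta> / 2 * (\<bar>\<delta>\<bar> + \<Delta>) + K * \<Delta>"
          using e1 \<open>\<Delta> \<ge> 0\<close> by (intro add_right_mono mult_right_mono) auto
        finally have "\<eta> / 2 * \<bar>\<delta>\<bar> \<le> (\<eta> / 2 + K) * \<Delta>" by (simp add: field_simps)
        then have "(2 / \<eta>) * (\<eta> / 2 * \<bar>\<delta>\<bar>) \<le> (2 / \<eta>) * ((\<eta> / 2 + K) * \<Delta>)"
          using pos(2) by (intro mult_left_mono) auto
        then show ?thesis using pos(2) by (simp add: c_def field_simps)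
      qed
      have "norm (\<theta> z - \<theta> y - \<theta>' y (z - y)) = \<bar>(\<delta> * a + b) / a\<bar>"
        using a by (simp add: \<theta>'_def \<delta>_def a_def b_def field_simps)
      also have "\<dots> \<le> e1 * (\<bar>\<delta>\<bar> + \<Delta>) / \<eta>"
        unfolding abs_divide using a main pos(2) by (intro frac_le) auto
      also have "\<dots> \<le> e1 * (c * \<Delta> + \<Delta>) / \<eta>"
        using \<delta>c e1 pos(2) by (intro divide_right_mono mult_left_mono) auto
      also have "\<dots> = (e1 * (c + 1)) * \<Delta> / \<eta>" by (simp add: algebra_simps)
      also have "\<dots> \<le> (e * \<eta>) * \<Delta> / \<eta>"
        using e1(3) \<open>\<Delta> \<ge> 0\<close> pos(2) by (intro divide_right_mono mult_right_mono) auto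
      also have "\<dots> = e * norm (z - y)" using pos(2) by (simp add: \<Delta>_def)
      finally show ?case .
    qed
  qed
  have "bounded_C j \<theta>" if "j \<le> Suc r" for j
    using that
  proof (induction j)
    case 0
    then show ?case
      using \<theta> by (auto simp: uniformly_bounded_def equicontinuous_def uniform_limit_iff
          continuous_on_eq_continuous_at isCont_def tendsto_iff)
  next
    case (Suc j)
    then have IH: "bounded_C j \<theta>" by simp
    have coef: "bounded_C j (\<lambda>y. F' (\<theta> y, y) v)" for v
    proof -
      have "bounded_C j (\<lambda>y. (\<lambda>p. F' p v) ((\<lambda>y. (0, y)) y + (\<theta> y, 0)))"
      proof (rule uniform_C_compose)
        show "bounded_linear (\<lambda>y::'e. (0::real, y))"
          by (intro bounded_linear_Pair bounded_linear_zero bounded_linear_ident)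
        show "bounded_C j (\<lambda>p. F' p v)" by (rule uniform_C_mono[OF C]) (use Suc.prems in simp)
        show "bounded_C j (\<lambda>y. (\<theta> y, 0::'e))"
          by (rule uniform_C_linear[OF _ IH, of "\<lambda>x. (x, 0)"])
             (intro bounded_linear_Pair bounded_linear_zero bounded_linear_ident)
      qed
      then show ?thesis by simp
    qed
    show ?case
    proof (rule uniform_C_Suc_I[where g' = "\<lambda>_. \<theta>'"])
      show "uniformly_bounded UNIV (\<lambda>_::unit. \<theta>)" using \<theta>(2) by (auto simp: uniformly_bounded_def)
      show "(\<theta> has_derivative \<theta>' y) (at y)" for y by (rule d)
      show "bounded_C j (\<lambda>y. \<theta>' y w)" for w
        unfolding \<theta>'_def
        by (intro uniform_C_linear[OF bounded_linear_minus[OF bounded_linear_ident]] uniform_C_scaleR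
              uniform_C_inverse[OF pos] coef)
    qed
  qed
  then show ?thesis by blast
qed

text \<open>Times enter as parameters in the form T sin \<sigma>. In this way the parameter \<sigma> ranges over the whole line while the time
stays bounded, so that flows have derivatives bounded on the whole parameter space. The phase makes the
statement closed under differentiation.\<close>

lemma bounded_C_sin: "bounded_C j (\<lambda>x::real. sin (x + \<phi>))"
proof (induction j arbitrary: \<phi>)
  case 0
  have "continuous_on UNIV (\<lambda>x::real. sin (x + \<phi>))" by (intro continuous_intros)
  moreover have "\<bar>sin (x + \<phi>)\<bar> \<le> 1" for x by simp
  ultimately show ?case
    by (auto simp: uniformly_bounded_def equicontinuous_def uniform_limit_iff
          continuous_on_eq_continuous_at isCont_def tendsto_iff simp del: abs_sin_le_one intro: exI[of _ 1])
next
  case (Suc j)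
  show ?case
  proof (rule uniform_C_Suc_I[where g' = "\<lambda>_ x w. w *\<^sub>R sin (x + (\<phi> + pi / 2))"])
    show "uniformly_bounded UNIV (\<lambda>_::unit. \<lambda>x::real. sin (x + \<phi>))"
      unfolding uniformly_bounded_def by (intro exI[of _ 1]) auto
    show "((\<lambda>x. sin (x + \<phi>)) has_derivative (\<lambda>w. w *\<^sub>R sin (x + (\<phi> + pi / 2)))) (at x)" for x
    proof -
      have "sin (x + (\<phi> + pi / 2)) = cos (x + \<phi>)"
        using sin_add[of "x + \<phi>" "pi / 2"] by (simp add: add.assoc)
      then show ?thesis by (auto intro!: derivative_eq_intros)
    qed
    show "bounded_C j (\<lambda>x. w *\<^sub>R sin (x + (\<phi> + pi / 2)))" for w
      by (intro uniform_C_linear[OF bounded_linear_scaleR_right] Suc)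
  qed
qed

lemma cos_arcsin_ge_half:
  assumes "\<bar>x\<bar> \<le> 1 / 2"
  shows "cos (arcsin x) \<ge> 1 / 2"
proof -
  have "x\<^sup>2 \<le> (1 / 2)\<^sup>2" using assms abs_le_square_iff[of x "1 / 2"] by simp
  then have "(1 / 2)\<^sup>2 \<le> 1 - x\<^sup>2" by (simp add: power2_eq_square)
  then have "1 / 2 \<le> sqrt (1 - x\<^sup>2)" by (rule real_le_rsqrt)
  moreover have "cos (arcsin x) = sqrt (1 - x\<^sup>2)" using assms by (intro cos_arcsin) auto
  ultimately show ?thesis by simp
qed

lemma bounded_C_arcsin:
  fixes a :: "'e::euclidean_space \<Rightarrow> real"
  assumes a: "bounded_C (Suc r) a" and half: "\<And>y. \<bar>a y\<bar> \<le> 1 / 2"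
  shows "bounded_C (Suc r) (\<lambda>y. arcsin (a y))"
proof -
  obtain a' where a': "\<And>y. (a has_derivative a' y) (at y)" "\<And>w. bounded_C r (\<lambda>y. a' y w)"
    using bounded_C_Suc_D[OF a] by blast
  show ?thesis
  proof (rule implicit_function_bounded_C[where F = "\<lambda>p. sin (fst p) - a (snd p)" and
        F' = "\<lambda>p w. fst w * cos (fst p) - a' (snd p) (snd w)"])
    show "((\<lambda>p. sin (fst p) - a (snd p)) has_derivative (\<lambda>w. fst w * cos (fst p) - a' (snd p) (snd w))) (at p)"
      for p :: "real \<times> 'e"
      by (auto intro!: derivative_eq_intros has_derivative_compose[OF _ a'(1), of snd snd])
    show "bounded_C r (\<lambda>p. fst w * cos (fst p) - a' (snd p) (snd w))" for w :: "real \<times> 'e"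
    proof -
      have "bounded_C r (\<lambda>p::real \<times> 'e. sin (fst p + (0 + pi / 2)))"
        using uniform_C_compose[OF bounded_linear_fst bounded_C_sin[of r "pi / 2"] uniform_C_const[of r UNIV 0]]
        by simp
      then have 1: "bounded_C r (\<lambda>p::real \<times> 'e. fst w *\<^sub>R cos (fst p))"
        by (intro uniform_C_linear[OF bounded_linear_scaleR_right]) (simp add: sin_add)
      have 2: "bounded_C r (\<lambda>p::real \<times> 'e. - a' (snd p) (snd w))"
        using uniform_C_linear[OF bounded_linear_minus[OF bounded_linear_ident]
          uniform_C_compose[OF bounded_linear_snd a'(2)[of "snd w"] uniform_C_const[of r UNIV 0]]]
        by simp
      from uniform_C_add[OF 1 2] show ?thesis by simp
    qed
    have cont: "continuous_on UNIV a"
      using a'(1) by (auto intro!: continuous_at_imp_continuous_on has_derivative_continuous)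
    show "continuous_on UNIV (\<lambda>y. arcsin (a y))"
    proof (intro continuous_on_arcsin cont ballI conjI)
      show "- 1 \<le> a y" "a y \<le> 1" for y using half[of y] by auto
    qed
    show "\<bar>arcsin (a y)\<bar> \<le> 2" for y
    proof -
      have "- 1 \<le> a y" "a y \<le> 1" using half[of y] by auto
      then show ?thesis using arcsin_bounded[of "a y"] pi_less_4 by auto
    qed
    show "sin (fst (arcsin (a y), y)) - a (snd (arcsin (a y), y)) = 0" for y
      using half[of y] by (simp add: abs_le_iff)
    show "fst (1::real, 0::'e) * cos (fst (arcsin (a y), y)) - a' (snd (arcsin (a y), y)) (snd (1::real, 0::'e)) \<ge> 1 / 2" for y
      using cos_arcsin_ge_half[OF half[of y]] linear_0[OF has_derivative_linear[OF a'(1)[of y]]] by simp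
  qed simp
qed

text \<open>The map s \<mapsto> U (s T sin \<sigma>) y solves the equation with field T sin \<sigma> f, in which \<sigma> is just another parameter, on the
fixed interval from 0 to 1. Hence smoothness in time is a case of smoothness in parameters.\<close>

lemma flow_bounded_C:
  fixes f :: "'b::euclidean_space \<times> 'e::euclidean_space \<Rightarrow> 'b" and U :: "real \<Rightarrow> 'e \<Rightarrow> 'b"
  assumes f: "bounded_C (Suc (Suc r)) f"
    and U: "\<And>y s. ((\<lambda>s. U s y) has_vector_derivative f (U s y, y)) (at s)"
    and init: "bounded_C (Suc (Suc r)) (U 0)"
  shows "bounded_C (Suc (Suc r)) (\<lambda>p. U (T * sin (fst p)) (snd p))"
proof -
  let ?f = "\<lambda>q :: 'b \<times> real \<times> 'e. (T * sin (fst (snd q))) *\<^sub>R f (fst q, snd (snd q))"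
  let ?u = "\<lambda>s p. U (s * (T * sin (fst p))) (snd p)"
  have "uniform_C (Suc (Suc r)) {0..1} ?u"
  proof (rule finite_time_uniform_C[where f = ?f])
    show "bounded_C (Suc (Suc r)) ?f"
    proof (rule uniform_C_scaleR)
      have "bounded_linear (\<lambda>q :: 'b \<times> real \<times> 'e. fst (snd q))"
        by (intro bounded_linear_compose[OF bounded_linear_fst] bounded_linear_snd)
      from uniform_C_compose[OF this bounded_C_sin[of _ 0] uniform_C_const[of "Suc (Suc r)" UNIV 0]]
      have "bounded_C (Suc (Suc r)) (\<lambda>q :: 'b \<times> real \<times> 'e. sin (fst (snd q)))" by simp
      from uniform_C_linear[OF bounded_linear_mult_right[of T] this]
      show "bounded_C (Suc (Suc r)) (\<lambda>q :: 'b \<times> real \<times> 'e. T * sin (fst (snd q)))" .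
      have "bounded_linear (\<lambda>q :: 'b \<times> real \<times> 'e. (fst q, snd (snd q)))"
        by (intro bounded_linear_Pair bounded_linear_fst bounded_linear_compose[OF bounded_linear_snd]
            bounded_linear_snd)
      from uniform_C_compose[OF this f uniform_C_const[of "Suc (Suc r)" UNIV 0]]
      show "bounded_C (Suc (Suc r)) (\<lambda>q :: 'b \<times> real \<times> 'e. f (fst q, snd (snd q)))" by simp
    qed
    show "((\<lambda>s. ?u s p) has_vector_derivative ?f (?u s p, p)) (at s within {0..1})" for s p
      using has_vector_derivative_at_within[OF has_vector_derivative_affine[where a = 0 and c = "T * sin (fst p)"
          and v = "\<lambda>s. U s (snd p)" and s = s, OF U]]
      by (simp add: mult.commute)
    have "bounded_C (Suc (Suc r)) (\<lambda>p :: real \<times> 'e. U 0 (snd p))"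
      using uniform_C_compose[OF bounded_linear_snd init uniform_C_const[of "Suc (Suc r)" UNIV 0]] by simp
    then show "bounded_C (Suc (Suc r)) (?u 0)" by simp
  qed simp
  from uniform_C_reindex[OF this, of UNIV "\<lambda>_. 1"] show ?thesis by simp
qed

lemma flow_at_time_bounded_C:
  fixes f :: "'b::euclidean_space \<times> 'e::euclidean_space \<Rightarrow> 'b" and U :: "real \<Rightarrow> 'e \<Rightarrow> 'b"
  assumes f: "bounded_C (Suc (Suc r)) f"
    and U: "\<And>y s. ((\<lambda>s. U s y) has_vector_derivative f (U s y, y)) (at s)"
    and init: "bounded_C (Suc (Suc r)) (U 0)"
    and \<tau>: "bounded_C (Suc (Suc r)) \<tau>" "\<And>y. \<bar>\<tau> y\<bar> \<le> T" "T > 0"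
  shows "bounded_C (Suc (Suc r)) (\<lambda>y. U (\<tau> y) y)"
proof -
  \<comment> \<open>The factor 2 keeps the argument of arcsin away from 1 in absolute value, where arcsin is not smooth.\<close>
  define \<theta> where "\<theta> = (\<lambda>y. arcsin (\<tau> y / (2 * T)))"
  have half: "\<bar>\<tau> y / (2 * T)\<bar> \<le> 1 / 2" for y using \<tau>(2)[of y] \<tau>(3) by (simp add: field_simps)
  have "bounded_C (Suc (Suc r)) (\<lambda>y. \<tau> y / (2 * T))"
    by (rule uniform_C_linear[OF bounded_linear_divide \<tau>(1)])
  then have \<theta>: "bounded_C (Suc (Suc r)) \<theta>"
    unfolding \<theta>_def by (rule bounded_C_arcsin[OF _ half])
  have "bounded_C (Suc (Suc r)) (\<lambda>y. (\<lambda>p. U (2 * T * sin (fst p)) (snd p)) ((\<lambda>y. (0, y)) y + (\<theta> y, 0)))"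
  proof (rule uniform_C_compose[OF _ flow_bounded_C[OF f U init]])
    show "bounded_linear (\<lambda>y::'e. (0::real, y))"
      by (intro bounded_linear_Pair bounded_linear_zero bounded_linear_ident)
    show "bounded_C (Suc (Suc r)) (\<lambda>y. (\<theta> y, 0::'e))"
      by (rule uniform_C_linear[OF _ \<theta>, of "\<lambda>x. (x, 0)"])
         (intro bounded_linear_Pair bounded_linear_zero bounded_linear_ident)
  qed
  moreover have "2 * T * sin (\<theta> y) = \<tau> y" for y
  proof -
    have "- 1 \<le> \<tau> y / (2 * T)" "\<tau> y / (2 * T) \<le> 1"
      using half[of y] unfolding abs_le_iff by linarith+
    from sin_arcsin[OF this] show ?thesis using \<tau>(3) by (simp add: \<theta>_def)
  qed
  ultimately show ?thesis by simp
qed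

section \<open>Crossing times\<close>

lemma has_derivative_partial:
  assumes "(h has_derivative h') (at (x, y))"
  shows "((\<lambda>x. h (x, y)) has_derivative (\<lambda>v. h' (v, 0))) (at x)"
proof -
  have "((\<lambda>x. (x, y)) has_derivative (\<lambda>v. (v, 0))) (at x)"
    by (intro has_derivative_Pair has_derivative_ident has_derivative_const)
  from has_derivative_compose[OF this assms] show ?thesis by simp
qed

lemma has_real_derivative_along_curve:
  fixes h :: "'b::euclidean_space \<times> 'e::euclidean_space \<Rightarrow> real"
  assumes "(h has_derivative h') (at (x s, y))" "(x has_vector_derivative D) (at s)"
  shows "((\<lambda>s. h (x s, y)) has_real_derivative h' (D, 0)) (at s)"
proof -
  have lin: "linear (\<lambda>v. h' (v, 0))"
    by (rule has_derivative_linear[OF has_derivative_partial[OF assms(1)]])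
  have "((\<lambda>s. h (x s, y)) has_derivative (\<lambda>t. h' (t *\<^sub>R D, 0))) (at s)"
    by (rule has_derivative_compose[where f = x and g = "\<lambda>x. h (x, y)"])
       (use has_derivative_partial[OF assms(1)] assms(2) in \<open>auto simp: has_vector_derivative_def\<close>)
  then show ?thesis
    unfolding has_field_derivative_def
    by (rule has_derivative_eq_rhs) (use linear_cmul[OF lin] in \<open>auto simp: fun_eq_iff\<close>)
qed

text \<open>The crossing time \<tau>(y) is the only s in {0..T} where h equals c with speed at least \<eta> and h \<le> c held before: an
earlier such s would be followed by values above c before \<tau>(y), a later one would be preceded by such values.
These conditions are closed in (y, s), so that \<tau> has a closed graph in a compact range and is continuous. They
include s = 0, because an orbit may begin arbitrarily close to the threshold. The implicit function theorem then
gives smoothness.\<close>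

lemma crossing_time_bounded_C:
  fixes f :: "'b::euclidean_space \<times> 'e::euclidean_space \<Rightarrow> 'b" and U :: "real \<Rightarrow> 'e \<Rightarrow> 'b"
    and h :: "'b \<times> 'e \<Rightarrow> real"
  assumes f: "bounded_C (Suc (Suc r)) f"
    and U: "\<And>y s. ((\<lambda>s. U s y) has_vector_derivative f (U s y, y)) (at s)"
    and init: "bounded_C (Suc (Suc r)) (U 0)"
    and h: "\<And>p. (h has_derivative h' p) (at p)" "\<And>w. bounded_C (Suc r) (\<lambda>p. h' p w)"
    and \<tau>: "\<And>y. 0 < \<tau> y" "\<And>y. \<tau> y \<le> T"
    and hit: "\<And>y. h (U (\<tau> y) y, y) = c"
    and trans: "\<And>y. h' (U (\<tau> y) y, y) (f (U (\<tau> y) y, y), 0) \<ge> \<eta>" "\<eta> > 0"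
    and below: "\<And>y s. 0 < s \<Longrightarrow> s < \<tau> y \<Longrightarrow> h (U s y, y) < c"
  shows "bounded_C (Suc (Suc r)) \<tau>"
proof -
  have T: "T > 0" using \<tau>(1)[of undefined] \<tau>(2)[of undefined] by linarith
  define G where "G = (\<lambda>p. U (2 * T * sin (fst p)) (snd p))"
  have G: "bounded_C (Suc (Suc r)) G" unfolding G_def by (rule flow_bounded_C[OF f U init])
  obtain G' where G': "\<And>p. (G has_derivative G' p) (at p)" "\<And>w. bounded_C (Suc r) (\<lambda>p. G' p w)"
    using bounded_C_Suc_D[OF G] by blast
  obtain f' where f': "\<And>p. (f has_derivative f' p) (at p)" using bounded_C_Suc_D[OF f] by blast
  have G_arcsin: "G (arcsin (s / (2 * T)), y) = U s y" if "s \<in> {0..T}" for s y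
  proof -
    have "- 1 \<le> s / (2 * T)" "s / (2 * T) \<le> 1" using that T by (auto simp: field_simps)
    from sin_arcsin[OF this] show ?thesis using T by (simp add: G_def)
  qed
  define W where "W = (\<lambda>q. (G (arcsin (snd q / (2 * T)), fst q), fst q))"
  have W: "W (y, s) = (U s y, y)" if "s \<in> {0..T}" for s y using G_arcsin[OF that] by (simp add: W_def)
  have isCont_G: "isCont G p" for p by (rule has_derivative_continuous[OF G'(1)])
  have contW: "continuous_on (UNIV \<times> {0..T}) W"
  proof -
    have "continuous_on (UNIV \<times> {0..T}) (\<lambda>q::'e \<times> real. arcsin (snd q / (2 * T)))"
    proof (intro continuous_on_arcsin continuous_intros ballI conjI)
      fix q :: "'e \<times> real" assume "q \<in> UNIV \<times> {0..T}"
      then show "- 1 \<le> snd q / (2 * T)" "snd q / (2 * T) \<le> 1" using T by (auto simp: field_simps)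
    qed (use T in auto)
    then have "continuous_on (UNIV \<times> {0..T}) (\<lambda>q::'e \<times> real. (arcsin (snd q / (2 * T)), fst q))"
      by (intro continuous_on_Pair continuous_on_fst continuous_on_id)
    from continuous_on_compose2[OF continuous_at_imp_continuous_on this, of UNIV G] isCont_G
    have "continuous_on (UNIV \<times> {0..T}) (\<lambda>q::'e \<times> real. G (arcsin (snd q / (2 * T)), fst q))" by auto
    then show ?thesis unfolding W_def by (intro continuous_on_Pair continuous_on_fst continuous_on_id)
  qed
  define Hd where "Hd = (\<lambda>p. h' p (f p, 0))"
  have conth: "continuous_on UNIV h"
    by (intro continuous_at_imp_continuous_on ballI has_derivative_continuous[OF h(1)])
  have contHd: "continuous_on UNIV Hd"
  proof -
    have "Hd p = (\<Sum>b\<in>Basis. ((f p, 0) \<bullet> b) * h' p b)" for p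
      unfolding Hd_def by (subst linear_eq_sum_Basis[OF has_derivative_linear[OF h(1)]]) simp
    then have eq: "Hd = (\<lambda>p. \<Sum>b\<in>Basis. ((f p, 0) \<bullet> b) * h' p b)" by (rule ext)
    have cf: "continuous_on UNIV f"
      by (intro continuous_at_imp_continuous_on ballI has_derivative_continuous[OF f'])
    have ch: "continuous_on UNIV (\<lambda>p. h' p b)" for b
      by (intro continuous_at_imp_continuous_on ballI
          equicontinuous_isCont[OF uniform_C_equicontinuous[OF h(2)[of b]] UNIV_I])
    show ?thesis unfolding eq by (intro continuous_intros cf ch)
  qed
  have dH: "((\<lambda>s. h (U s y, y)) has_real_derivative Hd (U s y, y)) (at s)" for s y
    unfolding Hd_def by (rule has_real_derivative_along_curve[where x = "\<lambda>s. U s y", OF h(1) U])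
  \<comment> \<open>The last condition is stated on proportions \<kappa> of the time s, because it has to be closed in s as well.\<close>
  define S where "S = {q \<in> UNIV \<times> {0..T}. h (W q) = c} \<inter> {q \<in> UNIV \<times> {0..T}. Hd (W q) \<ge> \<eta>} \<inter>
    (\<Inter>\<kappa>\<in>{0..1}. {q \<in> UNIV \<times> {0..T}. h (W (fst q, \<kappa> * snd q)) \<le> c})"
  have closedS: "closed S"
  proof -
    have cl: "closed (UNIV \<times> {0..T} :: ('e \<times> real) set)" by (intro closed_Times) auto
    have 1: "continuous_on (UNIV \<times> {0..T}) (\<lambda>q. h (W q))"
      by (rule continuous_on_compose2[OF conth contW]) auto
    have 2: "continuous_on (UNIV \<times> {0..T}) (\<lambda>q. Hd (W q))"
      by (rule continuous_on_compose2[OF contHd contW]) auto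
    have 3: "continuous_on (UNIV \<times> {0..T}) (\<lambda>q. h (W (fst q, \<kappa> * snd q)))" if "\<kappa> \<in> {0..1}" for \<kappa>
    proof (rule continuous_on_compose2[OF 1])
      show "(\<lambda>q. (fst q, \<kappa> * snd q)) ` (UNIV \<times> {0..T} :: ('e \<times> real) set) \<subseteq> UNIV \<times> {0..T}"
        using that by (auto intro!: order_trans[OF mult_left_le_one_le])
    qed (intro continuous_intros)
    show ?thesis
      unfolding S_def
      by (intro closed_Int closed_INT ballI continuous_closed_preimage_constant[OF 1 cl]
          continuous_on_closed_Collect_le[OF continuous_on_const 2 cl]
          continuous_on_closed_Collect_le[OF 3 continuous_on_const cl])
  qed
  have after: "\<exists>d>0. \<forall>x>0. x < d \<longrightarrow> h (U (s + x) y, y) > c" if "h (U s y, y) = c" "Hd (U s y, y) \<ge> \<eta>" for s y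
    using DERIV_pos_inc_right[OF dH[of y s]] that trans(2) by (metis less_le_trans)
  have S_eq: "S = (\<lambda>y. (y, \<tau> y)) ` UNIV"
  proof (intro subset_antisym subsetI)
    fix q assume q: "q \<in> S"
    obtain y s where ys: "q = (y, s)" by (cases q)
    have s: "0 \<le> s" "s \<le> T" using q ys by (auto simp: S_def)
    have hs: "h (U s y, y) = c" "Hd (U s y, y) \<ge> \<eta>" using q W[of s y] s by (auto simp: S_def ys)
    have le: "h (U (\<kappa> * s) y, y) \<le> c" if "\<kappa> \<in> {0..1}" for \<kappa>
    proof -
      have "h (W (y, \<kappa> * s)) \<le> c" using q that by (auto simp: S_def ys)
      moreover have "\<kappa> * s \<in> {0..T}" using that s by (auto intro!: order_trans[OF mult_left_le_one_le])
      ultimately show ?thesis using W by simp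
    qed
    have "\<not> s < \<tau> y"
    proof
      assume lt: "s < \<tau> y"
      obtain d where d: "d > 0" "\<And>x. 0 < x \<Longrightarrow> x < d \<Longrightarrow> h (U (s + x) y, y) > c" using after[OF hs] by blast
      define x where "x = min (d / 2) ((\<tau> y - s) / 2)"
      have x: "0 < x" "x < d" "s + x < \<tau> y" using d lt by (auto simp: x_def min_def field_simps)
      from d(2)[OF x(1,2)] below[of "s + x" y] x s show False by auto
    qed
    moreover have "\<not> \<tau> y < s"
    proof
      assume lt: "\<tau> y < s"
      obtain d where d: "d > 0" "\<And>x. 0 < x \<Longrightarrow> x < d \<Longrightarrow> h (U (\<tau> y + x) y, y) > c"
        using after[of "\<tau> y" y] hit trans(1) by (auto simp: Hd_def)
      define x where "x = min (d / 2) ((s - \<tau> y) / 2)"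
      have x: "0 < x" "x < d" "\<tau> y + x < s" using d lt by (auto simp: x_def min_def field_simps)
      have "h (U ((\<tau> y + x) / s * s) y, y) \<le> c"
        by (rule le) (use x \<tau>(1)[of y] in auto)
      moreover have "(\<tau> y + x) / s * s = \<tau> y + x" using lt \<tau>(1)[of y] by simp
      ultimately show False using d(2)[OF x(1,2)] by auto
    qed
    ultimately have "s = \<tau> y" by simp
    then show "q \<in> (\<lambda>y. (y, \<tau> y)) ` UNIV" using ys by simp
  next
    fix q assume "q \<in> (\<lambda>y. (y, \<tau> y)) ` UNIV"
    then obtain y where q: "q = (y, \<tau> y)" by auto
    have in_T: "\<tau> y \<in> {0..T}" using \<tau>(1)[of y] \<tau>(2)[of y] by simp
    have "h (W (y, \<kappa> * \<tau> y)) \<le> c" if l: "\<kappa> \<in> {0..1}" for \<kappa>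
    proof -
      have "\<kappa> * \<tau> y \<in> {0..T}" using l in_T by (auto intro!: order_trans[OF mult_left_le_one_le])
      then have "h (W (y, \<kappa> * \<tau> y)) = h (U (\<kappa> * \<tau> y) y, y)" by (simp add: W)
      moreover have "h (U (\<kappa> * \<tau> y) y, y) \<le> c"
      proof -
        consider "\<kappa> = 0" | "0 < \<kappa>" "\<kappa> < 1" | "\<kappa> = 1" using l by fastforce
        then show ?thesis
        proof cases
          case 1
          have "((\<lambda>s. h (U s y, y)) \<longlongrightarrow> h (U 0 y, y)) (at_right 0)"
            using DERIV_isCont[OF dH[of y 0]] by (auto simp: isCont_def intro: tendsto_within_subset)
          moreover have "\<forall>\<^sub>F s in at_right 0. h (U s y, y) \<le> c"
            unfolding eventually_at_right_field using \<tau>(1)[of y] below less_imp_le by blast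
          ultimately show ?thesis using 1 tendsto_upperbound by fastforce
        next
          case 2
          then show ?thesis using \<tau>(1)[of y] by (intro less_imp_le below) auto
        qed (simp add: hit)
      qed
      ultimately show ?thesis by simp
    qed
    then show "q \<in> S" using q in_T W[OF in_T] hit trans(1) by (auto simp: S_def Hd_def)
  qed
  have cont\<tau>: "continuous_on UNIV \<tau>"
  proof (rule continuous_from_closed_graph[of "{0..T}"])
    show "closed ((\<lambda>y. (y, \<tau> y)) ` UNIV)" using closedS S_eq by simp
  qed (use \<tau> in \<open>auto intro: less_imp_le[OF \<tau>(1)]\<close>)
  define \<theta> where "\<theta> = (\<lambda>y. arcsin (\<tau> y / (2 * T)))"
  have half: "0 \<le> \<tau> y / (2 * T)" "\<tau> y / (2 * T) \<le> 1 / 2" for y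
    using \<tau>(1)[of y] \<tau>(2)[of y] T by (auto simp: field_simps)
  have G\<theta>: "G (\<theta> y, y) = U (\<tau> y) y" for y
    unfolding \<theta>_def by (rule G_arcsin) (use \<tau>(1)[of y] \<tau>(2)[of y] in simp)
  have sin\<theta>: "2 * T * sin (\<theta> y) = \<tau> y" for y
  proof -
    have "- 1 \<le> \<tau> y / (2 * T)" "\<tau> y / (2 * T) \<le> 1" using half[of y] by linarith+
    from sin_arcsin[OF this] show ?thesis using T by (simp add: \<theta>_def)
  qed
  have "bounded_C (Suc (Suc r)) \<theta>"
  proof (rule implicit_function_bounded_C[where F = "\<lambda>p. h (G p, snd p) - c" and
        F' = "\<lambda>p w. h' (G p, snd p) (G' p w, snd w)" and \<eta> = "T * \<eta>" and B = 2])
    have d: "((\<lambda>p. (G p, snd p)) has_derivative (\<lambda>w. (G' p w, snd w))) (at p)" for p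
      by (intro has_derivative_Pair G' has_derivative_snd has_derivative_ident)
    show "((\<lambda>p. h (G p, snd p) - c) has_derivative (\<lambda>w. h' (G p, snd p) (G' p w, snd w))) (at p)" for p
      using has_derivative_diff[OF has_derivative_compose[OF d h(1)] has_derivative_const] by simp
    show "bounded_C (Suc r) (\<lambda>p. h' (G p, snd p) (G' p w, snd w))" for w
    proof -
      have eq: "h' (G p, snd p) (G' p w, snd w) =
          (\<Sum>b\<in>Basis. ((G' p w, snd w) \<bullet> b) *\<^sub>R h' (G p, snd p) b)" for p
        by (rule linear_eq_sum_Basis[OF has_derivative_linear[OF h(1)]])
      have blin: "bounded_linear (\<lambda>x::'b. (x, 0::'e))"
        by (intro bounded_linear_Pair bounded_linear_zero bounded_linear_ident)
      have "bounded_C (Suc r) (\<lambda>p. (G' p w, 0) + (0, snd w))"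
        by (intro uniform_C_add uniform_C_linear[OF blin] G'(2) uniform_C_const)
      then have 1: "bounded_C (Suc r) (\<lambda>p. (G' p w, snd w))" by simp
      have 2: "bounded_C (Suc r) (\<lambda>p. h' (G p, snd p) b)" for b
      proof -
        have "bounded_C (Suc r) (\<lambda>p. (\<lambda>p. h' p b) ((\<lambda>p. (0, snd p)) p + (G p, 0)))"
        proof (rule uniform_C_compose[OF _ h(2)])
          show "bounded_linear (\<lambda>p::real \<times> 'e. (0::'b, snd p))"
            by (intro bounded_linear_Pair bounded_linear_zero bounded_linear_snd)
          show "bounded_C (Suc r) (\<lambda>p. (G p, 0::'e))"
            by (rule uniform_C_linear[OF blin uniform_C_Suc_imp[OF G]])
        qed
        then show ?thesis by simp
      qed
      show ?thesis
        unfolding eq by (intro uniform_C_sum uniform_C_scaleR uniform_C_linear[OF bounded_linear_inner_left 1] 2) auto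
    qed
    show "continuous_on UNIV \<theta>"
      unfolding \<theta>_def
    proof (intro continuous_on_arcsin continuous_intros cont\<tau> ballI conjI)
      show "- 1 \<le> \<tau> y / (2 * T)" "\<tau> y / (2 * T) \<le> 1" for y using half[of y] by linarith+
    qed (use T in auto)
    show "\<bar>\<theta> y\<bar> \<le> 2" for y
    proof -
      have "- 1 \<le> \<tau> y / (2 * T)" "\<tau> y / (2 * T) \<le> 1" using half[of y] by linarith+
      then show ?thesis using arcsin_bounded[of "\<tau> y / (2 * T)"] pi_less_4 by (auto simp: \<theta>_def)
    qed
    show "h (G (\<theta> y, y), snd (\<theta> y, y)) - c = 0" for y by (simp add: G\<theta> hit)
    show "h' (G (\<theta> y, y), snd (\<theta> y, y)) (G' (\<theta> y, y) (1, 0), snd (1::real, 0::'e)) \<ge> T * \<eta>" for y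
    proof -
      have "((\<lambda>\<sigma>. G (\<sigma>, y)) has_derivative (\<lambda>v. G' (\<theta> y, y) (v, 0))) (at (\<theta> y))"
        by (rule has_derivative_partial[OF G'(1)])
      moreover have "((\<lambda>\<sigma>. 2 * T * sin \<sigma>) has_vector_derivative 2 * T * cos (\<theta> y)) (at (\<theta> y))"
        unfolding has_real_derivative_iff_has_vector_derivative[symmetric] by (auto intro!: derivative_eq_intros)
      from vector_diff_chain_at[OF this U]
      have "((\<lambda>\<sigma>. G (\<sigma>, y)) has_vector_derivative (2 * T * cos (\<theta> y)) *\<^sub>R f (U (\<tau> y) y, y)) (at (\<theta> y))"
        by (simp add: comp_def G_def sin\<theta>)
      ultimately have "(\<lambda>v. G' (\<theta> y, y) (v, 0)) = (\<lambda>v. v *\<^sub>R (2 * T * cos (\<theta> y)) *\<^sub>R f (U (\<tau> y) y, y))"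
        unfolding has_vector_derivative_def by (rule has_derivative_unique)
      from fun_cong[OF this, of 1] have "G' (\<theta> y, y) (1, 0) = (2 * T * cos (\<theta> y)) *\<^sub>R f (U (\<tau> y) y, y)" by simp
      then have "h' (G (\<theta> y, y), snd (\<theta> y, y)) (G' (\<theta> y, y) (1, 0), snd (1::real, 0::'e)) =
          h' (U (\<tau> y) y, y) ((2 * T * cos (\<theta> y)) *\<^sub>R (f (U (\<tau> y) y, y), 0))" by (simp add: G\<theta>)
      also have "\<dots> = 2 * T * cos (\<theta> y) * h' (U (\<tau> y) y, y) (f (U (\<tau> y) y, y), 0)"
        by (subst linear_cmul[OF has_derivative_linear[OF h(1)]]) simp
      also have "\<dots> \<ge> T * \<eta>"
      proof (rule mult_mono)
        have "cos (\<theta> y) \<ge> 1 / 2" unfolding \<theta>_def by (rule cos_arcsin_ge_half) (use half[of y] in auto)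
        then have "T * 1 \<le> T * (2 * cos (\<theta> y))" using T by (intro mult_left_mono) auto
        then show "T \<le> 2 * T * cos (\<theta> y)" by simp
        then show "0 \<le> 2 * T * cos (\<theta> y)" using T by linarith
      qed (use trans in \<open>auto intro: less_imp_le\<close>)
      finally show ?thesis .
    qed
    show "T * \<eta> > 0" using T trans(2) by simp
  qed
  then have "bounded_C (Suc (Suc r)) (\<lambda>y. (\<lambda>x. sin (x + 0)) ((\<lambda>_. 0) y + \<theta> y))"
    by (rule uniform_C_compose[OF bounded_linear_zero bounded_C_sin])
  then have "bounded_C (Suc (Suc r)) (\<lambda>y. (2 * T) * sin (\<theta> y))"
    by (intro uniform_C_linear[OF bounded_linear_mult_right]) simp
  then show ?thesis by (simp add: sin\<theta>)
qed

text \<open>At the ends of the interval only continuity is known; the integral form of the equation gives the one-sided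
derivatives.\<close>

lemma ode_derivative_closed_interval:
  fixes v :: "real \<Rightarrow> 'b::euclidean_space"
  assumes cont: "continuous_on {a..b} v" and \<phi>: "continuous_on UNIV \<phi>"
    and d: "\<And>s. a < s \<Longrightarrow> s < b \<Longrightarrow> (v has_vector_derivative \<phi> (v s)) (at s)" and x: "x \<in> {a..b}"
  shows "(v has_vector_derivative \<phi> (v x)) (at x within {a..b})"
proof -
  have c: "continuous_on {a..b} (\<lambda>s. \<phi> (v s))" by (rule continuous_on_compose2[OF \<phi> cont]) auto
  have "integral {a..u} (\<lambda>s. \<phi> (v s)) = v u - v a" if "u \<in> {a..b}" for u
    by (intro integral_unique fundamental_theorem_of_calculus_interior continuous_on_subset[OF cont] d)
       (use that in auto)
  then have eq: "v u = v a + integral {a..u} (\<lambda>s. \<phi> (v s))" if "u \<in> {a..b}" for u using that by simp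
  have "((\<lambda>u. v a + integral {a..u} (\<lambda>s. \<phi> (v s))) has_vector_derivative 0 + \<phi> (v x)) (at x within {a..b})"
    by (intro has_vector_derivative_add has_vector_derivative_const integral_has_vector_derivative c x)
  then show ?thesis
    unfolding add_0_left
    by (rule has_vector_derivative_transform_within[OF _ zero_less_one x]) (rule eq[symmetric])
qed

section \<open>The outermost orbit\<close>

text \<open>The time T is chosen such that all orbits are within \<rho> of w(y) from then on. They have then crossed
all thresholds, since h(w(y), y) exceeds the last one by \<mu>. Induction over the crossings gives the point on the
last threshold, and the flow of f N, evaluated at the time T - t N y, gives uN T. From there the solution is
followed backwards for a bounded time by finite_time_uniform_C, and forwards for all times by
nonlinear_ode_uniform_C, where the spectral gap at w(y) provides stability. The times s between t N y and T are
covered by the backward part because t N y \<ge> 0.\<close>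

lemma C_class_outer_orbit:
  fixes f :: "int \<Rightarrow> (real^'n) \<times> 'e::euclidean_space \<Rightarrow> real^'n"
    and u uN :: "real \<Rightarrow> 'e \<Rightarrow> real^'n" and h :: "(real^'n) \<times> 'e \<Rightarrow> real"
    and t :: "int \<Rightarrow> 'e \<Rightarrow> real" and c :: "int \<Rightarrow> real"
  assumes N: "N \<ge> 1" and f: "\<And>l. l \<in> {0..N} \<Longrightarrow> bounded_C (Suc (Suc r)) (f l)"
    and h: "\<And>p. (h has_derivative h' p) (at p)" "\<And>w. bounded_C (Suc r) (\<lambda>p. h' p w)"
    and t: "\<And>y. t 0 y = 0" "\<And>i y. i \<in> {1..N} \<Longrightarrow> t (i - 1) y < t i y"
    and u_cont: "\<And>y. continuous_on {0..} (\<lambda>s. u s y)"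
    and ode: "\<And>i y s. i \<in> {1..N} \<Longrightarrow> t (i - 1) y < s \<Longrightarrow> s < t i y \<Longrightarrow>
       ((\<lambda>s. u s y) has_vector_derivative f (i - 1) (u s y, y)) (at s)"
    and ode_last: "\<And>y s. t N y < s \<Longrightarrow> ((\<lambda>s. u s y) has_vector_derivative f N (u s y, y)) (at s)"
    and hit: "\<And>i y. i \<in> {1..N} \<Longrightarrow> h (u (t i y) y, y) = c (i - 1)"
    and trans: "\<And>i y. i \<in> {1..N} \<Longrightarrow> h' (u (t i y) y, y) (f (i - 1) (u (t i y) y, y), 0) \<ge> \<eta>" "\<eta> > 0"
    and below: "\<And>i y s. i \<in> {1..N} \<Longrightarrow> t (i - 1) y < s \<Longrightarrow> s < t i y \<Longrightarrow> h (u s y, y) < c (i - 1)"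
    and init: "bounded_C (Suc (Suc r)) (u 0)"
    and w: "\<And>y. norm (w y) \<le> W" "continuous_on UNIV w"
    and \<mu>: "\<mu> > 0" "\<And>y. h (w y, y) - c (N - 1) > \<mu>"
    and lim: "uniform_limit UNIV u w at_top"
    and fN': "\<And>p. (f N has_derivative fN' p) (at p)"
    and hyp: "\<delta> > 0" "\<And>y. spectral_gap \<delta> (matrix (\<lambda>v. fN' (w y, y) (v, 0)))"
    and uN: "\<And>y s. ((\<lambda>s. uN s y) has_vector_derivative f N (uN s y, y)) (at s)"
      "\<And>y. uN (t N y) y = u (t N y) y"
  shows "(\<forall>s. C_class (Suc (Suc r)) (uN s)) \<and>
    (\<forall>q\<le>Suc (Suc r). \<exists>K. \<forall>y s. s \<ge> t N y \<longrightarrow> nderiv_norm_le q (uN s) y K)"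
proof -
  let ?r = "Suc (Suc r)"
  have fN: "bounded_C ?r (f N)" using f[of N] N by simp
  have fN'_C: "bounded_C (Suc r) (\<lambda>p. fN' p w)" for w by (rule uniform_C_derivative[OF fN fN'])
  obtain Kf where Kf: "Kf \<ge> 0" "\<And>p w. norm (fN' p w) \<le> Kf * norm w"
    using uniformly_bounded_Basis[of "UNIV :: unit set" "\<lambda>_. fN'"] has_derivative_linear[OF fN']
      uniform_C_bounded[OF fN'_C] by auto
  obtain Kh where Kh: "Kh \<ge> 0" "\<And>p w. norm (h' p w) \<le> Kh * norm w"
    using uniformly_bounded_Basis[of "UNIV :: unit set" "\<lambda>_. h'"] has_derivative_linear[OF h(1)]
      uniform_C_bounded[OF h(2)] by auto
  have h_Lip: "norm (h p - h q) \<le> Kh * norm (p - q)" for p q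
    by (rule Lipschitz_from_derivative_bound[OF h(1) Kh(2)])
  obtain L where L: "L \<ge> 0" "\<And>p q w. norm (fN' q w - fN' p w) \<le> L * norm (q - p) * norm w"
    "\<And>p q. norm (f N q - f N p - fN' p (q - p)) \<le> L * (norm (q - p))\<^sup>2"
    by (rule bounded_C_Taylor[OF fN fN']) (rule that)
  obtain C \<epsilon> where C: "C > 0" "\<epsilon> > 0" and stable:
    "\<And>(A\<^sub>0::real^'n^'n) A. \<forall>x. norm (A\<^sub>0 *v x) \<le> Kf * norm x \<Longrightarrow> spectral_gap \<delta> A\<^sub>0 \<Longrightarrow>
      \<forall>s\<ge>0. \<forall>x. norm (A s x - A\<^sub>0 *v x) \<le> \<epsilon> * norm x \<Longrightarrow> stable_on {0..} A C"
    using stable_on_spectral_gap[OF Kf(1) hyp(1), where 'n = 'n] by blast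
  \<comment> \<open>The three bounds keep the linearization within \<epsilon> of that at w, keep h above the last threshold, and make solutions at nearby parameters 3 \<rho>-close with C L (3 \<rho>) \<le> 1/2.\<close>
  define \<rho> where "\<rho> = min (\<epsilon> / (L + 1)) (min (\<mu> / (Kh + 1)) (1 / (6 * (C * L + 1))))"
  have dens: "L + 1 > 0" "Kh + 1 > 0" "C * L + 1 > 0" using L Kh C by (auto intro: add_nonneg_pos)
  have \<rho>: "\<rho> > 0" using dens C \<mu> by (simp add: \<rho>_def)
  have "\<rho> \<le> \<epsilon> / (L + 1)" "\<rho> \<le> \<mu> / (Kh + 1)" "\<rho> \<le> 1 / (6 * (C * L + 1))"
    unfolding \<rho>_def by (simp_all add: min.coboundedI2)
  then have "\<rho> * (L + 1) \<le> \<epsilon>" "\<rho> * (Kh + 1) \<le> \<mu>" "\<rho> * (6 * (C * L + 1)) \<le> 1"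
    using dens by (simp_all add: pos_le_divide_eq)
  with \<rho> have \<rho>L: "L * \<rho> \<le> \<epsilon>" and \<rho>h: "Kh * \<rho> < \<mu>" and \<rho>C: "C * (L * (3 * \<rho>)) \<le> 1 / 2"
    by (simp_all add: algebra_simps)
  have "\<forall>\<^sub>F s in at_top. \<forall>y\<in>UNIV. dist (u s y) (w y) < \<rho>" by (rule uniform_limitD[OF lim \<rho>])
  then obtain T0 where T0: "\<And>s y. s \<ge> T0 \<Longrightarrow> dist (u s y) (w y) < \<rho>"
    unfolding eventually_at_top_linorder by blast
  define T where "T = max T0 1"
  have T: "T > 0" "\<And>s y. s \<ge> T \<Longrightarrow> norm (u s y - w y) < \<rho>" using T0 by (auto simp: T_def dist_norm)
  have tN_T: "t N y < T" for y
  proof (rule ccontr)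
    assume "\<not> t N y < T"
    then have "norm (u (t N y) y - w y) < \<rho>" using T(2) by simp
    have "norm (h (u (t N y) y, y) - h (w y, y)) \<le> Kh * norm ((u (t N y) y, y) - (w y, y))" by (rule h_Lip)
    also have "\<dots> = Kh * norm (u (t N y) y - w y)" by (simp add: norm_Pair)
    also have "\<dots> \<le> Kh * \<rho>" using \<open>norm (u (t N y) y - w y) < \<rho>\<close> Kh by (intro mult_left_mono) auto
    finally have "\<bar>c (N - 1) - h (w y, y)\<bar> < \<mu>" using \<rho>h hit[of N y] N by simp
    then show False using \<mu>(2)[of y] by linarith
  qed
  have t_mono: "t i y \<le> t j y" if "0 \<le> i" "i \<le> j" "j \<le> N" for i j y
    using that(2,3)
  proof (induction j rule: int_ge_induct)
    case (step j)
    then show ?case using t(2)[of "j + 1" y] that(1) by simp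
  qed simp
  have f_Lip: "\<exists>K\<ge>0. \<forall>x x' y. norm (f l (x, y) - f l (x', y)) \<le> K * norm (x - x')" if l: "l \<in> {0..N}" for l
  proof -
    obtain K where "K \<ge> 0" "\<And>p q. norm (f l q - f l p) \<le> K * norm (q - p)"
      using uniform_C_Suc_Lipschitz[OF f[OF l]] by (metis UNIV_I)
    then have "norm (f l (x, y) - f l (x', y)) \<le> K * norm (x - x')" for x x' y
      using \<open>\<And>p q. norm (f l q - f l p) \<le> K * norm (q - p)\<close>[of "(x, y)" "(x', y)"] by (simp add: norm_Pair)
    then show ?thesis using \<open>K \<ge> 0\<close> by blast
  qed
  \<comment> \<open>Between crossings the given orbit agrees with the flow of the smooth field, which continues beyond the crossing.\<close>
  have solution_flow: "u (a + s) y = V s"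
    if l: "l \<in> {0..N}" and "0 \<le> a" "0 \<le> s" "s \<le> R"
      and d: "\<And>s. a < s \<Longrightarrow> s < a + R \<Longrightarrow> ((\<lambda>s. u s y) has_vector_derivative f l (u s y, y)) (at s)"
      and V: "\<And>s. (V has_vector_derivative f l (V s, y)) (at s)" "V 0 = u a y" for l a R V s y
  proof -
    obtain K where K: "K \<ge> 0" "\<And>x x'. norm (f l (x, y) - f l (x', y)) \<le> K * norm (x - x')"
      using f_Lip[OF l] by blast
    show ?thesis
    proof (rule solution_unique[where ?v1.0 = "\<lambda>s. u (a + s) y" and f = "\<lambda>x. f l (x, y)", OF K(2,1)])
      show "continuous_on {0..R} (\<lambda>s. u (a + s) y)"
        by (rule continuous_on_compose2[OF u_cont]) (use \<open>0 \<le> a\<close> in \<open>auto intro!: continuous_intros\<close>)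
      show "continuous_on {0..R} V"
        by (intro continuous_at_imp_continuous_on ballI has_vector_derivative_continuous[OF V(1)])
      show "((\<lambda>s. u (a + s) y) has_vector_derivative f l (u (a + s) y, y)) (at s)" if "0 < s" "s < R" for s
        using has_vector_derivative_affine[of "\<lambda>s. u s y" _ a 1 s, OF _] d[of "a + s"] that by simp
    qed (use that V in auto)
  qed
  have crossing: "bounded_C ?r (t i) \<and> bounded_C ?r (\<lambda>y. u (t i y) y)" if "0 \<le> i" "i \<le> N" for i
    using that
  proof (induction i rule: int_ge_induct)
    case base
    have "t 0 = (\<lambda>y. 0)" using t(1) by auto
    then show ?case using init uniform_C_const by simp
  next
    case (step i)
    then have IH: "bounded_C ?r (t i)" "bounded_C ?r (\<lambda>y. u (t i y) y)" and i: "i \<in> {0..N}" "i + 1 \<in> {1..N}"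
      by auto
    obtain K where K: "\<And>x x' y. norm (f i (x, y) - f i (x', y)) \<le> K * norm (x - x')" using f_Lip[OF i(1)] by blast
    have "\<forall>y. \<exists>x. x 0 = u (t i y) y \<and> (\<forall>s. (x has_vector_derivative f i (x s, y)) (at s))"
      using global_solution_exists[of "\<lambda>x. f i (x, y)" K for y] K by blast
    then obtain V where V: "\<And>y. V y 0 = u (t i y) y" "\<And>y s. (V y has_vector_derivative f i (V y s, y)) (at s)"
      by metis
    define \<tau> where "\<tau> = (\<lambda>y. t (i + 1) y - t i y)"
    have \<tau>_pos: "\<tau> y > 0" for y using t(2)[OF i(2), of y] by (simp add: \<tau>_def)
    have ti: "0 \<le> t i y" for y using t_mono[of 0 i y] i t(1) by simp
    have ti_T: "t (i + 1) y \<le> T" for y using t_mono[of "i + 1" N y] i tN_T[of y] by simp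
    have \<tau>_T: "\<tau> y \<le> T" for y using ti[of y] ti_T[of y] unfolding \<tau>_def by linarith
    have uV: "u (t i y + s) y = V y s" if "0 \<le> s" "s \<le> \<tau> y" for s y
    proof (rule solution_flow[OF i(1) ti that _ V(2,1)])
      show "((\<lambda>s. u s y) has_vector_derivative f i (u s y, y)) (at s)" if "t i y < s" "s < t i y + \<tau> y" for s
        using ode[OF i(2), of y s] that by (simp add: \<tau>_def)
    qed
    have uV1: "V y (\<tau> y) = u (t (i + 1) y) y" for y
      using uV[of "\<tau> y" y] \<tau>_pos[of y] by (simp add: \<tau>_def)
    have \<tau>: "bounded_C ?r \<tau>"
    proof (rule crossing_time_bounded_C[where U = "\<lambda>s y. V y s", OF f[OF i(1)] V(2) _ h \<tau>_pos \<tau>_T])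
      show "bounded_C ?r (\<lambda>y. V y 0)" using IH(2) V(1) by simp
      show "h (V y (\<tau> y), y) = c i" for y using hit[OF i(2), of y] by (simp add: uV1)
      show "h' (V y (\<tau> y), y) (f i (V y (\<tau> y), y), 0) \<ge> \<eta>" for y using trans(1)[OF i(2), of y] by (simp add: uV1)
      show "h (V y s, y) < c i" if "0 < s" "s < \<tau> y" for y s
        using below[OF i(2), of y "t i y + s"] uV[of s y] that by (simp add: \<tau>_def)
    qed (rule trans(2))
    have "bounded_C ?r (\<lambda>y. V y (\<tau> y))"
      by (rule flow_at_time_bounded_C[where U = "\<lambda>s y. V y s", OF f[OF i(1)] V(2) _ \<tau> _ T(1)])
         (use IH(2) V(1) \<tau>_T less_imp_le[OF \<tau>_pos] in auto)
    then have "bounded_C ?r (\<lambda>y. u (t (i + 1) y) y)" by (simp add: uV1)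
    moreover have "bounded_C ?r (\<lambda>y. t i y + \<tau> y)" by (rule uniform_C_add[OF IH(1) \<tau>])
    then have "bounded_C ?r (t (i + 1))" by (simp add: \<tau>_def)
    ultimately show ?case by simp
  qed
  have tN: "bounded_C ?r (t N)" "bounded_C ?r (\<lambda>y. u (t N y) y)" using crossing[of N] N by auto
  have tN_nonneg: "0 \<le> t N y" for y using t_mono[of 0 N y] N t(1) by simp
  have uN_u: "uN s y = u s y" if "s \<ge> t N y" for s y
  proof -
    have "u (t N y + (s - t N y)) y = uN (t N y + (s - t N y)) y"
    proof (rule solution_flow[where l = N and R = "s - t N y"])
      show "((\<lambda>s. u s y) has_vector_derivative f N (u s y, y)) (at s)" if "t N y < s" for s by (rule ode_last[OF that])
      show "((\<lambda>s. uN (t N y + s) y) has_vector_derivative f N (uN (t N y + s) y, y)) (at s)" for s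
        using has_vector_derivative_affine[of "\<lambda>s. uN s y" _ "t N y" 1 s, OF _] uN(1) by simp
    qed (use that N tN_nonneg uN(2) in auto)
    then show ?thesis by simp
  qed
  have uN_T: "bounded_C ?r (uN T)"
  proof -
    have "bounded_C ?r (\<lambda>y. uN (t N y + (T - t N y)) y)"
    proof (rule flow_at_time_bounded_C[where U = "\<lambda>s y. uN (t N y + s) y", OF fN _ _ _ _ T(1)])
      show "((\<lambda>s. uN (t N y + s) y) has_vector_derivative f N (uN (t N y + s) y, y)) (at s)" for s y
        using has_vector_derivative_affine[of "\<lambda>s. uN s y" _ "t N y" 1 s, OF _] uN(1) by simp
      show "bounded_C ?r (\<lambda>y. uN (t N y + 0) y)" using tN(2) by (simp add: uN(2))
      have "bounded_C ?r (\<lambda>y. T + - t N y)"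
        by (intro uniform_C_add uniform_C_const uniform_C_linear[OF bounded_linear_minus[OF bounded_linear_ident] tN(1)])
      then show "bounded_C ?r (\<lambda>y. T - t N y)" by simp
      show "\<bar>T - t N y\<bar> \<le> T" for y using tN_T[of y] tN_nonneg[of y] by simp
    qed
    then show ?thesis by simp
  qed
  have backward: "uniform_C ?r {0..R} (\<lambda>s. uN (T - s))" if "R \<ge> 0" for R
  proof (rule finite_time_uniform_C[where f = "\<lambda>p. - f N p"])
    show "bounded_C ?r (\<lambda>p. - f N p)"
      by (rule uniform_C_linear[OF bounded_linear_minus[OF bounded_linear_ident] fN])
    show "((\<lambda>s. uN (T - s) y) has_vector_derivative - f N (uN (T - s) y, y)) (at s within {0..R})" for s y
      using has_vector_derivative_at_within[OF has_vector_derivative_affine[of "\<lambda>s. uN s y" _ T "-1" s, OF uN(1)]] by simp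
  qed (use uN_T that in auto)
  have forward: "uniform_C ?r {0..} (\<lambda>s. uN (T + s))"
  proof (rule nonlinear_ode_uniform_C[OF _ _ less_imp_le[OF C(1)] fN fN' L(1,3)])
    have close: "norm (uN (T + s) y - w y) < \<rho>" if "s \<in> {0..}" for s y
      using uN_u[of y "T + s"] tN_T[of y] T(2)[of "T + s" y] that by simp
    show "stable_on {0..} (\<lambda>s v. fN' (uN (T + s) y, y) (v, 0)) C" for y
    proof (rule stable[OF _ hyp(2)[of y]]; intro allI impI)
      have "linear (\<lambda>v. fN' (w y, y) (v, 0))"
        by (rule has_derivative_linear[OF has_derivative_partial[OF fN']])
      then have A0: "matrix (\<lambda>v. fN' (w y, y) (v, 0)) *v x = fN' (w y, y) (x, 0)" for x
        by (rule fun_cong[OF matrix_vector_mul(2)])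
      show "norm (matrix (\<lambda>v. fN' (w y, y) (v, 0)) *v x) \<le> Kf * norm x" for x
        unfolding A0 using Kf(2)[of "(w y, y)" "(x, 0)"] by (simp add: norm_Pair)
      show "norm (fN' (uN (T + s) y, y) (x, 0) - matrix (\<lambda>v. fN' (w y, y) (v, 0)) *v x) \<le> \<epsilon> * norm x"
        if "s \<ge> 0" for s x
      proof -
        have "norm (fN' (uN (T + s) y, y) (x, 0) - fN' (w y, y) (x, 0))
            \<le> L * norm ((uN (T + s) y, y) - (w y, y)) * norm (x, 0::'e)" by (rule L(2))
        also have "\<dots> = L * norm (uN (T + s) y - w y) * norm x" by (simp add: norm_Pair)
        also have "\<dots> \<le> L * \<rho> * norm x"
          using close[of s y] that L by (intro mult_right_mono mult_left_mono) auto
        also have "\<dots> \<le> \<epsilon> * norm x" using \<rho>L by (intro mult_right_mono) auto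
        finally show ?thesis unfolding A0 .
      qed
    qed
    show "((\<lambda>s. uN (T + s) y) has_vector_derivative f N (uN (T + s) y, y)) (at s within {0..})" for s y
      using has_vector_derivative_at_within[OF has_vector_derivative_affine[of "\<lambda>s. uN s y" _ T 1 s, OF _]] uN(1) by simp
    have "norm (uN (T + s) y) \<le> W + \<rho>" if "s \<in> {0..}" for s y
      using norm_triangle_sub[of "uN (T + s) y" "w y"] w(1)[of y] close[OF that, of y] by linarith
    then show "uniformly_bounded {0..} (\<lambda>s. uN (T + s))" unfolding uniformly_bounded_def by blast
    show "uniform_C ?r {0..} (\<lambda>s. uN (T + 0))" using uniform_C_const_family[OF uN_T] by simp
    show "C * (L * (3 * \<rho>)) \<le> 1 / 2" by (rule \<rho>C)
    show "\<forall>\<^sub>F p in at y. \<forall>s\<in>{0..}. norm (uN (T + s) p - uN (T + s) y) \<le> 3 * \<rho>" for y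
    proof -
      have "(w \<longlongrightarrow> w y) (at y)" using w(2) by (simp add: continuous_on_eq_continuous_at isCont_def)
      from tendstoD[OF this \<rho>] show ?thesis
      proof eventually_elim
        case (elim p)
        show ?case
        proof
          fix s :: real assume s: "s \<in> {0..}"
          have "uN (T + s) p - uN (T + s) y = (uN (T + s) p - w p) + (w p - w y) - (uN (T + s) y - w y)" by simp
          also have "norm \<dots> \<le> norm (uN (T + s) p - w p) + norm (w p - w y) + norm (uN (T + s) y - w y)"
            by (intro norm_triangle_le_diff add_right_mono norm_triangle_ineq)
          also have "\<dots> \<le> 3 * \<rho>" using close[OF s, of p] close[OF s, of y] elim by (simp add: dist_norm)
          finally show "norm (uN (T + s) p - uN (T + s) y) \<le> 3 * \<rho>" .
        qed
      qed
    qed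
  qed auto
  have "C_class ?r (uN s)" for s
    using uniform_C_imp_C_class[OF backward[of "T - s"], of "T - s"] uniform_C_imp_C_class[OF forward, of "s - T"]
    by (cases "s \<le> T") auto
  moreover have "\<exists>K. \<forall>y s. s \<ge> t N y \<longrightarrow> nderiv_norm_le q (uN s) y K" if q: "q \<le> ?r" for q
  proof -
    obtain K1 where K1: "\<And>s y. s \<in> {0..T} \<Longrightarrow> nderiv_norm_le q (uN (T - s)) y K1"
      using uniform_C_imp_nderiv_norm_le[OF backward[OF less_imp_le[OF T(1)]] q] by blast
    obtain K2 where K2: "\<And>s y. s \<in> {0..} \<Longrightarrow> nderiv_norm_le q (uN (T + s)) y K2"
      using uniform_C_imp_nderiv_norm_le[OF forward q] by blast
    have "nderiv_norm_le q (uN s) y (max K1 K2)" if "s \<ge> t N y" for s y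
    proof (cases "s \<le> T")
      case True
      then have "nderiv_norm_le q (uN (T - (T - s))) y K1" using that tN_nonneg[of y] by (intro K1) auto
      then show ?thesis by (auto simp: nderiv_norm_le_def intro: order_trans)
    next
      case False
      then have "nderiv_norm_le q (uN (T + (s - T))) y K2" by (intro K2) auto
      then show ?thesis by (auto simp: nderiv_norm_le_def intro: order_trans)
    qed
    then show ?thesis by blast
  qed
  ultimately show ?thesis by blast
qed

section \<open>The theorem\<close>

lemma partial_x_eq:
  assumes "(g has_derivative g') (at (x, y))"
  shows "partial_x g (x, y) = (\<lambda>v. g' (v, 0))"
  unfolding partial_x_def using frechet_derivative_at[OF has_derivative_partial[OF assms]] by simp

lemma vector_derivative_at_left_ode:
  fixes v :: "real \<Rightarrow> 'b::euclidean_space"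
  assumes "a < b" "continuous_on {a..b} v" "continuous_on UNIV \<phi>"
    "\<And>s. a < s \<Longrightarrow> s < b \<Longrightarrow> (v has_vector_derivative \<phi> (v s)) (at s)"
  shows "vector_derivative v (at_left b) = \<phi> (v b)"
proof (rule vector_derivative_within)
  show "(v has_vector_derivative \<phi> (v b)) (at_left b)"
    using ode_derivative_closed_interval[OF assms(2,3,4), of b] assms(1) by (simp add: at_within_Icc_at_left)
qed simp

lemma vector_derivative_at_right_ode:
  fixes v :: "real \<Rightarrow> 'b::euclidean_space"
  assumes "a < b" "continuous_on {a..b} v" "continuous_on UNIV \<phi>"
    "\<And>s. a < s \<Longrightarrow> s < b \<Longrightarrow> (v has_vector_derivative \<phi> (v s)) (at s)"
  shows "vector_derivative v (at_right a) = \<phi> (v a)"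
proof (rule vector_derivative_within)
  show "(v has_vector_derivative \<phi> (v a)) (at_right a)"
    using ode_derivative_closed_interval[OF assms(2,3,4), of a] assms(1) by (simp add: at_within_Icc_at_right)
qed simp

text \<open>For the backward orbit, C_class_outer_orbit is applied to the reversed system: time s becomes -s, the fields
become - f (- i), the crossing times - t (- i), and h becomes - h, so that the reversed orbit again crosses
increasing thresholds. The threshold between the pieces i - 1 and i is c (- i) originally, which fixes the index
shift in the reversed thresholds - c (- i - 1). Reversal turns the right derivatives at the crossings into left ones.\<close>

theorem lemma4p2:
  fixes r k :: nat and M N :: int
    and c :: "int \<Rightarrow> real"
    and h :: "(real^'n::finite) \<times> (real^'m::finite) \<Rightarrow> real"
    and f :: "int \<Rightarrow> (real^'n) \<times> (real^'m) \<Rightarrow> real^'n"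
    and t :: "int \<Rightarrow> real^'m \<Rightarrow> real"
    and u_plus u_minus :: "real \<Rightarrow> real^'m \<Rightarrow> real^'n"
    and w_plus w_minus :: "real^'m \<Rightarrow> real^'n"
    and B :: "(real^'n) set"
    and \<eta> \<mu>\<^sub>0 \<delta>\<^sub>0 :: real
    and uN_plus uM_minus :: "real \<Rightarrow> real^'m \<Rightarrow> real^'n"
  assumes r: "r \<ge> 2" and M: "M \<ge> 1" and N: "N \<ge> 1"
    and c: "strict_mono_on {- M..N - 1} c"
    and h_smooth: "C_class r h"
    and h_bounded: "\<forall>q\<in>{1..r}. \<exists>K. \<forall>p. nderiv_norm_le q h p K"
    and f_smooth: "\<forall>l\<in>{- M..N}. C_class r (f l)"
    and f_bounded: "\<forall>l\<in>{- M..N}. \<forall>q\<le>r. \<exists>K. \<forall>p. nderiv_norm_le q (f l) p K"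
    and \<eta>: "\<eta> > 0"
    and t_mono: "\<forall>y. strict_mono_on {- M..N} (\<lambda>l. t l y)"
    and t_zero: "\<forall>y. t 0 y = 0"
    \<comment> \<open>the orbits for nonnegative times\<close>
    and up_pw: "\<forall>y. (\<lambda>s. u_plus s y) piecewise_C1_differentiable_on {0..}"
    and up_ode: "\<forall>y. \<forall>i\<in>{1..N}. \<forall>s. t (i - 1) y < s \<and> s < t i y \<longrightarrow>
       ((\<lambda>s. u_plus s y) has_vector_derivative f (i - 1) (u_plus s y, y)) (at s)"
    and up_ode_last: "\<forall>y. \<forall>s > t N y.
       ((\<lambda>s. u_plus s y) has_vector_derivative f N (u_plus s y, y)) (at s)"
    and up_hit: "\<forall>y. \<forall>i\<in>{1..N}. h (u_plus (t i y) y, y) = c (i - 1)"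
    and up_transversal: "\<forall>y. \<forall>i\<in>{1..N}.
       partial_x h (u_plus (t i y) y, y)
         (vector_derivative (\<lambda>s. u_plus s y) (at_left (t i y))) > 2 * \<eta> \<and>
       partial_x h (u_plus (t i y) y, y)
         (vector_derivative (\<lambda>s. u_plus s y) (at_right (t i y))) > 2 * \<eta>"
    and up_between: "\<forall>y. \<forall>i\<in>{0..N - 1}. \<forall>s. t i y < s \<and> s < t (i + 1) y \<longrightarrow>
       c (i - 1) < h (u_plus s y, y) \<and> h (u_plus s y, y) < c i"
    and up_last: "\<forall>y. \<forall>s > t N y. h (u_plus s y, y) > c (N - 1)"
    \<comment> \<open>the orbits for nonpositive times\<close>
    and um_pw: "\<forall>y. (\<lambda>s. u_minus s y) piecewise_C1_differentiable_on {..0}"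
    and um_ode: "\<forall>y. \<forall>j\<in>{- M..- 1}. \<forall>s. t j y < s \<and> s < t (j + 1) y \<longrightarrow>
       ((\<lambda>s. u_minus s y) has_vector_derivative f (j + 1) (u_minus s y, y)) (at s)"
    and um_ode_last: "\<forall>y. \<forall>s < t (- M) y.
       ((\<lambda>s. u_minus s y) has_vector_derivative f (- M) (u_minus s y, y)) (at s)"
    and um_hit: "\<forall>y. \<forall>j\<in>{- M..- 1}. h (u_minus (t j y) y, y) = c j"
    and um_transversal: "\<forall>y. \<forall>j\<in>{- M..- 1}.
       partial_x h (u_minus (t j y) y, y)
         (vector_derivative (\<lambda>s. u_minus s y) (at_left (t j y))) > 2 * \<eta> \<and>
       partial_x h (u_minus (t j y) y, y)
         (vector_derivative (\<lambda>s. u_minus s y) (at_right (t j y))) > 2 * \<eta>"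
    and um_between: "\<forall>y. \<forall>j\<in>{- M..- 1}. \<forall>s. t j y < s \<and> s < t (j + 1) y \<longrightarrow>
       c j < h (u_minus s y, y) \<and> h (u_minus s y, y) < c (j + 1)"
    and um_last: "\<forall>y. \<forall>s < t (- M) y. h (u_minus s y, y) < c (- M)"
    \<comment> \<open>(A1)\<close>
    and A1_smooth: "C_class r (\<lambda>y. u_plus 0 y)" "C_class r (\<lambda>y. u_minus 0 y)"
    and A1_bounded: "\<forall>q\<le>r. \<exists>K. \<forall>y. nderiv_norm_le q (\<lambda>y. u_plus 0 y) y K"
       "\<forall>q\<le>r. \<exists>K. \<forall>y. nderiv_norm_le q (\<lambda>y. u_minus 0 y) y K"
    and A1_B: "open B" "bounded B" "closure B \<times> UNIV \<subseteq> Omega M N c h 0"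
       "\<forall>y. u_plus 0 y \<in> B" "\<forall>y. u_minus 0 y \<in> B"
    \<comment> \<open>(A2)\<close>
    and A2_smooth: "C_class r w_plus" "C_class r w_minus"
    and A2_bounded: "bounded (range w_plus)" "bounded (range w_minus)"
    and A2_zero: "\<forall>y. f N (w_plus y, y) = 0" "\<forall>y. f (- M) (w_minus y, y) = 0"
    and A2_\<mu>\<^sub>0: "\<mu>\<^sub>0 > 0"
       "\<forall>y. h (w_plus y, y) - c (N - 1) > \<mu>\<^sub>0"
       "\<forall>y. h (w_minus y, y) - c (- M) < - \<mu>\<^sub>0"
    and A2_lim: "uniform_limit UNIV u_plus w_plus at_top"
       "uniform_limit UNIV u_minus w_minus at_bot"
    \<comment> \<open>(A3)\<close>
    and A3_\<delta>\<^sub>0: "\<delta>\<^sub>0 > 0"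
    and A3_k: "k \<le> CARD('n)"
    and A3: "\<forall>y. hyperbolic_splitting k \<delta>\<^sub>0 (matrix (partial_x (f N) (w_plus y, y)))"
       "\<forall>y. hyperbolic_splitting k \<delta>\<^sub>0 (matrix (partial_x (f (- M)) (w_minus y, y)))"
    \<comment> \<open>the solutions of the outermost equations through the last crossing points\<close>
    and uN_plus: "\<forall>y s. ((\<lambda>s. uN_plus s y) has_vector_derivative f N (uN_plus s y, y)) (at s)"
       "\<forall>y. uN_plus (t N y) y = u_plus (t N y) y"
    and uM_minus: "\<forall>y s. ((\<lambda>s. uM_minus s y) has_vector_derivative f (- M) (uM_minus s y, y)) (at s)"
       "\<forall>y. uM_minus (t (- M) y) y = u_minus (t (- M) y) y"
  shows "(\<forall>s. C_class r (\<lambda>y. uN_plus s y)) \<and>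
         (\<forall>q\<le>r. \<exists>K. \<forall>y s. s \<ge> t N y \<longrightarrow> nderiv_norm_le q (\<lambda>y. uN_plus s y) y K) \<and>
         (\<forall>s. C_class r (\<lambda>y. uM_minus s y)) \<and>
         (\<forall>q\<le>r. \<exists>K. \<forall>y s. s \<le> t (- M) y \<longrightarrow> nderiv_norm_le q (\<lambda>y. uM_minus s y) y K)"
proof -
  obtain q where q: "r = Suc (Suc q)" using r by (metis add_2_eq_Suc le_iff_add)
  have fC: "bounded_C (Suc (Suc q)) (f l)" if "l \<in> {- M..N}" for l
    using f_smooth f_bounded that unfolding q by (intro C_class_imp_bounded_C) auto
  let ?h' = "\<lambda>p. frechet_derivative h (at p)"
  have h': "(h has_derivative ?h' p) (at p)" for p
    using h_smooth C_class_SucD(1)[of "Suc q" h p] frechet_derivative_works unfolding q by blast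
  have h'C: "bounded_C (Suc q) (\<lambda>p. ?h' p v)" for v
    using h_smooth h_bounded unfolding q by (intro C_class_imp_bounded_C_derivative) auto
  have f_cont: "continuous_on UNIV (\<lambda>x. f l (x, y))" if "l \<in> {- M..N}" for l y
  proof -
    have "continuous_on UNIV (f l)"
      using f_smooth that by (auto simp: C_class_def dest!: bspec spec[of _ "[]"])
    then show ?thesis by (rule continuous_on_compose2) (auto intro!: continuous_intros)
  qed
  have up_cont: "continuous_on {0..} (\<lambda>s. u_plus s y)" and um_cont: "continuous_on {..0} (\<lambda>s. u_minus s y)" for y
    using up_pw um_pw by (auto simp: piecewise_C1_differentiable_on_def)
  have t_less: "t i y < t j y" if "- M \<le> i" "i < j" "j \<le> N" for i j y
    using t_mono that by (auto simp: strict_mono_on_def)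
  have t_nonneg: "0 \<le> t i y" if "0 \<le> i" "i \<le> N" for i y
    using t_less[of 0 i y] t_zero that M by (cases "i = 0") auto
  have t_nonpos: "t i y \<le> 0" if "- M \<le> i" "i \<le> 0" for i y
    using t_less[of i 0 y] t_zero that N by (cases "i = 0") auto
  have w_cont: "continuous_on UNIV w_plus" "continuous_on UNIV w_minus"
    using A2_smooth unfolding C_class_def by (metis le0 list.size(3) nderiv.simps(1))+
  obtain W where W: "\<And>y. norm (w_plus y) \<le> W" "\<And>y. norm (w_minus y) \<le> W"
  proof -
    obtain W1 W2 where "\<And>y. norm (w_plus y) \<le> W1" "\<And>y. norm (w_minus y) \<le> W2"
      using A2_bounded unfolding bounded_iff by auto
    then have "norm (w_plus y) \<le> max W1 W2" "norm (w_minus y) \<le> max W1 W2" for y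
      by (auto intro: le_max_iff_disj[THEN iffD2])
    then show thesis using that by blast
  qed
  have gap: "spectral_gap \<delta>\<^sub>0 (matrix (\<lambda>v. frechet_derivative (f l) (at (w y, y)) (v, 0)))"
    if "hyperbolic_splitting k \<delta>\<^sub>0 (matrix (partial_x (f l) (w y, y)))" and l: "l \<in> {- M..N}" for l w y
  proof -
    have "(f l has_derivative frechet_derivative (f l) (at (w y, y))) (at (w y, y))"
      using f_smooth C_class_SucD(1)[of "Suc q" "f l" "(w y, y)"] l frechet_derivative_works unfolding q by blast
    from partial_x_eq[OF this] show ?thesis
      using hyperbolic_splitting_imp_spectral_gap[OF that(1)] by simp
  qed
  have f': "(f l has_derivative frechet_derivative (f l) (at p)) (at p)" if "l \<in> {- M..N}" for l p
    using f_smooth C_class_SucD(1)[of "Suc q" "f l" p] that frechet_derivative_works unfolding q by blast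
  have u0C: "bounded_C (Suc (Suc q)) (u_plus 0)" "bounded_C (Suc (Suc q)) (u_minus 0)"
    using A1_smooth A1_bounded unfolding q by (auto intro!: C_class_imp_bounded_C)
  have plus: "(\<forall>s. C_class (Suc (Suc q)) (uN_plus s)) \<and>
    (\<forall>d\<le>Suc (Suc q). \<exists>K. \<forall>y s. s \<ge> t N y \<longrightarrow> nderiv_norm_le d (uN_plus s) y K)"
  proof (rule C_class_outer_orbit[where f = f and h = h and h' = ?h' and u = u_plus and c = c and w = w_plus and
        \<eta> = "2 * \<eta>" and \<mu> = \<mu>\<^sub>0 and \<delta> = \<delta>\<^sub>0 and W = W and fN' = "\<lambda>p. frechet_derivative (f N) (at p)"])
    fix i y assume i: "i \<in> {1..N}"
    show less: "t (i - 1) y < t i y" by (rule t_less) (use i M in auto)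
    have "vector_derivative (\<lambda>s. u_plus s y) (at_left (t i y)) = f (i - 1) (u_plus (t i y) y, y)"
    proof (rule vector_derivative_at_left_ode[OF less, where \<phi> = "\<lambda>x. f (i - 1) (x, y)"])
      show "continuous_on {t (i - 1) y..t i y} (\<lambda>s. u_plus s y)"
        by (rule continuous_on_subset[OF up_cont]) (use t_nonneg[of "i - 1" y] i in auto)
    qed (use f_cont[of "i - 1" y] up_ode i M in auto)
    then show "?h' (u_plus (t i y) y, y) (f (i - 1) (u_plus (t i y) y, y), 0) \<ge> 2 * \<eta>"
      using up_transversal i partial_x_eq[OF h', of "u_plus (t i y) y" y] by (metis less_imp_le)
    show "h (u_plus s y, y) < c (i - 1)" if "t (i - 1) y < s" "s < t i y" for s
      using up_between[rule_format, of "i - 1" y s] that i by simp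
  qed (use N M fC h' h'C t_zero up_cont up_ode up_ode_last up_hit \<eta> u0C W w_cont A2_\<mu>\<^sub>0 A2_lim f' A3_\<delta>\<^sub>0
        gap[of N w_plus] A3 uN_plus in auto)
  \<comment> \<open>The reversed orbit runs forward in time from 0.\<close>
  define v where "v = (\<lambda>s. u_minus (- s))"
  have minus: "(\<forall>s. C_class (Suc (Suc q)) (\<lambda>y. uM_minus (- s) y)) \<and>
    (\<forall>d\<le>Suc (Suc q). \<exists>K. \<forall>y s. s \<ge> - t (- M) y \<longrightarrow> nderiv_norm_le d (\<lambda>y. uM_minus (- s) y) y K)"
  proof (rule C_class_outer_orbit[where f = "\<lambda>i p. - f (- i) p" and h = "\<lambda>p. - h p" and h' = "\<lambda>p v. - ?h' p v"
        and u = v and c = "\<lambda>i. - c (- i - 1)" and w = w_minus and \<eta> = "2 * \<eta>" and \<mu> = \<mu>\<^sub>0 and \<delta> = \<delta>\<^sub>0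
        and W = W and fN' = "\<lambda>p v. - frechet_derivative (f (- M)) (at p) v" and N = M
        and t = "\<lambda>i y. - t (- i) y"])
    show "M \<ge> 1" by (rule M)
    show "bounded_C (Suc (Suc q)) (\<lambda>p. - f (- l) p)" if "l \<in> {0..M}" for l
      by (rule uniform_C_linear[OF bounded_linear_minus[OF bounded_linear_ident] fC]) (use that N in auto)
    show "((\<lambda>p. - h p) has_derivative (\<lambda>v. - ?h' p v)) (at p)" for p by (intro has_derivative_minus h')
    show "bounded_C (Suc q) (\<lambda>p. - ?h' p v)" for v
      by (rule uniform_C_linear[OF bounded_linear_minus[OF bounded_linear_ident] h'C])
    show "- t (- 0) y = 0" for y using t_zero by simp
    show "continuous_on {0..} (\<lambda>s. v s y)" for y
      unfolding v_def by (rule continuous_on_compose2[OF um_cont]) (auto intro!: continuous_intros)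
    have dv: "((\<lambda>s. v s y) has_vector_derivative - D) (at s)"
      if "((\<lambda>s. u_minus s y) has_vector_derivative D) (at (- s))" for D s y
      using has_vector_derivative_affine[of "\<lambda>s. u_minus s y" D 0 "- 1" s] that by (simp add: v_def)
    show "((\<lambda>s. v s y) has_vector_derivative - f (- M) (v s y, y)) (at s)" if "- t (- M) y < s" for y s
      unfolding v_def[THEN fun_cong, of s] using um_ode_last that by (intro dv) auto
    show "bounded_C (Suc (Suc q)) (v 0)" using u0C by (simp add: v_def)
    show "norm (w_minus y) \<le> W" for y by (rule W)
    show "continuous_on UNIV w_minus" by (rule w_cont)
    show "\<mu>\<^sub>0 > 0" by (rule A2_\<mu>\<^sub>0)
    show "- h (w_minus y, y) - - c (- (M - 1) - 1) > \<mu>\<^sub>0" for y using A2_\<mu>\<^sub>0(3)[rule_format, of y] by simp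
    show "uniform_limit UNIV v w_minus at_top"
      using A2_lim(2) unfolding v_def uniform_limit_iff at_top_mirror eventually_filtermap by simp
    show "((\<lambda>p. - f (- M) p) has_derivative (\<lambda>v. - frechet_derivative (f (- M)) (at p) v)) (at p)" for p
      by (intro has_derivative_minus f') (use M N in auto)
    show "\<delta>\<^sub>0 > 0" by (rule A3_\<delta>\<^sub>0)
    show "spectral_gap \<delta>\<^sub>0 (matrix (\<lambda>v. - frechet_derivative (f (- M)) (at (w_minus y, y)) (v, 0)))" for y
    proof -
      have "matrix (\<lambda>v. - frechet_derivative (f (- M)) (at (w_minus y, y)) (v, 0)) =
          - matrix (\<lambda>v. frechet_derivative (f (- M)) (at (w_minus y, y)) (v, 0))"
        by (simp add: matrix_def vec_eq_iff)
      then show ?thesis using spectral_gap_uminus[OF gap[of "- M" w_minus y]] A3(2) M N by simp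
    qed
    show "((\<lambda>s. uM_minus (- s) y) has_vector_derivative - f (- M) (uM_minus (- s) y, y)) (at s)" for y s
      using has_vector_derivative_affine[of "\<lambda>s. uM_minus s y" _ 0 "- 1" s, OF _] uM_minus(1) by simp
    show "uM_minus (- (- t (- M) y)) y = v (- t (- M) y) y" for y using uM_minus(2) by (simp add: v_def)
    show "2 * \<eta> > 0" using \<eta> by simp
    fix i y assume i: "i \<in> {1..M}"
    have j: "- i \<in> {- M..- 1}" using i by auto
    have less: "t (- i) y < t (- i + 1) y" by (rule t_less) (use i N in auto)
    then show "- t (- (i - 1)) y < - t (- i) y" by simp
    show "- h (v (- t (- i) y) y, y) = - c (- (i - 1) - 1)" using um_hit[rule_format, OF j, of y] by (simp add: v_def)
    have "vector_derivative (\<lambda>s. u_minus s y) (at_right (t (- i) y)) = f (- i + 1) (u_minus (t (- i) y) y, y)"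
    proof (rule vector_derivative_at_right_ode[OF less, where \<phi> = "\<lambda>x. f (- i + 1) (x, y)"])
      show "continuous_on {t (- i) y..t (- i + 1) y} (\<lambda>s. u_minus s y)"
        by (rule continuous_on_subset[OF um_cont]) (use t_nonpos[of "- i + 1" y] i in auto)
    qed (use f_cont[of "- i + 1" y] um_ode[rule_format, OF j] i N in auto)
    moreover have "?h' (u_minus (t (- i) y) y, y) (vector_derivative (\<lambda>s. u_minus s y) (at_right (t (- i) y)), 0) > 2 * \<eta>"
      using um_transversal[rule_format, OF j, of y] partial_x_eq[OF h', of "u_minus (t (- i) y) y" y] by simp
    ultimately have "?h' (u_minus (t (- i) y) y, y) (f (- i + 1) (u_minus (t (- i) y) y, y), 0) > 2 * \<eta>" by simp
    moreover have "- ?h' p (- x, 0) = ?h' p (x, 0)" for p and x :: "real^'n"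
      using linear_neg[OF has_derivative_linear[OF h'[of p]], of "(x, 0)"] by simp
    ultimately show "- ?h' (v (- t (- i) y) y, y) (- f (- (i - 1)) (v (- t (- i) y) y, y), 0) \<ge> 2 * \<eta>"
      by (simp add: v_def)
    fix s assume s: "- t (- (i - 1)) y < s" "s < - t (- i) y"
    then have s': "t (- i) y < - s" "- s < t (- i + 1) y" by auto
    show "((\<lambda>s. v s y) has_vector_derivative - f (- (i - 1)) (v s y, y)) (at s)"
      using dv[OF um_ode[rule_format, OF j conjI[OF s']]] by (simp add: v_def)
    show "- h (v s y, y) < - c (- (i - 1) - 1)"
      using um_between[rule_format, OF j conjI[OF s']] by (simp add: v_def)
  qed
  have "C_class (Suc (Suc q)) (uM_minus s)" for s
    using minus[THEN conjunct1, rule_format, of "- s"] by simp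
  moreover have "\<exists>K. \<forall>y s. s \<le> t (- M) y \<longrightarrow> nderiv_norm_le d (uM_minus s) y K" if d: "d \<le> Suc (Suc q)" for d
  proof -
    obtain K where K: "\<And>y s. s \<ge> - t (- M) y \<Longrightarrow> nderiv_norm_le d (\<lambda>y. uM_minus (- s) y) y K"
      using minus d by blast
    have "nderiv_norm_le d (uM_minus s) y K" if "s \<le> t (- M) y" for y s
      using K[of y "- s"] that by simp
    then show ?thesis by blast
  qed
  ultimately show ?thesis using plus unfolding q by blast
qed

end
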